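(* Let $G$ be a finite non-abelian group. The commuting graph $\Gamma(G)$ has maximum vertex degree $<4$ if and only if $G$ is isomorphic to one of the following groups: $S_3$, $D_{10}$, $A_4$, $\mathrm{GA}(1,5)$, $A_5$; $D_8$, $Q_8$; $D_{12}$, $C_3\rtimes C_4$, $\mathrm{SL}(2,3)$; $(C_4\times C_2)\rtimes C_2$, $C_4\rtimes C_4$, $C_8\rtimes C_2$, $D_8\times C_2$, $Q_8\times C_2$, $D_8\circ_{C_2}C_4$.
   Context: For a finite non-abelian group $G$ with center $Z(G)$, the commuting graph $\Gamma(G)$ is the simple graph whose vertex set is $G\setminus Z(G)$ and in which two distinct vertices $x,y$ are adjacent if and only if $xy=yx$. Notation for groups: $C_n$ is the cyclic group of order $n$; $D_{2n}$ is the dihedral group of order $2n$ (so $D_8,D_{10},D_{12}$ have orders $8,10,12$); $Q_8$ is the quaternion group of order 8; $S_3$, $A_4$, $A_5$ are symmetric and alternating groups; $\mathrm{GA}(1,5)$ is the group of all affine maps $t\mapsto at+b$ ($a\in\mathbb{F}_5^\times$, $b\in\mathbb{F}_5$) of $\mathbb{F}_5$, of order 20; $\mathrm{SL}(2,3)$ is the group of $2\times 2$ matrices of determinant 1 over $\mathbb{F}_3$. $C_3\rtimes C_4$ is the semidirect product in which a generator of $C_4$ acts on $C_3$ by inversion. The groups $(C_4\times C_2)\rtimes C_2$, $C_4\rtimes C_4$, $C_8\rtimes C_2$ denote the following non-abelian groups of order 16 with center of order 4: $(C_4\times C_2)\rtimes C_2=\langle a,b,c\mid a^4=b^2=c^2=1,\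 ab=ba,\ bc=cb,\ cac^{-1}=ab\rangle$; $C_4\rtimes C_4=\langle a,b\mid a^4=b^4=1,\ bab^{-1}=a^{-1}\rangle$; $C_8\rtimes C_2=\langle a,b\mid a^8=b^2=1,\ bab^{-1}=a^5\rangle$. $D_8\circ_{C_2}C_4$ is the central product of $D_8$ and $C_4$ over $C_2$, i.e. the quotient of $D_8\times C_4$ identifying the center of $D_8$ with the subgroup of order 2 of $C_4$. *)

theory Defs
  imports "HOL-Analysis.Analysis" "HOL-Algebra.Algebra"
begin

text \<open>A simple graph is a pair of a vertex set and a set of two-element sets of vertices.\<close>

type_synonym 'v simple_graph = "'v set \<times> 'v set set"

definition degree_at :: "'v simple_graph \<Rightarrow> 'v \<Rightarrow> nat" where
  "degree_at \<Gamma> v = card {e \<in> snd \<Gamma>. v \<in> e}"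

definition max_degree :: "'v simple_graph \<Rightarrow> nat" where
  "max_degree \<Gamma> = Max (degree_at \<Gamma> ` fst \<Gamma>)"

definition center :: "('a, 'm) monoid_scheme \<Rightarrow> 'a set" where
  "center G = {z \<in> carrier G. \<forall>g \<in> carrier G. z \<otimes>\<^bsub>G\<^esub> g = g \<otimes>\<^bsub>G\<^esub> z}"

definition commuting_graph :: "('a, 'm) monoid_scheme \<Rightarrow> 'a simple_graph" where
  "commuting_graph G =
     (carrier G - center G,
      {{x, y} | x y. x \<in> carrier G - center G \<and> y \<in> carrier G - center G \<and>
                     x \<noteq> y \<and> x \<otimes>\<^bsub>G\<^esub> y = y \<otimes>\<^bsub>G\<^esub> x})"

definition semidirect_product ::
  "('a, 'm) monoid_scheme \<Rightarrow> ('b, 'n) monoid_scheme \<Rightarrow> ('b \<Rightarrow> 'a \<Rightarrow> 'a) \<Rightarrow> ('a \<times> 'b) monoid" where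
  "semidirect_product N H \<phi> =
     \<lparr>carrier = carrier N \<times> carrier H,
      monoid.mult = (\<lambda>(n, h) (n', h'). (n \<otimes>\<^bsub>N\<^esub> \<phi> h n', h \<otimes>\<^bsub>H\<^esub> h')),
      one = (\<one>\<^bsub>N\<^esub>, \<one>\<^bsub>H\<^esub>)\<rparr>"

text \<open>The semidirect product of cyclic groups of order \<open>n\<close> and \<open>m\<close> (with \<open>m\<close> even) in which the
  generator \<open>1\<close> of the second factor acts on the first by inversion; hence \<open>k\<close> acts as the
  \<open>k\<close>-th power of inversion.\<close>

definition inversion_semidirect :: "nat \<Rightarrow> nat \<Rightarrow> (int \<times> int) monoid" where
  "inversion_semidirect n m =
     semidirect_product (integer_mod_group n) (integer_mod_group m)
       (\<lambda>k x. if even k then x else inv\<^bsub>integer_mod_group n\<^esub> x)"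

text \<open>The index is half of the order: \<open>dihedral_group n\<close> is the group usually called
  \<open>D\<close> with subscript \<open>2n\<close>.\<close>

definition dihedral_group :: "nat \<Rightarrow> (int \<times> int) monoid" where
  "dihedral_group n = inversion_semidirect n 2"

text \<open>In \<open>dihedral_group 4\<close> the nontrivial central element is the half turn \<open>(2, 0)\<close>; it is
  identified with the element \<open>2\<close> of order two in the cyclic group of order four (which is its
  own inverse, so the subgroup factored out is the one below).\<close>

definition D8_central_product_C4 :: "((int \<times> int) \<times> int) set monoid" where
  "D8_central_product_C4 =
     (dihedral_group 4 \<times>\<times> integer_mod_group 4) Mod {((0, 0), 0), ((2, 0), 2)}"

text \<open>\<open>(a, b, c, d)\<close> stands for the quaternion \<open>a + bi + cj + dk\<close>.\<close>

fun quaternion_mult ::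
  "int \<times> int \<times> int \<times> int \<Rightarrow> int \<times> int \<times> int \<times> int \<Rightarrow> int \<times> int \<times> int \<times> int" where
  "quaternion_mult (a, b, c, d) (a', b', c', d') =
     (a * a' - b * b' - c * c' - d * d',
      a * b' + b * a' + c * d' - d * c',
      a * c' - b * d' + c * a' + d * b',
      a * d' + b * c' - c * b' + d * a')"

definition quaternion_group :: "(int \<times> int \<times> int \<times> int) monoid" where
  "quaternion_group =
     \<lparr>carrier = {(1, 0, 0, 0), (-1, 0, 0, 0), (0, 1, 0, 0), (0, -1, 0, 0),
                 (0, 0, 1, 0), (0, 0, -1, 0), (0, 0, 0, 1), (0, 0, 0, -1)},
      monoid.mult = quaternion_mult,
      one = (1, 0, 0, 0)\<rparr>"

text \<open>The numeral types \<open>3\<close> and \<open>5\<close> are the rings of integers modulo 3 and modulo 5, i.e. the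
  prime fields with three and five elements.\<close>

definition GA_1_5 :: "(5 \<Rightarrow> 5) monoid" where
  "GA_1_5 =
     \<lparr>carrier = {(\<lambda>t. a * t + b) | a b. a \<noteq> 0}, monoid.mult = (\<circ>), one = id\<rparr>"

definition SL_2_3 :: "(3^2^2) monoid" where
  "SL_2_3 = \<lparr>carrier = {A. det A = 1}, monoid.mult = (**), one = mat 1\<rparr>"

text \<open>Generators are all the elements of the type \<open>'x\<close>; a word is a list of generators and
  formal inverses of generators, and a relation \<open>l = r\<close> is the pair \<open>(l, r)\<close> of words. The
  presented group consists of the words modulo the least congruence that contains free
  cancellation and the relations.\<close>

datatype 'x letter = Gen 'x | Inv 'x

type_synonym 'x group_word = "'x letter list"

inductive word_eq :: "('x group_word \<times> 'x group_word) set \<Rightarrow> 'x group_word \<Rightarrow> 'x group_word \<Rightarrow> bool"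
  for R where
  word_refl: "word_eq R u u"
| word_sym: "word_eq R u v \<Longrightarrow> word_eq R v u"
| word_trans: "word_eq R u v \<Longrightarrow> word_eq R v w \<Longrightarrow> word_eq R u w"
| word_cancel_right: "word_eq R (u @ [Gen x, Inv x] @ v) (u @ v)"
| word_cancel_left: "word_eq R (u @ [Inv x, Gen x] @ v) (u @ v)"
| word_relation: "(l, r) \<in> R \<Longrightarrow> word_eq R (u @ l @ v) (u @ r @ v)"

definition presented_group ::
  "('x group_word \<times> 'x group_word) set \<Rightarrow> 'x group_word set monoid" where
  "presented_group R =
     \<lparr>carrier = UNIV // {(u, v). word_eq R u v},
      monoid.mult = (\<lambda>P Q. {w. \<exists>u \<in> P. \<exists>v \<in> Q. word_eq R (u @ v) w}),
      one = {w. word_eq R [] w}\<rparr>"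

definition C4xC2_semidirect_C2 :: "3 group_word set monoid" where
  "C4xC2_semidirect_C2 =
     (let a = Gen 0; b = Gen 1; c = Gen 2; c' = Inv 2
      in presented_group
           {([a, a, a, a], []), ([b, b], []), ([c, c], []),
            ([a, b], [b, a]), ([b, c], [c, b]), ([c, a, c'], [a, b])})"

definition C4_semidirect_C4 :: "2 group_word set monoid" where
  "C4_semidirect_C4 =
     (let a = Gen 0; b = Gen 1; a' = Inv 0; b' = Inv 1
      in presented_group
           {([a, a, a, a], []), ([b, b, b, b], []), ([b, a, b'], [a'])})"

definition C8_semidirect_C2 :: "2 group_word set monoid" where
  "C8_semidirect_C2 =
     (let a = Gen 0; b = Gen 1; b' = Inv 1
      in presented_group
           {([a, a, a, a, a, a, a, a], []), ([b, b], []), ([b, a, b'], [a, a, a, a, a])})"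

end

theory Submission
  imports Defs
begin

text \<open>A noncentral element \<open>v\<close> has degree \<open>card (centralizer G v) - card (center G) - 1\<close> in the
  commuting graph. So the maximum degree is below four if and only if every noncentral centralizer
  has at most four elements more than the center (\<open>small_centralizers\<close>). As the center is a proper
  subgroup of such a centralizer, it has at most four elements.

  Under this bound a noncentral centralizer is abelian, because a nonabelian one would contain
  too many cosets of the center (\<open>four_cosets\<close>). Hence the centralizers, with the center removed,
  partition the noncentral elements, and the number of elements with centralizer of order \<open>c\<close> is a
  multiple of \<open>c - card (center G)\<close>. It is also a multiple of \<open>order G / c\<close>, the size of their
  conjugacy classes. These conditions turn the class equation into an equation between unit
  fractions with very few solutions. A trivial center leaves the orders 6, 10, 12, 20 and 60, and a
  center of order two the orders 8, 12 and 24. If the center has order three or four, all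
  squares are central and the commutator is a bilinear map into the elements of order two of the
  center. This excludes order three, and for order four it excludes the order 32 that the class
  equation admits besides 16.

  The groups are identified in two ways. The symmetric group of degree three and the alternating
  groups of degree four and five come from faithful conjugation actions on three elements, four
  elements and five subgroups. For all others the proof finds generators that satisfy
  certain relations. The presented group is polycyclic, so that collecting words bounds its order
  (\<open>generate_cyclic_extension\<close>), and a group of exactly this order satisfying the relations is
  determined up to isomorphism (\<open>iso_by_presentation\<close>). For \<open>GA_1_5\<close> and \<open>SL_2_3\<close> the
  centralizers are computed, and generators satisfying the relations then come from the
  classification itself.

  Conversely, since a proper centralizer has at most half of the elements, the bound holds whenever
  \<open>order G \<le> 2 * card (center G) + 8\<close>. This covers all groups except the alternating groups, \<open>GA_1_5\<close>
  and \<open>SL_2_3\<close>. For the alternating groups the reason is that commuting nontrivial even permutations of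
  five points have the same fixed points.\<close>

section \<open>Centralizers and the degree of a vertex\<close>

definition centralizer :: "('a, 'm) monoid_scheme \<Rightarrow> 'a \<Rightarrow> 'a set" where
  "centralizer G v = {w \<in> carrier G. w \<otimes>\<^bsub>G\<^esub> v = v \<otimes>\<^bsub>G\<^esub> w}"

text \<open>The bound on the degrees without reference to the graph. As a property of the multiplication
  it is invariant under isomorphism.\<close>

definition small_centralizers :: "('a, 'm) monoid_scheme \<Rightarrow> bool" where
  "small_centralizers G \<longleftrightarrow>
     (\<forall>v \<in> carrier G - center G. card (centralizer G v) \<le> card (center G) + 4)"

lemma center_subset_centralizer: "v \<in> carrier G \<Longrightarrow> center G \<subseteq> centralizer G v"
  by (auto simp: center_def centralizer_def)

lemma centralizer_subset: "centralizer G v \<subseteq> carrier G"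
  by (auto simp: centralizer_def)

lemma center_subset: "center G \<subseteq> carrier G"
  by (auto simp: center_def)

text \<open>The neighbours of \<open>v\<close> are the noncentral elements of its centralizer apart from \<open>v\<close> itself,
  which accounts for the summand 1.\<close>

lemma degree_at_commuting_graph:
  assumes "finite (carrier G)" and "v \<in> carrier G - center G"
  shows "degree_at (commuting_graph G) v + card (center G) + 1 = card (centralizer G v)"
proof -
  let ?N = "centralizer G v - center G - {v}"
  have fin: "finite (centralizer G v)"
    using assms(1) by (rule finite_subset[OF centralizer_subset])
  have "{e \<in> snd (commuting_graph G). v \<in> e} = (\<lambda>w. {v, w}) ` ?N"
  proof (intro equalityI subsetI)
    fix e assume e: "e \<in> {e \<in> snd (commuting_graph G). v \<in> e}"
    then obtain x y where xy: "e = {x, y}" "x \<in> carrier G - center G" "y \<in> carrier G - center G"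
      "x \<noteq> y" "x \<otimes>\<^bsub>G\<^esub> y = y \<otimes>\<^bsub>G\<^esub> x" "v = x \<or> v = y"
      by (auto simp: commuting_graph_def)
    from xy(6) show "e \<in> (\<lambda>w. {v, w}) ` ?N"
    proof
      assume "v = x" thus ?thesis using xy by (auto simp: centralizer_def)
    next
      assume "v = y"
      hence "e = {v, x}" "x \<in> ?N" using xy by (auto simp: centralizer_def)
      thus ?thesis by blast
    qed
  next
    fix e assume "e \<in> (\<lambda>w. {v, w}) ` ?N"
    then obtain w where w: "e = {v, w}" "w \<in> ?N" by blast
    have "w \<in> carrier G - center G" "v \<noteq> w" "v \<otimes>\<^bsub>G\<^esub> w = w \<otimes>\<^bsub>G\<^esub> v"
      using w by (auto simp: centralizer_def)
    thus "e \<in> {e \<in> snd (commuting_graph G). v \<in> e}"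
      using assms(2) w(1) unfolding commuting_graph_def by auto
  qed
  moreover have "inj_on (\<lambda>w. {v, w}) ?N"
    by (auto simp: inj_on_def doubleton_eq_iff)
  ultimately have "degree_at (commuting_graph G) v = card ?N"
    by (simp add: degree_at_def card_image)
  moreover have "insert v (center G) \<subseteq> centralizer G v" "v \<notin> center G"
    using assms(2) center_subset_centralizer[of v G] by (auto simp: centralizer_def)
  hence "card ?N + card (insert v (center G)) = card (centralizer G v)"
    using fin by (metis Diff_insert card_Diff_subset card_mono finite_subset le_add_diff_inverse2)
  moreover have "card (insert v (center G)) = card (center G) + 1"
    using \<open>v \<notin> center G\<close> assms(1) finite_subset[OF center_subset] by (metis Suc_eq_plus1 card_insert_disjoint)
  ultimately show ?thesis by simp
qed

lemma comm_group_iff_center: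
  assumes "group G" shows "comm_group G \<longleftrightarrow> center G = carrier G"
proof
  assume "comm_group G"
  then interpret comm_group G .
  show "center G = carrier G" by (auto simp: center_def m_comm)
next
  assume "center G = carrier G"
  hence "x \<otimes>\<^bsub>G\<^esub> y = y \<otimes>\<^bsub>G\<^esub> x" if "x \<in> carrier G" "y \<in> carrier G" for x y
  proof -
    have "x \<in> center G" using that(1) \<open>center G = carrier G\<close> by simp
    thus ?thesis using that(2) by (simp add: center_def)
  qed
  thus "comm_group G"
    by (rule group.group_comm_groupI[OF assms])
qed

lemma max_degree_commuting_graph_less_4_iff:
  assumes "group G" and "finite (carrier G)" and "\<not> comm_group G"
  shows "max_degree (commuting_graph G) < 4 \<longleftrightarrow> small_centralizers G"
proof -
  have "carrier G - center G \<noteq> {}"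
    using comm_group_iff_center[OF assms(1)] assms(3) center_subset[of G] by auto
  moreover have "fst (commuting_graph G) = carrier G - center G"
    by (simp add: commuting_graph_def)
  ultimately have "max_degree (commuting_graph G) < 4 \<longleftrightarrow>
      (\<forall>v \<in> carrier G - center G. degree_at (commuting_graph G) v < 4)"
    using assms(2) by (simp add: max_degree_def)
  also have "\<dots> \<longleftrightarrow> small_centralizers G"
    unfolding small_centralizers_def
    using degree_at_commuting_graph[OF assms(2)] by (intro ball_cong refl) fastforce
  finally show ?thesis .
qed

lemma (in group) iso_centralizer:
  assumes "h \<in> iso G H" and "v \<in> carrier G"
  shows "h ` centralizer G v = centralizer H (h v)"
proof -
  have inj: "inj_on h (carrier G)" and onto: "h ` carrier G = carrier H"
    and hom: "\<And>x y. x \<in> carrier G \<Longrightarrow> y \<in> carrier G \<Longrightarrow> h (x \<otimes> y) = h x \<otimes>\<^bsub>H\<^esub> h y"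
    using assms(1) by (auto simp: iso_def hom_def bij_betw_def)
  have "h x \<otimes>\<^bsub>H\<^esub> h v = h v \<otimes>\<^bsub>H\<^esub> h x \<longleftrightarrow> x \<otimes> v = v \<otimes> x" if "x \<in> carrier G" for x
    using that assms(2) hom inj_on_eq_iff[OF inj] by (metis m_closed)
  moreover have "centralizer H (h v) = {y \<in> h ` carrier G. y \<otimes>\<^bsub>H\<^esub> h v = h v \<otimes>\<^bsub>H\<^esub> y}"
    by (simp add: onto centralizer_def)
  ultimately show ?thesis by (auto simp: centralizer_def)
qed

lemma (in group) iso_center:
  assumes "h \<in> iso G H"
  shows "h ` center G = center H"
proof -
  have onto: "h ` carrier G = carrier H"
    using assms by (auto simp: iso_def bij_betw_def)
  have "x \<in> center G \<longleftrightarrow> h x \<in> center H" if x: "x \<in> carrier G" for x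
  proof -
    have "x \<in> center G \<longleftrightarrow> (\<forall>g \<in> carrier G. x \<in> centralizer G g)"
      using x by (auto simp: center_def centralizer_def)
    also have "\<dots> \<longleftrightarrow> (\<forall>g \<in> carrier G. h x \<in> centralizer H (h g))"
    proof (intro ball_cong refl)
      fix g assume "g \<in> carrier G"
      have "inj_on h (carrier G)" using assms by (auto simp: iso_def bij_betw_def)
      hence "x \<in> centralizer G g \<longleftrightarrow> h x \<in> h ` centralizer G g"
        using x by (simp add: inj_on_image_mem_iff centralizer_subset)
      thus "x \<in> centralizer G g \<longleftrightarrow> h x \<in> centralizer H (h g)"
        using iso_centralizer[OF assms \<open>g \<in> carrier G\<close>] by simp
    qed
    also have "\<dots> \<longleftrightarrow> h x \<in> center H"
    proof -
      have "h x \<in> carrier H" using x onto by blast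
      hence "h x \<in> center H \<longleftrightarrow> (\<forall>g \<in> carrier H. h x \<in> centralizer H g)"
        by (auto simp: center_def centralizer_def)
      thus ?thesis unfolding onto[symmetric] by simp
    qed
    finally show ?thesis .
  qed
  hence "center G = {x \<in> carrier G. h x \<in> center H}" using center_subset[of G] by auto
  moreover have "center H \<subseteq> h ` carrier G" unfolding onto by (rule center_subset)
  ultimately show ?thesis by auto
qed

lemma (in group) card_center_iso:
  assumes "G \<cong> H" shows "card (center H) = card (center G)"
proof -
  obtain h where h: "h \<in> iso G H" using assms by (auto simp: is_iso_def)
  hence "inj_on h (center G)"
    using center_subset[of G] by (auto simp: iso_def bij_betw_def intro: inj_on_subset)
  thus ?thesis using iso_center[OF h] card_image by metis
qed

lemma (in group) small_centralizers_iso: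
  assumes "G \<cong> H" shows "small_centralizers H \<longleftrightarrow> small_centralizers G"
proof -
  obtain h where h: "h \<in> iso G H" using assms by (auto simp: is_iso_def)
  have inj: "inj_on h (carrier G)" and onto: "h ` carrier G = carrier H"
    using h by (auto simp: iso_def bij_betw_def)
  have "h ` (carrier G - center G) = carrier H - center H"
    using iso_center[OF h] onto inj_on_image_set_diff[OF inj, of "carrier G" "center G"]
    by (simp add: center_subset)
  hence "carrier H - center H = h ` (carrier G - center G)" by simp
  moreover have "card (centralizer H (h v)) = card (centralizer G v)" if "v \<in> carrier G" for v
    using iso_centralizer[OF h that] card_image[OF inj_on_subset[OF inj centralizer_subset]] by metis
  ultimately show ?thesis
    unfolding small_centralizers_def card_center_iso[OF assms] by simp
qed

section \<open>Counting in finite groups\<close>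

lemma (in group) commutes_mult:
  assumes "a \<otimes> g = g \<otimes> a" and "b \<otimes> g = g \<otimes> b"
    and c: "a \<in> carrier G" "b \<in> carrier G" "g \<in> carrier G"
  shows "(a \<otimes> b) \<otimes> g = g \<otimes> (a \<otimes> b)"
proof -
  have "(a \<otimes> b) \<otimes> g = a \<otimes> (b \<otimes> g)" using c by (rule m_assoc)
  also have "\<dots> = a \<otimes> (g \<otimes> b)" using assms(2) by simp
  also have "\<dots> = (a \<otimes> g) \<otimes> b" using c by (simp only: m_assoc)
  also have "\<dots> = (g \<otimes> a) \<otimes> b" using assms(1) by simp
  also have "\<dots> = g \<otimes> (a \<otimes> b)" using c by (simp only: m_assoc)
  finally show ?thesis .
qed

locale finite_group = group +
  assumes finite_carrier: "finite (carrier G)"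
begin

lemma center_subgroup: "subgroup (center G) G"
proof (rule subgroupI)
  show "center G \<noteq> {}" by (auto simp: center_def)
next
  fix a assume "a \<in> center G"
  hence a: "a \<in> carrier G" "\<And>g. g \<in> carrier G \<Longrightarrow> a \<otimes> g = g \<otimes> a" by (auto simp: center_def)
  have "inv a \<otimes> g = g \<otimes> inv a" if g: "g \<in> carrier G" for g
  proof -
    have "inv (a \<otimes> inv g) = inv (inv g \<otimes> a)" using a(2)[of "inv g"] g by simp
    thus ?thesis using a(1) g by (simp add: inv_mult_group)
  qed
  thus "inv a \<in> center G" using a by (auto simp: center_def)
next
  fix a b assume ab: "a \<in> center G" "b \<in> center G"
  have "a \<otimes> b \<otimes> g = g \<otimes> (a \<otimes> b)" if g: "g \<in> carrier G" for g
    using ab g by (intro commutes_mult) (auto simp: center_def)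
  moreover have "a \<in> carrier G" "b \<in> carrier G" using ab center_subset[of G] by auto
  ultimately show "a \<otimes> b \<in> center G" unfolding center_def by blast
qed (auto simp: center_def)

lemma centralizer_subgroup:
  assumes v: "v \<in> carrier G" shows "subgroup (centralizer G v) G"
proof (rule subgroupI)
  show "centralizer G v \<noteq> {}" using v by (auto simp: centralizer_def)
next
  fix a assume "a \<in> centralizer G v"
  hence a: "a \<in> carrier G" "a \<otimes> v = v \<otimes> a" by (auto simp: centralizer_def)
  have "inv a \<otimes> v = inv a \<otimes> (v \<otimes> a) \<otimes> inv a" using a(1) v by (simp add: m_assoc)
  also have "\<dots> = inv a \<otimes> (a \<otimes> v) \<otimes> inv a" using a(2) by simp
  also have "\<dots> = v \<otimes> inv a" using a(1) v by (simp flip: m_assoc)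
  finally have "inv a \<otimes> v = v \<otimes> inv a" .
  thus "inv a \<in> centralizer G v" using a by (auto simp: centralizer_def)
next
  fix a b assume ab: "a \<in> centralizer G v" "b \<in> centralizer G v"
  hence c: "a \<in> carrier G" "b \<in> carrier G" "a \<otimes> v = v \<otimes> a" "b \<otimes> v = v \<otimes> b"
    by (auto simp: centralizer_def)
  have "a \<otimes> b \<otimes> v = v \<otimes> (a \<otimes> b)" using c v by (intro commutes_mult)
  thus "a \<otimes> b \<in> centralizer G v" using c by (auto simp: centralizer_def)
qed (auto simp: centralizer_def)

lemma finite_subset_carrier: "A \<subseteq> carrier G \<Longrightarrow> finite A"
  using finite_carrier finite_subset by blast

lemma card_subgroup_dvd:
  assumes "subgroup H G" and "subgroup K G" and "H \<subseteq> K"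
  shows "card H dvd card K"
proof -
  interpret K: group "G\<lparr>carrier := K\<rparr>" by (rule subgroup_imp_group[OF assms(2)])
  have "subgroup H (G\<lparr>carrier := K\<rparr>)" using subgroup_incl assms by blast
  from K.lagrange[OF this] have "card K = card (rcosets\<^bsub>G\<lparr>carrier := K\<rparr>\<^esub> H) * card H"
    by (simp add: order_def)
  thus ?thesis by simp
qed

lemma card_subgroup_dvd_order: "subgroup H G \<Longrightarrow> card H dvd order G"
  using lagrange by (metis dvd_triv_right)

lemma card_subgroup_pos: "subgroup H G \<Longrightarrow> 0 < card H"
  using finite_subset_carrier[OF subgroup.subset] subgroup.one_closed[of H G] by (auto simp: card_gt_0_iff)

lemma proper_subgroup_card:
  assumes "subgroup H G" and "subgroup K G" and "H \<subset> K"
  shows "2 * card H \<le> card K"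
proof -
  obtain k where k: "card K = card H * k"
    using card_subgroup_dvd assms by blast
  have "card H < card K"
    using assms(3) psubset_card_mono finite_subset_carrier subgroup.subset[OF assms(2)] by blast
  hence "k \<noteq> 0" "k \<noteq> 1" using k by auto
  hence "2 \<le> k" by linarith
  thus ?thesis using k by simp
qed

lemma noncentral_centralizer:
  assumes v: "v \<in> carrier G - center G"
  shows "2 * card (center G) \<le> card (centralizer G v)"
    and "2 * card (centralizer G v) \<le> order G"
    and "v \<in> centralizer G v" and "subgroup (centralizer G v) G"
    and "center G \<subseteq> centralizer G v"
    and "card (center G) dvd card (centralizer G v)"
    and "card (centralizer G v) dvd order G"
proof -
  show s: "subgroup (centralizer G v) G" using centralizer_subgroup v by blast
  show vin: "v \<in> centralizer G v" using v by (auto simp: centralizer_def)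
  show zc: "center G \<subseteq> centralizer G v" using v by (intro center_subset_centralizer) simp
  show "2 * card (center G) \<le> card (centralizer G v)"
    using proper_subgroup_card[OF center_subgroup s] zc vin v by blast
  obtain g where g: "g \<in> carrier G" "v \<otimes> g \<noteq> g \<otimes> v" using v by (auto simp: center_def)
  hence "g \<notin> centralizer G v" by (auto simp: centralizer_def)
  hence "centralizer G v \<noteq> carrier G" using g(1) by blast
  hence "centralizer G v \<subset> carrier G" using centralizer_subset[of G v] by blast
  thus "2 * card (centralizer G v) \<le> order G"
    using proper_subgroup_card[OF s subgroup_self] by (simp add: order_def)
  show "card (center G) dvd card (centralizer G v)"
    using card_subgroup_dvd[OF center_subgroup s zc] .
  show "card (centralizer G v) dvd order G"
    using card_subgroup_dvd_order[OF s] .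
qed

text \<open>The elements that commute with both \<open>x\<close> and \<open>y\<close> form a subgroup, and the cosets of this
  subgroup represented by \<open>\<one>\<close>, \<open>x\<close>, \<open>y\<close> and \<open>x \<otimes> y\<close> are distinct.\<close>

lemma four_cosets:
  fixes x y :: 'a and M :: "'a set"
  defines "U \<equiv> (\<lambda>m. x \<otimes> y \<otimes> m) ` M \<union> ((\<lambda>m. y \<otimes> m) ` M \<union> ((\<lambda>m. x \<otimes> m) ` M \<union> M))"
  assumes K: "subgroup K G" and M: "M \<subseteq> K" and x: "x \<in> K" and y: "y \<in> K"
    and xy: "x \<otimes> y \<noteq> y \<otimes> x" and Mx: "M \<subseteq> centralizer G x" and My: "M \<subseteq> centralizer G y"
  shows "card U = 4 * card M" and "U \<subseteq> K" and "4 * card M \<le> card K"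
proof -
  note Kc = subgroup.mem_carrier[OF K]
  have c: "x \<in> carrier G" "y \<in> carrier G" "\<And>m. m \<in> M \<Longrightarrow> m \<in> carrier G"
    using Kc M x y by auto
  have finM: "finite M" using c(3) finite_subset_carrier by blast
  \<comment> \<open>An element between two elements of \<open>M\<close> commutes with \<open>x\<close> and \<open>y\<close>.\<close>
  have q: "u \<in> centralizer G x \<and> u \<in> centralizer G y"
    if "m \<in> M" "m' \<in> M" "u \<in> carrier G" "u \<otimes> m = m'" for u m m'
  proof -
    have "u = m' \<otimes> inv m" using that c by (metis inv_solve_right)
    thus ?thesis using that Mx My
      by (metis c(1,2) centralizer_subgroup subgroup.m_closed subgroup.m_inv_closed subset_iff)
  qed
  have l: "(\<lambda>m. g \<otimes> m) ` M \<inter> (\<lambda>m. h \<otimes> m) ` M = {}"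
    if "g \<in> carrier G" "h \<in> carrier G"
      "\<not> (inv h \<otimes> g \<in> centralizer G x \<and> inv h \<otimes> g \<in> centralizer G y)" for g h
  proof -
    have False if "m \<in> M" "m' \<in> M" "g \<otimes> m = h \<otimes> m'" for m m'
    proof -
      have "(inv h \<otimes> g) \<otimes> m = m'"
        using that c(3) \<open>g \<in> carrier G\<close> \<open>h \<in> carrier G\<close> by (simp add: m_assoc) (simp flip: m_assoc)
      thus False using q[OF that(1,2), of "inv h \<otimes> g"] \<open>g \<in> carrier G\<close> \<open>h \<in> carrier G\<close>
        \<open>\<not> (inv h \<otimes> g \<in> centralizer G x \<and> inv h \<otimes> g \<in> centralizer G y)\<close> by blast
    qed
    thus ?thesis by blast
  qed
  have cc: "card ((\<lambda>m. g \<otimes> m) ` M) = card M" if "g \<in> carrier G" for g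
    using that c(3) by (intro card_image) (auto simp: inj_on_def)
  let ?A = "\<lambda>g. (\<lambda>m. g \<otimes> m) ` M"
  have cen: "(w \<in> centralizer G x) = (w \<otimes> x = x \<otimes> w)" "(w \<in> centralizer G y) = (w \<otimes> y = y \<otimes> w)"
    if "w \<in> carrier G" for w using that by (auto simp: centralizer_def)
  have 1: "x \<otimes> y \<in> carrier G" using c by simp
  have d1: "?A x \<inter> ?A \<one> = {}" using xy c by (intro l) (auto simp: cen)
  have d2: "?A y \<inter> ?A \<one> = {}" using xy c by (intro l) (auto simp: cen)
  have d3: "?A (x \<otimes> y) \<inter> ?A \<one> = {}"
    using xy c by (intro l) (auto simp: cen m_assoc)
  have d4: "?A y \<inter> ?A x = {}"
  proof (intro l)
    show "\<not> (inv x \<otimes> y \<in> centralizer G x \<and> inv x \<otimes> y \<in> centralizer G y)"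
    proof
      assume "inv x \<otimes> y \<in> centralizer G x \<and> inv x \<otimes> y \<in> centralizer G y"
      hence "inv x \<otimes> y \<otimes> x = x \<otimes> (inv x \<otimes> y)" using c by (simp add: cen)
      also have "\<dots> = y" using c by (simp flip: m_assoc)
      finally have "x \<otimes> (inv x \<otimes> y \<otimes> x) = x \<otimes> y" by simp
      moreover have "x \<otimes> (inv x \<otimes> y \<otimes> x) = y \<otimes> x" using c by (simp flip: m_assoc)
      ultimately show False using xy by simp
    qed
  qed (use c in auto)
  have d5: "?A (x \<otimes> y) \<inter> ?A x = {}"
  proof (intro l)
    have "inv x \<otimes> (x \<otimes> y) = y" using c by (simp flip: m_assoc)
    thus "\<not> (inv x \<otimes> (x \<otimes> y) \<in> centralizer G x \<and> inv x \<otimes> (x \<otimes> y) \<in> centralizer G y)"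
      using xy c by (auto simp: cen)
  qed (use c in auto)
  have d6: "?A (x \<otimes> y) \<inter> ?A y = {}"
  proof (intro l)
    show "\<not> (inv y \<otimes> (x \<otimes> y) \<in> centralizer G x \<and> inv y \<otimes> (x \<otimes> y) \<in> centralizer G y)"
    proof
      assume "inv y \<otimes> (x \<otimes> y) \<in> centralizer G x \<and> inv y \<otimes> (x \<otimes> y) \<in> centralizer G y"
      hence "inv y \<otimes> (x \<otimes> y) \<otimes> y = y \<otimes> (inv y \<otimes> (x \<otimes> y))" using c by (simp add: cen)
      hence "inv y \<otimes> (x \<otimes> y) = x" using c by (simp flip: m_assoc)
      thus False using xy c by (metis inv_solve_left m_closed)
    qed
  qed (use c in auto)
  have "card (?A (x \<otimes> y) \<union> (?A y \<union> (?A x \<union> ?A \<one>))) =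
      card (?A (x \<otimes> y)) + (card (?A y) + (card (?A x) + card (?A \<one>)))"
    using d1 d2 d3 d4 d5 d6 finM by (simp add: card_Un_disjoint Int_Un_distrib)
  hence "card (?A (x \<otimes> y) \<union> (?A y \<union> (?A x \<union> ?A \<one>))) = 4 * card M"
    using cc[OF one_closed] cc[OF c(1)] cc[OF c(2)] cc[OF 1] by simp
  moreover have "?A (x \<otimes> y) \<union> (?A y \<union> (?A x \<union> ?A \<one>)) \<subseteq> K"
    using K M x y by (auto intro: subgroup.m_closed subgroup.one_closed dest: subsetD)
  moreover have "?A \<one> = M" using c(3) by force
  ultimately show U: "card U = 4 * card M" "U \<subseteq> K" by (simp_all add: U_def)
  show "4 * card M \<le> card K"
    using card_mono[OF finite_subset_carrier[OF subgroup.subset[OF K]] U(2)] U(1) by simp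
qed

definition conj_class :: "'a \<Rightarrow> 'a set" where
  "conj_class v = {g \<otimes> v \<otimes> inv g | g. g \<in> carrier G}"

lemma conj_eq_iff:
  assumes "g \<in> carrier G" and "v \<in> carrier G" and "w \<in> carrier G"
  shows "g \<otimes> v \<otimes> inv g = w \<longleftrightarrow> g \<otimes> v = w \<otimes> g"
  using assms by (metis inv_solve_right m_closed)

lemma conj_class_subset: "v \<in> carrier G \<Longrightarrow> conj_class v \<subseteq> carrier G"
  by (auto simp: conj_class_def)

lemma conj_class_self: "v \<in> carrier G \<Longrightarrow> v \<in> conj_class v"
  unfolding conj_class_def by (rule CollectI, rule exI[of _ \<one>]) simp

lemma card_conj_class:
  assumes v: "v \<in> carrier G"
  shows "card (conj_class v) * card (centralizer G v) = order G"
proof -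
  let ?c = "\<lambda>g. \<lambda>h\<in>carrier G. g \<otimes> h \<otimes> inv g"
  interpret A: group_action G "carrier G" ?c by (rule action_by_conjugation)
  have "orbit G ?c v = conj_class v"
    using v by (simp add: orbit_def conj_class_def)
  moreover have "stabilizer G ?c v = centralizer G v"
    using v conj_eq_iff[OF _ v v] by (auto simp: stabilizer_def centralizer_def)
  ultimately show ?thesis using A.orbit_stabilizer_theorem[OF v] by simp
qed

text \<open>A set closed under conjugation is a union of conjugacy classes, and each class contained in
  this one has \<open>order G / c\<close> elements.\<close>

lemma order_dvd_card_conj_closed:
  assumes S: "S \<subseteq> carrier G" and closed: "\<And>x g. x \<in> S \<Longrightarrow> g \<in> carrier G \<Longrightarrow> g \<otimes> x \<otimes> inv g \<in> S"
    and c: "\<And>x. x \<in> S \<Longrightarrow> card (centralizer G x) = c"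
  shows "order G dvd c * card S"
proof -
  let ?c = "\<lambda>g. \<lambda>h\<in>carrier G. g \<otimes> h \<otimes> inv g"
  interpret A: group_action G "carrier G" ?c by (rule action_by_conjugation)
  have orb: "orbit G ?c v = conj_class v" if "v \<in> carrier G" for v
    using that by (simp add: orbit_def conj_class_def)
  have "S = \<Union> (conj_class ` S)"
  proof (intro equalityI subsetI)
    fix x assume "x \<in> S"
    thus "x \<in> \<Union> (conj_class ` S)" using S conj_class_self by blast
  qed (use closed in \<open>auto simp: conj_class_def\<close>)
  moreover have "card (\<Union> (conj_class ` S)) = sum card (conj_class ` S)"
  proof (rule card_Union_disjoint)
    show "pairwise disjnt (conj_class ` S)"
    proof (rule pairwiseI)
      fix O1 O2 assume O12: "O1 \<in> conj_class ` S" "O2 \<in> conj_class ` S" "O1 \<noteq> O2"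
      then obtain v w where vw: "v \<in> S" "w \<in> S" "O1 = conj_class v" "O2 = conj_class w" using O12 by auto
      hence "O1 = orbit G ?c v" "O2 = orbit G ?c w" "v \<in> carrier G" "w \<in> carrier G"
        using S orb by auto
      hence "O1 \<in> orbits G (carrier G) ?c" "O2 \<in> orbits G (carrier G) ?c"
        unfolding orbits_def by blast+
      from A.disjoint_union[OF this] O12(3) show "disjnt O1 O2" by (simp add: disjnt_def)
    qed
  next
    fix A assume "A \<in> conj_class ` S"
    thus "finite A" using S conj_class_subset finite_subset_carrier by blast
  qed
  ultimately have "c * card S = (\<Sum>B\<in>conj_class ` S. c * card B)"
    by (simp add: sum_distrib_left)
  moreover have "c * card B = order G" if "B \<in> conj_class ` S" for B
    using that S card_conj_class c by (metis (no_types, lifting) imageE mult.commute subset_iff)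
  ultimately have "c * card S = card (conj_class ` S) * order G" by simp
  thus ?thesis by simp
qed

lemma centralizer_conj:
  assumes v: "v \<in> carrier G" and g: "g \<in> carrier G"
  shows "centralizer G (g \<otimes> v \<otimes> inv g) = (\<lambda>w. g \<otimes> w \<otimes> inv g) ` centralizer G v"
    and "card (centralizer G (g \<otimes> v \<otimes> inv g)) = card (centralizer G v)"
proof -
  let ?c = "\<lambda>h. g \<otimes> h \<otimes> inv g"
  have hom: "?c (a \<otimes> b) = ?c a \<otimes> ?c b" if "a \<in> carrier G" "b \<in> carrier G" for a b
  proof -
    have "?c a \<otimes> ?c b = g \<otimes> a \<otimes> (inv g \<otimes> g) \<otimes> b \<otimes> inv g"
      using that g by (simp only: m_assoc inv_closed m_closed)
    thus ?thesis using that g by (simp add: m_assoc)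
  qed
  have bij: "bij_betw ?c (carrier G) (carrier G)"
    using conjugation_is_bij[OF g] by (simp add: bij_betw_def inj_on_def)
  have "?c \<in> iso G G"
    using g hom bij by (auto simp: iso_def hom_def)
  thus eq: "centralizer G (g \<otimes> v \<otimes> inv g) = ?c ` centralizer G v"
    using iso_centralizer[of ?c G v] v by simp
  have "inj_on ?c (centralizer G v)"
    using bij inj_on_subset[OF _ centralizer_subset] by (auto simp: bij_betw_def)
  thus "card (centralizer G (g \<otimes> v \<otimes> inv g)) = card (centralizer G v)"
    unfolding eq by (rule card_image)
qed

lemma center_conj:
  assumes "v \<in> carrier G" and "g \<in> carrier G" and "g \<otimes> v \<otimes> inv g \<in> center G"
  shows "g \<otimes> v \<otimes> inv g = v"
proof -
  have "(g \<otimes> v \<otimes> inv g) \<otimes> g = g \<otimes> (g \<otimes> v \<otimes> inv g)"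
    using assms by (simp add: center_def)
  moreover have "(g \<otimes> v \<otimes> inv g) \<otimes> g = g \<otimes> v" using assms(1,2) by (simp add: m_assoc)
  ultimately show ?thesis using assms(1,2) by simp
qed

definition centralizer_class :: "nat \<Rightarrow> 'a set" where
  "centralizer_class c = {v \<in> carrier G - center G. card (centralizer G v) = c}"

lemma centralizer_class_conj:
  assumes "v \<in> centralizer_class c" and "g \<in> carrier G"
  shows "g \<otimes> v \<otimes> inv g \<in> centralizer_class c"
proof -
  have v: "v \<in> carrier G" "v \<notin> center G" "card (centralizer G v) = c"
    using assms(1) by (auto simp: centralizer_class_def)
  hence "g \<otimes> v \<otimes> inv g \<notin> center G" using center_conj[OF v(1) assms(2)] by metis
  thus ?thesis using v assms(2) centralizer_conj(2)[OF v(1) assms(2)] by (simp add: centralizer_class_def)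
qed

lemma order_dvd_card_centralizer_class: "order G dvd c * card (centralizer_class c)"
  using centralizer_class_conj
  by (intro order_dvd_card_conj_closed) (auto simp: centralizer_class_def)

lemma centralizer_class_nonempty:
  assumes "card (centralizer_class c) \<noteq> 0"
  shows "c dvd order G" and "2 * c \<le> order G" and "card (center G) dvd c"
proof -
  have "centralizer_class c \<noteq> {}" using assms by auto
  then obtain v where "v \<in> carrier G - center G" "card (centralizer G v) = c"
    unfolding centralizer_class_def by blast
  thus "c dvd order G" and "2 * c \<le> order G" and "card (center G) dvd c"
    using noncentral_centralizer by metis+
qed

end

section \<open>Groups in which noncentral centralizers exceed the center by at most four elements\<close>

locale small_centralizer_group = finite_group +
  assumes noncommutative: "\<not> comm_group G" and small: "small_centralizers G"
begin

lemma center_pos: "0 < card (center G)"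
  using card_subgroup_pos center_subgroup by blast

lemma card_centralizer_le: "v \<in> carrier G - center G \<Longrightarrow> card (centralizer G v) \<le> card (center G) + 4"
  using small by (simp add: small_centralizers_def)

text \<open>With two noncommuting elements the centralizer would contain four disjoint translates of the
  union of the center and its coset by \<open>v\<close>, hence at least eight times as many elements as the
  center, which exceeds the bound.\<close>

lemma centralizer_abelian:
  assumes v: "v \<in> carrier G - center G" and x: "x \<in> centralizer G v" and y: "y \<in> centralizer G v"
  shows "x \<otimes> y = y \<otimes> x"
proof (rule ccontr)
  assume xy: "x \<otimes> y \<noteq> y \<otimes> x"
  have c: "v \<in> carrier G" "x \<in> carrier G" "y \<in> carrier G"
    using v x y by (auto simp: centralizer_def)
  let ?Z = "center G" and ?vZ = "(\<lambda>z. v \<otimes> z) ` center G"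
  have zc: "z \<in> carrier G" "\<And>g. g \<in> carrier G \<Longrightarrow> z \<otimes> g = g \<otimes> z" if "z \<in> ?Z" for z
    using that by (auto simp: center_def)
  have "?Z \<inter> ?vZ = {}"
  proof -
    have False if "z \<in> ?Z" "v \<otimes> z \<in> ?Z" for z
    proof -
      have "v = (v \<otimes> z) \<otimes> inv z" using zc(1)[OF that(1)] c(1) by (simp add: m_assoc)
      also have "\<dots> \<in> ?Z" using that center_subgroup
        by (meson subgroup.m_closed subgroup.m_inv_closed)
      finally show False using v by simp
    qed
    thus ?thesis by blast
  qed
  moreover have "card ?vZ = card ?Z"
    using c zc by (intro card_image) (auto simp: inj_on_def)
  ultimately have card: "card (?Z \<union> ?vZ) = 2 * card ?Z"
    using finite_subset_carrier[OF center_subset] by (subst card_Un_disjoint) auto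
  have vz: "v \<otimes> z \<in> centralizer G u" if "z \<in> ?Z" "u \<in> carrier G" "u \<otimes> v = v \<otimes> u" for u z
    using that zc c commutes_mult[of v u z] by (auto simp: centralizer_def)
  have sub: "?Z \<union> ?vZ \<subseteq> centralizer G u" if "u \<in> carrier G" "u \<otimes> v = v \<otimes> u" for u
    using that vz[OF _ that] center_subset_centralizer[of u G] by auto
  have "4 * card (?Z \<union> ?vZ) \<le> card (centralizer G v)"
    using v x y xy c by (intro four_cosets(3)[of _ _ x y] noncentral_centralizer sub) (auto simp: centralizer_def)
  thus False using card card_centralizer_le[OF v] center_pos by linarith
qed

text \<open>Both centralizers are abelian, so each of them contains the other.\<close>

lemma centralizer_eq:
  assumes v: "v \<in> carrier G - center G" and w: "w \<in> centralizer G v - center G"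
  shows "centralizer G w = centralizer G v"
proof -
  have "centralizer G v \<subseteq> centralizer G w"
    if "v \<in> carrier G - center G" "w \<in> centralizer G v - center G" for v w
    using centralizer_abelian[OF that(1)] that(2) by (auto simp: centralizer_def)
  moreover have "w \<in> carrier G - center G" "v \<in> centralizer G w - center G"
    using v w by (auto simp: centralizer_def)
  ultimately show ?thesis using v w by blast
qed

text \<open>The sets \<open>centralizer G v - center G\<close> partition the noncentral elements, and those that meet
  the class are contained in it and have \<open>c - card (center G)\<close> elements.\<close>

lemma card_centralizer_class_partition:
  "card (centralizer_class c) = (c - card (center G)) * card (centralizer G ` centralizer_class c)"
proof -
  let ?X = "centralizer_class c"
  let ?P = "(\<lambda>C. C - center G) ` centralizer G ` ?X"
  have Xv: "v \<in> carrier G - center G" "card (centralizer G v) = c" if "v \<in> ?X" for v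
    using that by (auto simp: centralizer_class_def)
  have "\<Union> ?P = ?X"
  proof (intro equalityI subsetI)
    fix w assume "w \<in> \<Union> ?P"
    then obtain v where v: "v \<in> ?X" "w \<in> centralizer G v - center G" by auto
    thus "w \<in> ?X" using centralizer_eq[OF Xv(1)[OF v(1)] v(2)] Xv[OF v(1)]
      by (auto simp: centralizer_class_def centralizer_def)
  next
    fix w assume "w \<in> ?X"
    thus "w \<in> \<Union> ?P" using Xv[of w] noncentral_centralizer(3)[of w] by auto
  qed
  moreover have "card (\<Union> ?P) = sum card ?P"
  proof (rule card_Union_disjoint)
    show "pairwise disjnt ?P"
    proof (rule pairwiseI)
      fix A B assume AB: "A \<in> ?P" "B \<in> ?P" "A \<noteq> B"
      then obtain v w where vw: "v \<in> ?X" "w \<in> ?X" "A = centralizer G v - center G"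
        "B = centralizer G w - center G" by auto
      have False if "u \<in> A" "u \<in> B" for u
        using centralizer_eq[OF Xv(1)[OF vw(1)], of u] centralizer_eq[OF Xv(1)[OF vw(2)], of u] that vw AB(3)
        by auto
      thus "disjnt A B" by (auto simp: disjnt_def)
    qed
  next
    fix A assume "A \<in> ?P"
    then obtain v where "A = centralizer G v - center G" by blast
    thus "finite A" using centralizer_subset[of G v] by (intro finite_subset_carrier) blast
  qed
  moreover have "card A = c - card (center G)" if "A \<in> ?P" for A
  proof -
    obtain v where v: "v \<in> ?X" "A = centralizer G v - center G" using \<open>A \<in> ?P\<close> by blast
    thus ?thesis using Xv[OF v(1)] noncentral_centralizer(5)[of v] finite_subset_carrier[OF center_subset]
      by (simp add: card_Diff_subset)
  qed
  moreover have "card ?P = card (centralizer G ` ?X)"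
  proof (rule card_image, rule inj_onI)
    fix A B assume AB: "A \<in> centralizer G ` ?X" "B \<in> centralizer G ` ?X" "A - center G = B - center G"
    moreover have "center G \<subseteq> A" "center G \<subseteq> B"
      using AB(1,2) Xv noncentral_centralizer(5) by auto
    ultimately show "A = B" by blast
  qed
  ultimately show ?thesis by simp
qed

lemma dvd_card_centralizer_class: "c - card (center G) dvd card (centralizer_class c)"
  using card_centralizer_class_partition by simp

lemma order_eq_sum:
  "order G = card (center G) + (\<Sum>c\<in>{card (center G) + 1..card (center G) + 4}. card (centralizer_class c))"
proof -
  let ?I = "{card (center G) + 1..card (center G) + 4}"
  have "carrier G = center G \<union> (\<Union>c\<in>?I. centralizer_class c)"
  proof (intro equalityI subsetI)
    fix v assume "v \<in> carrier G"
    show "v \<in> center G \<union> (\<Union>c\<in>?I. centralizer_class c)"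
    proof (cases "v \<in> center G")
      case False
      hence v: "v \<in> carrier G - center G" using \<open>v \<in> carrier G\<close> by simp
      hence "card (centralizer G v) \<in> ?I"
        using card_centralizer_le[OF v] noncentral_centralizer(1)[OF v] center_pos by auto
      thus ?thesis using v by (auto simp: centralizer_class_def)
    qed simp
  qed (auto simp: centralizer_class_def center_def)
  moreover have "center G \<inter> (\<Union>c\<in>?I. centralizer_class c) = {}"
    by (auto simp: centralizer_class_def)
  moreover have fin: "finite (centralizer_class c)" for c
    by (rule finite_subset_carrier) (auto simp: centralizer_class_def)
  moreover have "card (\<Union>c\<in>?I. centralizer_class c) = (\<Sum>c\<in>?I. card (centralizer_class c))"
    using fin by (intro card_UN_disjoint) (auto simp: centralizer_class_def)
  ultimately show ?thesis
    using card_Un_disjoint[of "center G" "\<Union>c\<in>?I. centralizer_class c"] finite_subset_carrier[OF center_subset]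
    by (simp add: order_def)
qed

end

section \<open>The class equation as a sum of unit fractions\<close>

text \<open>Here \<open>Nc\<close> counts the elements with centralizer of order \<open>c\<close>. With \<open>c * Nc = n * kc\<close> the equation
  reads \<open>1/n + k2/2 + k3/3 + k4/4 + k5/5 = 1\<close>; clearing denominators shows that \<open>n\<close> divides 60 and
  leaves sixteen tuples of coefficients. Most of them are excluded because the centralizers
  partition the elements, which makes \<open>Nc\<close> divisible by \<open>c - 1\<close>, and because \<open>c\<close> divides \<open>n\<close>.\<close>

lemma class_equation_center_1:
  fixes n :: nat
  assumes n: "n = 1 + N2 + N3 + N4 + N5"
    and d: "n dvd 2 * N2" "n dvd 3 * N3" "n dvd 4 * N4" "n dvd 5 * N5"
    and p: "2 dvd N3" "3 dvd N4" "4 dvd N5"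
    and c: "N2 \<noteq> 0 \<Longrightarrow> 4 \<le> n" "N3 \<noteq> 0 \<Longrightarrow> 3 dvd n \<and> 6 \<le> n" "N4 \<noteq> 0 \<Longrightarrow> 4 dvd n \<and> 8 \<le> n"
      "N5 \<noteq> 0 \<Longrightarrow> 5 dvd n \<and> 10 \<le> n" and n1: "n \<noteq> 1"
  shows "(n, N2, N3, N4, N5) \<in> {(6, 3, 2, 0, 0), (10, 5, 0, 0, 4), (12, 0, 8, 3, 0),
           (20, 0, 0, 15, 4), (60, 0, 20, 15, 24)}"
proof -
  obtain k2 k3 k4 k5 where k: "2 * N2 = n * k2" "3 * N3 = n * k3" "4 * N4 = n * k4" "5 * N5 = n * k5"
    using d by (auto elim!: dvdE)
  have b: "k2 < 2" "k3 < 3" "k4 < 4" "k5 < 5"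
  proof -
    have "n * k2 < n * 2" "n * k3 < n * 3" "n * k4 < n * 4" "n * k5 < n * 5"
      unfolding k[symmetric] using n by linarith+
    thus "k2 < 2" "k3 < 3" "k4 < 4" "k5 < 5" by auto
  qed
  have "k2 = 0 \<or> k2 = 1" "k3 = 0 \<or> k3 = 1 \<or> k3 = 2" "k4 = 0 \<or> k4 = 1 \<or> k4 = 2 \<or> k4 = 3"
    "k5 = 0 \<or> k5 = 1 \<or> k5 = 2 \<or> k5 = 3 \<or> k5 = 4"
    using b by linarith+
  note k_cases = this
  \<comment> \<open>\<open>s / 60\<close> is the sum of the fractions \<open>kc / c\<close>.\<close>
  define s where "s = 30 * k2 + 20 * k3 + 15 * k4 + 12 * k5"
  have "60 * n = 60 + 30 * (2 * N2) + 20 * (3 * N3) + 15 * (4 * N4) + 12 * (5 * N5)"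
    using n by simp
  also have "\<dots> = 60 + n * s"
    unfolding k s_def by (simp add: algebra_simps)
  finally have ns: "60 * n = 60 + n * s" .
  hence "n * s < n * 60" by linarith
  hence s: "s < 60" by simp
  have n60: "n * (60 - s) = 60" using ns by (simp add: algebra_simps)
  hence "(60 - s) dvd 60" by (metis dvd_triv_right)
  with s k_cases have "(k2, k3, k4, k5) \<in> {(1,0,0,0), (1,1,0,0), (1,0,1,0), (1,0,0,2), (1,0,1,1), (0,0,0,0),
      (0,0,0,4), (0,0,2,0), (0,0,2,2), (0,0,3,0), (0,0,3,1), (0,1,0,3), (0,1,1,2), (0,1,2,0), (0,2,0,0), (0,2,1,0)}"
    unfolding s_def by (elim disjE) simp_all
  thus ?thesis
    using n60 k p c n1 unfolding s_def by (elim insertE emptyE; simp)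
qed

text \<open>The same argument with \<open>k4/4 + k6/6 = 1 - 2/n\<close>. The last of the four solutions is not realized
  by a group, but arithmetic alone does not exclude it.\<close>

lemma class_equation_center_2:
  fixes n :: nat
  assumes n: "n = 2 + N4 + N6"
    and d: "n dvd 4 * N4" "n dvd 6 * N6" and p: "2 dvd N4" "4 dvd N6"
    and c: "N4 \<noteq> 0 \<Longrightarrow> 4 dvd n \<and> 8 \<le> n" "N6 \<noteq> 0 \<Longrightarrow> 6 dvd n \<and> 12 \<le> n" and n1: "n \<noteq> 2"
  shows "(n, N4, N6) \<in> {(8, 6, 0), (12, 6, 4), (24, 6, 16), (24, 18, 4)}"
proof -
  obtain k4 k6 where k: "4 * N4 = n * k4" "6 * N6 = n * k6"
    using d by (auto elim!: dvdE)
  have "n * k4 < n * 4" "n * k6 < n * 6"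
    unfolding k[symmetric] using n by linarith+
  hence "k4 < 4" "k6 < 6" by auto
  hence "k4 = 0 \<or> k4 = 1 \<or> k4 = 2 \<or> k4 = 3" "k6 = 0 \<or> k6 = 1 \<or> k6 = 2 \<or> k6 = 3 \<or> k6 = 4 \<or> k6 = 5"
    by linarith+
  thus ?thesis
    using k n p c n1 by (elim disjE; simp; presburger)
qed

lemma class_equation_center_4:
  fixes n :: nat
  assumes n: "n = 4 + N8" and d: "n dvd 8 * N8" and c: "N8 \<noteq> 0 \<Longrightarrow> 8 dvd n \<and> 16 \<le> n" and n1: "n \<noteq> 4"
  shows "n = 16 \<or> n = 32"
proof -
  obtain k where k: "8 * N8 = n * k" using d by auto
  have "n * k < n * 8"
    unfolding k[symmetric] using n by linarith
  hence "k < 8" by auto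
  hence "k = 0 \<or> k = 1 \<or> k = 2 \<or> k = 3 \<or> k = 4 \<or> k = 5 \<or> k = 6 \<or> k = 7" by linarith
  thus ?thesis
    using k n c n1 by (elim disjE; simp; presburger)
qed

context small_centralizer_group
begin

abbreviation class_size :: "nat \<Rightarrow> nat" where
  "class_size c \<equiv> card (centralizer_class c)"

lemma exists_noncentral: "\<exists>v. v \<in> carrier G - center G"
  using noncommutative comm_group_iff_center[OF is_group] center_subset[of G] by blast

lemma order_ne_card_center: "order G \<noteq> card (center G)"
  using exists_noncentral card_seteq[OF finite_carrier center_subset] by (auto simp: order_def)

lemma card_center_le_4: "card (center G) \<le> 4"
proof -
  obtain v where v: "v \<in> carrier G - center G" using exists_noncentral by blast
  show ?thesis using noncentral_centralizer(1)[OF v] card_centralizer_le[OF v] by linarith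
qed

lemma class_size_0: "\<not> card (center G) dvd c \<Longrightarrow> class_size c = 0"
  using centralizer_class_nonempty(3) by blast

lemma class_sizes_center_1:
  assumes z: "card (center G) = 1"
  shows "(order G, class_size 2, class_size 3, class_size 4, class_size 5) \<in>
    {(6, 3, 2, 0, 0), (10, 5, 0, 0, 4), (12, 0, 8, 3, 0), (20, 0, 0, 15, 4), (60, 0, 20, 15, 24)}"
proof (rule class_equation_center_1)
  have "{1 + 1..1 + 4 :: nat} = {2, 3, 4, 5}" by auto
  thus "order G = 1 + class_size 2 + class_size 3 + class_size 4 + class_size 5"
    using order_eq_sum by (simp add: z)
  show "2 dvd class_size 3" "3 dvd class_size 4" "4 dvd class_size 5"
    using dvd_card_centralizer_class[of 3] dvd_card_centralizer_class[of 4] dvd_card_centralizer_class[of 5]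
    by (simp_all add: z)
  show "order G \<noteq> 1" using order_ne_card_center z by simp
  show "order G dvd 2 * class_size 2" "order G dvd 3 * class_size 3" "order G dvd 4 * class_size 4" "order G dvd 5 * class_size 5"
    by (rule order_dvd_card_centralizer_class)+
  show "4 \<le> order G" if "class_size 2 \<noteq> 0" using centralizer_class_nonempty(2)[OF that] by simp
  show "3 dvd order G \<and> 6 \<le> order G" if "class_size 3 \<noteq> 0"
    using centralizer_class_nonempty(1,2)[OF that] by simp
  show "4 dvd order G \<and> 8 \<le> order G" if "class_size 4 \<noteq> 0"
    using centralizer_class_nonempty(1,2)[OF that] by simp
  show "5 dvd order G \<and> 10 \<le> order G" if "class_size 5 \<noteq> 0"
    using centralizer_class_nonempty(1,2)[OF that] by simp
qed

lemma class_sizes_center_2: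
  assumes z: "card (center G) = 2"
  shows "(order G, class_size 4, class_size 6) \<in> {(8, 6, 0), (12, 6, 4), (24, 6, 16), (24, 18, 4)}"
proof (rule class_equation_center_2)
  have "{2 + 1..2 + 4 :: nat} = {3, 4, 5, 6}" by auto
  moreover have "class_size 3 = 0" "class_size 5 = 0" using class_size_0 z by simp_all
  ultimately show "order G = 2 + class_size 4 + class_size 6"
    using order_eq_sum by (simp add: z)
  show "2 dvd class_size 4" "4 dvd class_size 6"
    using dvd_card_centralizer_class[of 4] dvd_card_centralizer_class[of 6] by (simp_all add: z)
  show "order G \<noteq> 2" using order_ne_card_center z by simp
  show "order G dvd 4 * class_size 4" "order G dvd 6 * class_size 6"
    by (rule order_dvd_card_centralizer_class)+
  show "4 dvd order G \<and> 8 \<le> order G" if "class_size 4 \<noteq> 0"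
    using centralizer_class_nonempty(1,2)[OF that] by simp
  show "6 dvd order G \<and> 12 \<le> order G" if "class_size 6 \<noteq> 0"
    using centralizer_class_nonempty(1,2)[OF that] by simp
qed

lemma order_candidates_center_4:
  assumes z: "card (center G) = 4"
  shows "order G = 16 \<or> order G = 32"
proof (rule class_equation_center_4)
  have "{4 + 1..4 + 4 :: nat} = {5, 6, 7, 8}" by auto
  moreover have "class_size 5 = 0" "class_size 6 = 0" "class_size 7 = 0" using class_size_0 z by simp_all
  ultimately show "order G = 4 + class_size 8"
    using order_eq_sum by (simp add: z)
  show "order G \<noteq> 4" using order_ne_card_center z by simp
  show "order G dvd 8 * class_size 8"
    by (rule order_dvd_card_centralizer_class)+
  show "8 dvd order G \<and> 16 \<le> order G" if "class_size 8 \<noteq> 0"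
    using centralizer_class_nonempty(1,2)[OF that] by simp
qed

end

section \<open>Group presentations\<close>

context group
begin

lemma conj_mult:
  assumes "b \<in> carrier G" "x \<in> carrier G" "y \<in> carrier G"
  shows "b \<otimes> (x \<otimes> y) \<otimes> inv b = (b \<otimes> x \<otimes> inv b) \<otimes> (b \<otimes> y \<otimes> inv b)"
proof -
  have "(b \<otimes> x \<otimes> inv b) \<otimes> (b \<otimes> y \<otimes> inv b) = b \<otimes> x \<otimes> (inv b \<otimes> b) \<otimes> y \<otimes> inv b"
    using assms by (simp only: m_assoc inv_closed m_closed)
  thus ?thesis using assms by (simp add: m_assoc)
qed

lemma conj_inv:
  assumes "b \<in> carrier G" "x \<in> carrier G"
  shows "b \<otimes> inv x \<otimes> inv b = inv (b \<otimes> x \<otimes> inv b)"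
  using assms by (simp add: inv_mult_group m_assoc)

text \<open>Conjugation by \<open>b\<close> is a homomorphism, so it suffices to test normalization on generators.\<close>

lemma generate_conj_closed:
  assumes S: "S \<subseteq> carrier G" and b: "b \<in> carrier G"
    and conj: "\<And>s. s \<in> S \<Longrightarrow> b \<otimes> s \<otimes> inv b \<in> generate G S" and x: "x \<in> generate G S"
  shows "b \<otimes> x \<otimes> inv b \<in> generate G S"
  using x
proof (induction rule: generate.induct)
  case one
  show ?case using b generate.one by simp
next
  case (inv h)
  thus ?case
    using conj[OF inv] generate_m_inv_closed[OF S] S b conj_inv[of b h] by auto
next
  case (eng h1 h2)
  thus ?case using conj_mult[OF b] generate_in_carrier[OF S] generate.eng by metis
qed (use conj in auto)

text \<open>Because \<open>b\<close> normalizes the subgroup generated by \<open>S\<close> and its \<open>m\<close>-th power lies in it, every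
  product can be collected into an element of this subgroup times one of the first \<open>m\<close>
  powers of \<open>b\<close>.\<close>

lemma generate_cyclic_extension:
  assumes S: "S \<subseteq> carrier G" and b: "b \<in> carrier G" and m: "0 < (m::nat)"
    and conj: "\<And>s. s \<in> S \<Longrightarrow> b \<otimes> s \<otimes> inv b \<in> generate G S" and pow: "b [^] m \<in> generate G S"
    and fin: "finite (generate G S)"
  shows "finite (generate G (insert b S))" and "card (generate G (insert b S)) \<le> m * card (generate G S)"
proof -
  let ?N = "generate G S"
  interpret N: subgroup ?N G using generate_is_subgroup[OF S] .
  define K where "K = {x \<otimes> b [^] i | x i. x \<in> ?N \<and> i \<in> (UNIV :: nat set)}"
  have conjN: "b [^] (i::nat) \<otimes> x \<otimes> inv (b [^] i) \<in> ?N" if x: "x \<in> ?N" for x i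
  proof (induction i)
    case (Suc i)
    have "b [^] Suc i \<otimes> x \<otimes> inv (b [^] Suc i) = b \<otimes> (b [^] i \<otimes> x \<otimes> inv (b [^] i)) \<otimes> inv b"
      using b x N.subset by (simp only: nat_pow_Suc2) (simp add: inv_mult_group m_assoc N.mem_carrier)
    thus ?case using generate_conj_closed[OF S b conj Suc] by simp
  qed (use x N.mem_carrier in simp)
  have K_mult: "g \<otimes> h \<in> K" if gh: "g \<in> K" "h \<in> K" for g h
  proof -
    obtain x i y j where xy: "x \<in> ?N" "y \<in> ?N" "g = x \<otimes> b [^] (i::nat)" "h = y \<otimes> b [^] (j::nat)"
      using gh by (auto simp: K_def)
    have c: "x \<in> carrier G" "y \<in> carrier G" "b [^] i \<in> carrier G" "b [^] j \<in> carrier G"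
      using xy b by auto
    have "g \<otimes> h = (x \<otimes> (b [^] i \<otimes> y \<otimes> inv (b [^] i))) \<otimes> (b [^] i \<otimes> b [^] j)"
    proof -
      have "(x \<otimes> (b [^] i \<otimes> y \<otimes> inv (b [^] i))) \<otimes> (b [^] i \<otimes> b [^] j) =
        x \<otimes> b [^] i \<otimes> y \<otimes> (inv (b [^] i) \<otimes> b [^] i) \<otimes> b [^] j"
        using c by (simp only: m_assoc m_closed inv_closed)
      thus ?thesis using xy c by (simp add: m_assoc)
    qed
    also have "b [^] i \<otimes> b [^] j = b [^] (i + j)" using b by (simp add: nat_pow_mult)
    finally show ?thesis using conjN[OF xy(2)] xy(1) unfolding K_def by blast
  qed
  have NK: "x \<in> K" if "x \<in> ?N" for x
    using that unfolding K_def by (intro CollectI exI[of _ x] exI[of _ 0]) (use N.mem_carrier in simp)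
  have powK: "b [^] (i::nat) \<in> K" for i
    unfolding K_def by (intro CollectI exI[of _ \<one>] exI[of _ i]) (use b in simp)
  have pw: "inv (b [^] m) \<in> ?N" using pow by simp
  have bK: "b \<in> K" using powK[of 1] b by simp
  have "inv b = inv (b [^] m) \<otimes> b [^] (m - 1)"
  proof -
    have "b [^] m = b [^] (m - 1) \<otimes> b" using m by (metis Suc_diff_1 nat_pow_Suc)
    thus ?thesis using b by (simp add: inv_mult_group m_assoc)
  qed
  hence ibK: "inv b \<in> K" using K_mult[OF NK[OF pw] powK] by simp
  have K: "generate G (insert b S) \<subseteq> K"
  proof
    fix g assume "g \<in> generate G (insert b S)"
    thus "g \<in> K"
    proof (induction rule: generate.induct)
      case one
      show ?case using powK[of 0] by simp
    next
      case (incl h)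
      thus ?case using NK generate.incl[of h S] bK by auto
    next
      case (inv h)
      thus ?case using NK generate.inv[of h S] ibK by auto
    qed (use K_mult in blast)
  qed
  have "K \<subseteq> (\<lambda>(x, i). x \<otimes> b [^] i) ` (?N \<times> {..<m})"
  proof
    fix g assume "g \<in> K"
    then obtain x i where xi: "x \<in> ?N" "g = x \<otimes> b [^] (i::nat)" by (auto simp: K_def)
    have "b [^] i = (b [^] m) [^] (i div m) \<otimes> b [^] (i mod m)"
      using b by (simp add: nat_pow_pow nat_pow_mult)
    hence "g = (x \<otimes> (b [^] m) [^] (i div m)) \<otimes> b [^] (i mod m)"
      using xi b N.mem_carrier[OF xi(1)] by (simp add: m_assoc)
    moreover have "(b [^] m) [^] (i div m) \<in> ?N"
    proof (induction "i div m" arbitrary: i)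
      case (Suc q)
      from Suc(1)[of "q * m"] m have "(b [^] m) [^] q \<in> ?N" by simp
      thus ?case using pow by (simp flip: Suc(2))
    qed simp
    ultimately show "g \<in> (\<lambda>(x, i). x \<otimes> b [^] i) ` (?N \<times> {..<m})"
      using xi(1) m by (intro image_eqI[of _ _ "(x \<otimes> (b [^] m) [^] (i div m), i mod m)"]) auto
  qed
  hence sub: "generate G (insert b S) \<subseteq> (\<lambda>(x, i). x \<otimes> b [^] i) ` (?N \<times> {..<m})" using K by blast
  have fin': "finite (?N \<times> {..<m})" using fin by simp
  show "finite (generate G (insert b S))" using sub fin' finite_subset by blast
  have "card (generate G (insert b S)) \<le> card (?N \<times> {..<m})"
    using sub fin' surj_card_le by blast
  thus "card (generate G (insert b S)) \<le> m * card ?N" by (simp add: card_cartesian_product mult.commute)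
qed

end

primrec letter_value :: "('a, 'm) monoid_scheme \<Rightarrow> ('x \<Rightarrow> 'a) \<Rightarrow> 'x letter \<Rightarrow> 'a" where
  "letter_value G f (Gen x) = f x"
| "letter_value G f (Inv x) = inv\<^bsub>G\<^esub> f x"

primrec word_value :: "('a, 'm) monoid_scheme \<Rightarrow> ('x \<Rightarrow> 'a) \<Rightarrow> 'x group_word \<Rightarrow> 'a" where
  "word_value G f [] = \<one>\<^bsub>G\<^esub>"
| "word_value G f (l # w) = letter_value G f l \<otimes>\<^bsub>G\<^esub> word_value G f w"

text \<open>Equivalently, \<open>f\<close> induces a homomorphism from the presented group onto \<open>G\<close>.\<close>

definition satisfies_presentation ::
  "('a, 'm) monoid_scheme \<Rightarrow> ('x \<Rightarrow> 'a) \<Rightarrow> ('x group_word \<times> 'x group_word) set \<Rightarrow> bool" where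
  "satisfies_presentation G f R \<longleftrightarrow> range f \<subseteq> carrier G \<and> generate G (range f) = carrier G \<and>
     (\<forall>(l, r) \<in> R. word_value G f l = word_value G f r)"

context group
begin

lemma letter_value_closed: "range f \<subseteq> carrier G \<Longrightarrow> letter_value G f l \<in> carrier G"
  by (cases l) auto

lemma word_value_closed: "range f \<subseteq> carrier G \<Longrightarrow> word_value G f w \<in> carrier G"
  by (induction w) (auto intro: letter_value_closed)

lemma word_value_append:
  "range f \<subseteq> carrier G \<Longrightarrow> word_value G f (u @ v) = word_value G f u \<otimes> word_value G f v"
  by (induction u) (auto simp: m_assoc letter_value_closed word_value_closed)

lemma word_value_eq:
  assumes f: "range f \<subseteq> carrier G" and R: "\<And>l r. (l, r) \<in> R \<Longrightarrow> word_value G f l = word_value G f r"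
    and "word_eq R u v"
  shows "word_value G f u = word_value G f v"
  using assms(3)
proof induction
  case (word_cancel_right u x v)
  have "f x \<in> carrier G" using f by auto
  thus ?case by (simp add: word_value_append[OF f] word_value_closed[OF f] r_inv flip: m_assoc)
next
  case (word_cancel_left u x v)
  have "f x \<in> carrier G" using f by auto
  thus ?case by (simp add: word_value_append[OF f] word_value_closed[OF f] l_inv flip: m_assoc)
qed (auto simp: word_value_append[OF f] R)

end

abbreviation word_class :: "('x group_word \<times> 'x group_word) set \<Rightarrow> 'x group_word \<Rightarrow> 'x group_word set" where
  "word_class R u \<equiv> {v. word_eq R u v}"

lemma word_eq_context: "word_eq R a b \<Longrightarrow> word_eq R (u @ a @ v) (u @ b @ v)"
proof (induction rule: word_eq.induct)
  case (word_cancel_right p x q)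
  show ?case using word_eq.word_cancel_right[of R "u @ p" x "q @ v"] by simp
next
  case (word_cancel_left p x q)
  show ?case using word_eq.word_cancel_left[of R "u @ p" x "q @ v"] by simp
next
  case (word_relation l r p q)
  show ?case using word_eq.word_relation[OF word_relation, of "u @ p" "q @ v"] by simp
qed (auto intro: word_eq.intros)

lemma word_eq_append:
  assumes "word_eq R a a'" and "word_eq R b b'" shows "word_eq R (a @ b) (a' @ b')"
  using word_eq_context[OF assms(1), of "[]" b] word_eq_context[OF assms(2), of a' "[]"]
  by (auto intro: word_trans)

lemma word_class_eq_iff: "word_class R u = word_class R v \<longleftrightarrow> word_eq R u v"
  by (auto intro: word_eq.intros)

lemma carrier_presented_group: "carrier (presented_group R) = range (word_class R)"
  unfolding presented_group_def quotient_def by auto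

lemma mult_presented_group:
  "word_class R u \<otimes>\<^bsub>presented_group R\<^esub> word_class R v = word_class R (u @ v)"
  unfolding presented_group_def
  by (auto intro: word_eq_append word_refl) (meson word_eq_append word_trans)

lemma one_presented_group: "\<one>\<^bsub>presented_group R\<^esub> = word_class R []"
  by (simp add: presented_group_def)

primrec letter_inverse :: "'x letter \<Rightarrow> 'x letter" where
  "letter_inverse (Gen x) = Inv x"
| "letter_inverse (Inv x) = Gen x"

lemma word_eq_inverse: "word_eq R (rev (map letter_inverse w) @ w) []"
proof (induction w)
  case (Cons l w)
  have "word_eq R ([letter_inverse l] @ [l]) []"
    using word_cancel_right[of R "[]" _ "[]"] word_cancel_left[of R "[]" _ "[]"] by (cases l) auto
  from word_eq_context[OF this, of "rev (map letter_inverse w)" w] Cons show ?case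
    by (auto intro: word_trans)
qed (simp add: word_refl)

lemma group_presented_group: "group (presented_group R)"
proof (rule groupI)
  fix P assume "P \<in> carrier (presented_group R)"
  then obtain w where "P = word_class R w" by (auto simp: carrier_presented_group)
  thus "\<exists>Q\<in>carrier (presented_group R). Q \<otimes>\<^bsub>presented_group R\<^esub> P = \<one>\<^bsub>presented_group R\<^esub>"
    using word_eq_inverse[of R w]
    by (auto simp: carrier_presented_group mult_presented_group one_presented_group word_class_eq_iff)
qed (auto simp: carrier_presented_group mult_presented_group one_presented_group)

definition presented_generator :: "('x group_word \<times> 'x group_word) set \<Rightarrow> 'x \<Rightarrow> 'x group_word set" where
  "presented_generator R x = word_class R [Gen x]"

lemma word_value_presented_generator:
  "word_value (presented_group R) (presented_generator R) w = word_class R w"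
proof (induction w)
  case (Cons l w)
  interpret P: group "presented_group R" by (rule group_presented_group)
  have "letter_value (presented_group R) (presented_generator R) l = word_class R [l]"
  proof (cases l)
    case (Inv x)
    have "word_class R [Inv x] \<otimes>\<^bsub>presented_group R\<^esub> word_class R [Gen x] = \<one>\<^bsub>presented_group R\<^esub>"
      using word_cancel_left[of R "[]" x "[]"]
      by (simp add: mult_presented_group one_presented_group word_class_eq_iff)
    hence "inv\<^bsub>presented_group R\<^esub> (word_class R [Gen x]) = word_class R [Inv x]"
      by (intro P.inv_equality) (auto simp: carrier_presented_group)
    thus ?thesis using Inv by (simp add: presented_generator_def)
  qed (simp add: presented_generator_def)
  thus ?case using Cons by (simp add: mult_presented_group)
qed (simp add: one_presented_group)

lemma (in group) word_value_in_generate: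
  "range f \<subseteq> carrier G \<Longrightarrow> word_value G f w \<in> generate G (range f)"
proof (induction w)
  case (Cons l w)
  have "letter_value G f l \<in> generate G (range f)"
    by (cases l) (auto intro: generate.incl generate.inv)
  thus ?case using Cons by (auto intro: generate.eng)
qed (auto intro: generate.one)

lemma satisfies_presentation_presented_group:
  "satisfies_presentation (presented_group R) (presented_generator R) R"
proof -
  interpret P: group "presented_group R" by (rule group_presented_group)
  have sub: "range (presented_generator R) \<subseteq> carrier (presented_group R)"
    by (auto simp: carrier_presented_group presented_generator_def)
  have "carrier (presented_group R) \<subseteq> generate (presented_group R) (range (presented_generator R))"
    using P.word_value_in_generate[OF sub] by (auto simp: carrier_presented_group word_value_presented_generator)
  moreover have "word_eq R l r" if "(l, r) \<in> R" for l r
    using word_relation[OF that, of "[]" "[]"] by simp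
  ultimately show ?thesis
    using sub P.generate_incl[OF sub]
    by (auto simp: satisfies_presentation_def word_value_presented_generator word_class_eq_iff
      simp del: Collect_mono_iff)
qed

text \<open>The universal property: evaluating words is a homomorphism onto \<open>G\<close>; a bound on the size of
  the presented group makes it bijective.\<close>

lemma (in group) iso_presented_group:
  assumes f: "satisfies_presentation G f R"
    and fin: "finite (carrier (presented_group R))" and card: "card (carrier (presented_group R)) \<le> order G"
  shows "presented_group R \<cong> G"
proof -
  have sub: "range f \<subseteq> carrier G" and gen: "generate G (range f) = carrier G"
    and rel: "\<And>l r. (l, r) \<in> R \<Longrightarrow> word_value G f l = word_value G f r"
    using f by (auto simp: satisfies_presentation_def)
  define h where "h P = word_value G f (SOME w. w \<in> P)" for P
  have h: "h (word_class R w) = word_value G f w" for w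
  proof -
    have "(SOME v. v \<in> word_class R w) \<in> word_class R w"
      by (rule someI[of _ w]) (simp add: word_refl)
    hence "word_eq R w (SOME v. v \<in> word_class R w)" by simp
    from word_value_eq[OF sub rel this] show ?thesis by (simp add: h_def)
  qed
  have hom: "h \<in> hom (presented_group R) G"
    unfolding hom_def
    by (auto simp: carrier_presented_group mult_presented_group h word_value_append[OF sub] word_value_closed[OF sub])
  interpret h: group_hom "presented_group R" G h
    by (rule group_hom.intro[OF group_presented_group is_group]) (simp add: group_hom_axioms_def hom)
  have "h ` generate (presented_group R) (range (presented_generator R)) = generate G (h ` range (presented_generator R))"
    by (rule h.generate_img[symmetric]) (auto simp: carrier_presented_group presented_generator_def)
  moreover have "h (presented_generator R x) = f x" for x
    using sub by (simp add: presented_generator_def h image_subset_iff)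
  hence "h ` range (presented_generator R) = range f"
    by (simp add: image_image)
  ultimately have surj: "h ` carrier (presented_group R) = carrier G"
    using gen satisfies_presentation_presented_group[of R] by (simp add: satisfies_presentation_def)
  have "inj_on h (carrier (presented_group R))"
    using fin card surj by (metis card_image_le eq_card_imp_inj_on le_antisym order_def)
  thus ?thesis using hom surj by (auto simp: is_iso_def iso_def bij_betw_def)
qed

text \<open>Two groups that are generated subject to the same relations are both isomorphic to the presented
  group as soon as their order reaches an upper bound for its order.\<close>

lemma (in group) iso_by_presentation:
  assumes G: "satisfies_presentation G f R" and H: "satisfies_presentation H g R" "group H"
    and bound: "finite (carrier (presented_group R))" "card (carrier (presented_group R)) \<le> n"
    and card: "order G = n" "order H = n"
  shows "G \<cong> H"
proof -
  interpret P: group "presented_group R" by (rule group_presented_group)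
  have "presented_group R \<cong> G" using iso_presented_group[OF G] bound card by simp
  moreover have "presented_group R \<cong> H" using group.iso_presented_group[OF H(2,1)] bound card by simp
  ultimately show ?thesis using P.iso_sym iso_trans by blast
qed

lemma (in group) satisfies_presentation_of_iso:
  assumes "G \<cong> presented_group R"
  obtains f where "satisfies_presentation G f R"
proof -
  let ?P = "presented_group R"
  obtain h where h: "h \<in> iso ?P G" using iso_sym[OF assms] by (auto simp: is_iso_def)
  interpret h: group_hom ?P G h
    by (rule group_hom.intro[OF group_presented_group is_group]) (use h in \<open>simp add: group_hom_axioms_def iso_def\<close>)
  let ?g = "presented_generator R"
  have P: "range ?g \<subseteq> carrier ?P" "generate ?P (range ?g) = carrier ?P"
    "\<And>l r. (l, r) \<in> R \<Longrightarrow> word_value ?P ?g l = word_value ?P ?g r"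
    using satisfies_presentation_presented_group[of R] by (auto simp: satisfies_presentation_def)
  have l: "letter_value G (h \<circ> ?g) l = h (letter_value ?P ?g l)" for l
    using P(1) h.hom_inv[of "?g _"] by (cases l) (auto simp: image_subset_iff)
  have w: "word_value G (h \<circ> ?g) w = h (word_value ?P ?g w)" for w
    by (induction w) (auto simp: l[unfolded comp_def] h.G.word_value_closed[OF P(1)] h.G.letter_value_closed[OF P(1)])
  have "h ` carrier ?P = carrier G" using h by (auto simp: iso_def bij_betw_def)
  hence "generate G (range (h \<circ> ?g)) = carrier G"
    using h.generate_img[OF P(1)] P(2) by (simp add: image_comp)
  moreover have "range (h \<circ> ?g) \<subseteq> carrier G" using P(1) by auto
  ultimately have "satisfies_presentation G (h \<circ> ?g) R"
    using P(3) by (auto simp: satisfies_presentation_def w)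
  thus ?thesis by (rule that)
qed

definition gen2 :: "'a \<Rightarrow> 'a \<Rightarrow> 2 \<Rightarrow> 'a" where
  "gen2 a b i = (if i = 0 then a else b)"

definition gen3 :: "'a \<Rightarrow> 'a \<Rightarrow> 'a \<Rightarrow> 3 \<Rightarrow> 'a" where
  "gen3 a b c i = (if i = 0 then a else if i = 1 then b else c)"

lemma UNIV_2_3: "(UNIV :: 2 set) = {0, 1}" "(UNIV :: 3 set) = {0, 1, 2}"
proof -
  show "(UNIV :: 2 set) = {0, 1}" using exhaust_2 by force
  show "(UNIV :: 3 set) = {0, 1, 2}" using exhaust_3 by force
qed

lemma range_gen2: "range (gen2 a b) = {a, b}"
  by (auto simp: UNIV_2_3 gen2_def)

lemma gen2_simps [simp]: "gen2 a b 0 = a" "gen2 a b 1 = b"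
  by (simp_all add: gen2_def)

lemma gen3_simps [simp]: "gen3 a b c 0 = a" "gen3 a b c 1 = b" "gen3 a b c 2 = c"
  by (simp_all add: gen3_def)

lemma range_gen3: "range (gen3 a b c) = {a, b, c}"
  by (simp add: UNIV_2_3(2))

lemma gen2_eta: "f = gen2 (f 0) (f 1)" for f :: "2 \<Rightarrow> 'a"
proof
  fix i :: 2 have "i \<in> {0, 1}" unfolding UNIV_2_3(1)[symmetric] by simp
  thus "f i = gen2 (f 0) (f 1) i" by auto
qed

lemma gen3_eta: "f = gen3 (f 0) (f 1) (f 2)" for f :: "3 \<Rightarrow> 'a"
proof
  fix i :: 3 have "i \<in> {0, 1, 2}" unfolding UNIV_2_3(2)[symmetric] by simp
  thus "f i = gen3 (f 0) (f 1) (f 2) i" by auto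
qed

text \<open>For a word \<open>w\<close> in the first generator these are the relators of an extension of a cyclic group of
  order at most \<open>n\<close> by one of order at most \<open>m\<close>.\<close>

definition metacyclic_relators :: "nat \<Rightarrow> nat \<Rightarrow> nat \<Rightarrow> 2 group_word \<Rightarrow> (2 group_word \<times> 2 group_word) set" where
  "metacyclic_relators n m k w =
     {(replicate n (Gen 0), []), (replicate m (Gen 1), replicate k (Gen 0)),
      ([Gen 1, Gen 0, Inv 1], w)}"

text \<open>For words \<open>u\<close> and \<open>w\<close> in the first two generators \<open>a\<close> and \<open>b\<close> these are the relators of an
  extension of the metacyclic group with \<open>a\<^sup>4 = 1\<close>, \<open>b\<^sup>2 = a\<^sup>k\<close>, \<open>b a b\<^sup>-\<^sup>1 = a\<^sup>-\<^sup>1\<close> by a cyclic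
  group of order at most \<open>m\<close>.\<close>

definition extension_relators ::
  "nat \<Rightarrow> nat \<Rightarrow> nat \<Rightarrow> 3 group_word \<Rightarrow> 3 group_word \<Rightarrow> (3 group_word \<times> 3 group_word) set" where
  "extension_relators k m l u w =
     {(replicate 4 (Gen 0), []), (replicate 2 (Gen 1), replicate k (Gen 0)),
      ([Gen 1, Gen 0, Inv 1], [Inv 0]),
      (replicate m (Gen 2), replicate l (Gen 0)), ([Gen 2, Gen 0, Inv 2], u), ([Gen 2, Gen 1, Inv 2], w)}"

context group
begin

lemma word_value_replicate:
  "f x \<in> carrier G \<Longrightarrow> word_value G f (replicate n (Gen x)) = f x [^] n"
  by (induction n) (simp_all add: nat_pow_Suc2[symmetric] del: nat_pow_Suc)

lemma pow_mem_generate: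
  assumes "S \<subseteq> carrier G" and "a \<in> generate G S" shows "a [^] (n::nat) \<in> generate G S"
  by (induction n) (use assms in \<open>auto intro: generate.one generate.eng\<close>)

lemma generate_cyclic_card:
  assumes a: "a \<in> carrier G" and n: "0 < n" and "a [^] n = \<one>"
  shows "finite (generate G {a})" and "card (generate G {a}) \<le> n"
  using generate_cyclic_extension[of "{}" a n] assms by (simp_all add: generate_empty)

lemma generate_metacyclic_card:
  assumes ab: "a \<in> carrier G" "b \<in> carrier G" and nm: "0 < n" "0 < m" and "a [^] n = \<one>"
    and "b [^] m \<in> generate G {a}" and "b \<otimes> a \<otimes> inv b \<in> generate G {a}"
  shows "finite (generate G {a, b})" and "card (generate G {a, b}) \<le> n * m"
proof -
  note a = generate_cyclic_card[OF ab(1) nm(1) \<open>a [^] n = \<one>\<close>]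
  have *: "finite (generate G (insert b {a}))" "card (generate G (insert b {a})) \<le> m * card (generate G {a})"
    using generate_cyclic_extension[of "{a}" b m] assms a(1) by auto
  hence "card (generate G (insert b {a})) \<le> n * m"
    using a(2) by (metis le_trans mult.commute mult_le_mono1)
  thus "finite (generate G {a, b})" and "card (generate G {a, b}) \<le> n * m"
    using * by (simp_all add: insert_commute)
qed

lemma satisfies_metacyclic:
  assumes "a \<in> carrier G" "b \<in> carrier G" and "generate G {a, b} = carrier G"
    and "a [^] n = \<one>" and "b [^] m = a [^] k" and "b \<otimes> a \<otimes> inv b = word_value G (gen2 a b) w"
  shows "satisfies_presentation G (gen2 a b) (metacyclic_relators n m k w)"
  using assms by (auto simp: satisfies_presentation_def metacyclic_relators_def range_gen2 word_value_replicate m_assoc)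

lemma satisfies_metacyclicD:
  assumes "satisfies_presentation G f (metacyclic_relators n m k w)"
  shows "f 0 \<in> carrier G" "f 1 \<in> carrier G" "generate G {f 0, f 1} = carrier G"
    "f 0 [^] n = \<one>" "f 1 [^] m = f 0 [^] k" "f 1 \<otimes> f 0 \<otimes> inv (f 1) = word_value G f w"
proof -
  have "range f = {f 0, f 1}" using range_gen2[of "f 0" "f 1"] gen2_eta[of f] by simp
  moreover have "f i \<in> carrier G" for i using assms by (auto simp: satisfies_presentation_def)
  ultimately show "f 0 \<in> carrier G" "f 1 \<in> carrier G" "generate G {f 0, f 1} = carrier G"
    "f 0 [^] n = \<one>" "f 1 [^] m = f 0 [^] k" "f 1 \<otimes> f 0 \<otimes> inv (f 1) = word_value G f w"
    using assms by (auto simp: satisfies_presentation_def metacyclic_relators_def word_value_replicate m_assoc)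
qed

lemma satisfies_extension:
  assumes "a \<in> carrier G" "b \<in> carrier G" "c \<in> carrier G" and "generate G {a, b, c} = carrier G"
    and "a [^] (4::nat) = \<one>" and "b [^] (2::nat) = a [^] k" and "b \<otimes> a \<otimes> inv b = inv a"
    and "c [^] m = a [^] l" and "c \<otimes> a \<otimes> inv c = word_value G (gen3 a b c) u"
    and "c \<otimes> b \<otimes> inv c = word_value G (gen3 a b c) w"
  shows "satisfies_presentation G (gen3 a b c) (extension_relators k m l u w)"
  using assms by (auto simp: satisfies_presentation_def extension_relators_def range_gen3 word_value_replicate m_assoc)

lemma satisfies_extensionD:
  assumes "satisfies_presentation G f (extension_relators k m l u w)"
  shows "f 0 \<in> carrier G" "f 1 \<in> carrier G" "f 2 \<in> carrier G" "generate G {f 0, f 1, f 2} = carrier G"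
    "f 0 [^] (4::nat) = \<one>" "f 1 [^] (2::nat) = f 0 [^] k" "f 1 \<otimes> f 0 \<otimes> inv (f 1) = inv (f 0)"
    "f 2 [^] m = f 0 [^] l" "f 2 \<otimes> f 0 \<otimes> inv (f 2) = word_value G f u"
    "f 2 \<otimes> f 1 \<otimes> inv (f 2) = word_value G f w"
proof -
  have "range f = {f 0, f 1, f 2}" using range_gen3[of "f 0" "f 1" "f 2"] gen3_eta[of f] by simp
  moreover have "f i \<in> carrier G" for i using assms by (auto simp: satisfies_presentation_def)
  ultimately show "f 0 \<in> carrier G" "f 1 \<in> carrier G" "f 2 \<in> carrier G" "generate G {f 0, f 1, f 2} = carrier G"
    "f 0 [^] (4::nat) = \<one>" "f 1 [^] (2::nat) = f 0 [^] k" "f 1 \<otimes> f 0 \<otimes> inv (f 1) = inv (f 0)"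
    "f 2 [^] m = f 0 [^] l" "f 2 \<otimes> f 0 \<otimes> inv (f 2) = word_value G f u"
    "f 2 \<otimes> f 1 \<otimes> inv (f 2) = word_value G f w"
    using assms by (auto simp: satisfies_presentation_def extension_relators_def word_value_replicate m_assoc)
qed

lemma word_value_mem_generate:
  assumes "S \<subseteq> carrier G" and "\<And>x. Gen x \<in> set w \<or> Inv x \<in> set w \<Longrightarrow> f x \<in> S"
  shows "word_value G f w \<in> generate G S"
  using assms(2)
proof (induction w)
  case (Cons l w)
  have "letter_value G f l \<in> generate G S"
    using Cons(2) by (cases l) (auto intro: generate.incl generate.inv)
  moreover have "word_value G f w \<in> generate G S" using Cons by auto
  ultimately show ?case by (auto intro: generate.eng)
qed (simp add: generate.one)

end

lemma presented_group_metacyclic_card: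
  fixes n m k :: nat and w :: "2 group_word"
  assumes "0 < n" "0 < m" and "set w \<subseteq> {Gen 0, Inv 0}"
  defines "P \<equiv> presented_group (metacyclic_relators n m k w)"
  shows "finite (carrier P)" and "card (carrier P) \<le> n * m"
proof -
  interpret P: group P unfolding P_def by (rule group_presented_group)
  let ?f = "presented_generator (metacyclic_relators n m k w)"
  note f = P.satisfies_metacyclicD[OF satisfies_presentation_presented_group[of "metacyclic_relators n m k w", folded P_def]]
  have a: "?f 0 \<in> generate P {?f 0}" by (rule generate.incl) simp
  have "word_value P ?f w \<in> generate P {?f 0}"
    using f(1) assms(3) by (intro P.word_value_mem_generate) auto
  hence "finite (generate P {?f 0, ?f 1})" "card (generate P {?f 0, ?f 1}) \<le> n * m"
    using P.generate_metacyclic_card[OF f(1,2) assms(1,2) f(4)] f P.pow_mem_generate[OF _ a] by auto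
  thus "finite (carrier P)" and "card (carrier P) \<le> n * m" using f(3) by auto
qed

lemma presented_group_extension_card:
  fixes k m l :: nat and u w :: "3 group_word"
  assumes m: "0 < m" and uw: "set u \<union> set w \<subseteq> {Gen 0, Inv 0, Gen 1, Inv 1}"
  defines "P \<equiv> presented_group (extension_relators k m l u w)"
  shows "finite (carrier P)" and "card (carrier P) \<le> m * 8"
proof -
  interpret P: group P unfolding P_def by (rule group_presented_group)
  let ?f = "presented_generator (extension_relators k m l u w)"
  note f = P.satisfies_extensionD[OF satisfies_presentation_presented_group[of "extension_relators k m l u w", folded P_def]]
  have ab: "?f 0 \<in> generate P {?f 0, ?f 1}" by (rule generate.incl) simp
  have a: "?f 0 \<in> generate P {?f 0}" by (rule generate.incl) simp
  have "inv\<^bsub>P\<^esub> ?f 0 \<in> generate P {?f 0}" by (rule generate.inv) simp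
  hence 1: "finite (generate P {?f 0, ?f 1})" "card (generate P {?f 0, ?f 1}) \<le> 4 * 2"
    using P.generate_metacyclic_card[OF f(1,2) _ _ f(5), of 2] f P.pow_mem_generate[OF _ a] by auto
  have "word_value P ?f u \<in> generate P {?f 0, ?f 1}" "word_value P ?f w \<in> generate P {?f 0, ?f 1}"
    using f(1,2) uw by (intro P.word_value_mem_generate; auto)+
  note uw' = this
  have "finite (generate P (insert (?f 2) {?f 0, ?f 1}))"
    "card (generate P (insert (?f 2) {?f 0, ?f 1})) \<le> m * card (generate P {?f 0, ?f 1})"
  proof -
    have "?f 2 \<otimes>\<^bsub>P\<^esub> s \<otimes>\<^bsub>P\<^esub> inv\<^bsub>P\<^esub> ?f 2 \<in> generate P {?f 0, ?f 1}" if "s \<in> {?f 0, ?f 1}" for s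
      using that f(9,10) uw' by auto
    moreover have "?f 2 [^]\<^bsub>P\<^esub> m \<in> generate P {?f 0, ?f 1}"
      using P.pow_mem_generate[OF _ ab] f(1,2,8) by auto
    ultimately show "finite (generate P (insert (?f 2) {?f 0, ?f 1}))"
      "card (generate P (insert (?f 2) {?f 0, ?f 1})) \<le> m * card (generate P {?f 0, ?f 1})"
      using P.generate_cyclic_extension[OF _ f(3) m _ _ 1(1)] f(1,2) by auto
  qed
  note 2 = this
  have "insert (?f 2) {?f 0, ?f 1} = {?f 0, ?f 1, ?f 2}" by auto
  hence gen: "generate P (insert (?f 2) {?f 0, ?f 1}) = carrier P" using f(4) by simp
  show "finite (carrier P)" using 2(1) unfolding gen .
  have "m * card (generate P {?f 0, ?f 1}) \<le> m * 8" using 1(2) by simp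
  thus "card (carrier P) \<le> m * 8" using 2(2) unfolding gen by (rule le_trans[rotated])
qed

text \<open>A presentation of the group of order 16 in which the commutator of \<open>c\<close> and \<open>a\<close> is the
  central involution \<open>b\<close>.\<close>

definition central_commutator_relators :: "(3 group_word \<times> 3 group_word) set" where
  "central_commutator_relators =
     {(replicate 4 (Gen 0), []), (replicate 2 (Gen 1), []), (replicate 2 (Gen 2), []),
      ([Gen 0, Gen 1], [Gen 1, Gen 0]), ([Gen 1, Gen 2], [Gen 2, Gen 1]),
      ([Gen 2, Gen 0, Inv 2], [Gen 0, Gen 1])}"

context group
begin

lemma satisfies_central_commutator:
  assumes "a \<in> carrier G" "b \<in> carrier G" "c \<in> carrier G" and "generate G {a, b, c} = carrier G"
    and "a [^] (4::nat) = \<one>" and "b [^] (2::nat) = \<one>" and "c [^] (2::nat) = \<one>"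
    and "a \<otimes> b = b \<otimes> a" and "b \<otimes> c = c \<otimes> b" and "c \<otimes> a \<otimes> inv c = a \<otimes> b"
  shows "satisfies_presentation G (gen3 a b c) central_commutator_relators"
proof -
  have "word_value G (gen3 a b c) l = word_value G (gen3 a b c) r"
    if "(l, r) \<in> central_commutator_relators" for l r
    using that assms(5-10) assms(1-3) unfolding central_commutator_relators_def
    by (elim insertE emptyE; simp add: word_value_replicate m_assoc)
  thus ?thesis using assms(1-4) by (auto simp: satisfies_presentation_def range_gen3)
qed

lemma satisfies_central_commutatorD:
  assumes "satisfies_presentation G f central_commutator_relators"
  shows "f 0 \<in> carrier G" "f 1 \<in> carrier G" "f 2 \<in> carrier G" "generate G {f 0, f 1, f 2} = carrier G"
    "f 0 [^] (4::nat) = \<one>" "f 1 [^] (2::nat) = \<one>" "f 2 [^] (2::nat) = \<one>"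
    "f 0 \<otimes> f 1 = f 1 \<otimes> f 0" "f 1 \<otimes> f 2 = f 2 \<otimes> f 1" "f 2 \<otimes> f 0 \<otimes> inv (f 2) = f 0 \<otimes> f 1"
proof -
  have "range f = {f 0, f 1, f 2}" using range_gen3[of "f 0" "f 1" "f 2"] gen3_eta[of f] by simp
  moreover have f: "f i \<in> carrier G" for i using assms by (auto simp: satisfies_presentation_def)
  ultimately show "f 0 \<in> carrier G" "f 1 \<in> carrier G" "f 2 \<in> carrier G" "generate G {f 0, f 1, f 2} = carrier G"
    using assms by (auto simp: satisfies_presentation_def)
  have rel: "word_value G f l = word_value G f r" if "(l, r) \<in> central_commutator_relators" for l r
    using assms that by (auto simp: satisfies_presentation_def)
  show "f 0 [^] (4::nat) = \<one>" using rel[of "replicate 4 (Gen 0)" "[]"] f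
    by (simp add: central_commutator_relators_def word_value_replicate)
  show "f 1 [^] (2::nat) = \<one>" using rel[of "replicate 2 (Gen 1)" "[]"] f
    by (simp add: central_commutator_relators_def word_value_replicate)
  show "f 2 [^] (2::nat) = \<one>" using rel[of "replicate 2 (Gen 2)" "[]"] f
    by (simp add: central_commutator_relators_def word_value_replicate)
  show "f 0 \<otimes> f 1 = f 1 \<otimes> f 0" using rel[of "[Gen 0, Gen 1]" "[Gen 1, Gen 0]"] f
    by (simp add: central_commutator_relators_def)
  show "f 1 \<otimes> f 2 = f 2 \<otimes> f 1" using rel[of "[Gen 1, Gen 2]" "[Gen 2, Gen 1]"] f
    by (simp add: central_commutator_relators_def)
  show "f 2 \<otimes> f 0 \<otimes> inv (f 2) = f 0 \<otimes> f 1" using rel[of "[Gen 2, Gen 0, Inv 2]" "[Gen 0, Gen 1]"] f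
    by (simp add: central_commutator_relators_def m_assoc)
qed

end

lemma presented_group_central_commutator_card:
  defines "P \<equiv> presented_group central_commutator_relators"
  shows "finite (carrier P)" and "card (carrier P) \<le> 16"
proof -
  interpret P: group P unfolding P_def by (rule group_presented_group)
  define f where "f = presented_generator central_commutator_relators"
  note f = P.satisfies_central_commutatorD[OF satisfies_presentation_presented_group[of central_commutator_relators, folded P_def f_def]]
  let ?a = "f 0" and ?b = "f 1" and ?c = "f 2"
  have bg: "?b \<in> generate P {?b}" "?b \<in> generate P {?b, ?a}" "?a \<in> generate P {?b, ?a}"
    by (auto intro: generate.incl)
  have "?a \<otimes>\<^bsub>P\<^esub> ?b \<otimes>\<^bsub>P\<^esub> inv\<^bsub>P\<^esub> ?a = ?b" using f(1,2,8) by (simp add: P.m_assoc)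
  hence 1: "finite (generate P {?b, ?a})" "card (generate P {?b, ?a}) \<le> 2 * 4"
    using P.generate_metacyclic_card[OF f(2,1) _ _ f(6), of 4] f(5) bg generate.one[of P] by auto
  have "?c \<otimes>\<^bsub>P\<^esub> ?b \<otimes>\<^bsub>P\<^esub> inv\<^bsub>P\<^esub> ?c = ?b" using f(3,2) f(9)[symmetric] by (simp add: P.m_assoc)
  moreover have "?c \<otimes>\<^bsub>P\<^esub> ?a \<otimes>\<^bsub>P\<^esub> inv\<^bsub>P\<^esub> ?c \<in> generate P {?b, ?a}"
    unfolding f(10) using bg by (intro generate.eng)
  ultimately have "?c \<otimes>\<^bsub>P\<^esub> s \<otimes>\<^bsub>P\<^esub> inv\<^bsub>P\<^esub> ?c \<in> generate P {?b, ?a}" if "s \<in> {?b, ?a}" for s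
    using that bg by auto
  hence 2: "finite (generate P (insert ?c {?b, ?a}))"
    "card (generate P (insert ?c {?b, ?a})) \<le> 2 * card (generate P {?b, ?a})"
    using P.generate_cyclic_extension[of "{?b, ?a}" ?c 2] f(1,2,3,7) 1(1) generate.one[of P] by auto
  have "insert ?c {?b, ?a} = {?a, ?b, ?c}" by auto
  hence gen: "generate P (insert ?c {?b, ?a}) = carrier P" using f(4) by simp
  show "finite (carrier P)" using 2(1) unfolding gen .
  show "card (carrier P) \<le> 16" using 2(2) 1(2) unfolding gen by simp
qed

section \<open>Centralizers modulo the center\<close>

lemma (in normal) pow_card_rcosets_mem:
  assumes x: "x \<in> carrier G" and fin: "finite (carrier G)"
  shows "x [^] card (rcosets H) \<in> H"
proof -
  interpret Q: group "G Mod H" by (rule factorgroup_is_group)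
  have "H #> x \<in> carrier (G Mod H)"
    using x by (auto simp: FactGroup_def RCOSETS_def)
  hence "(H #> x) [^]\<^bsub>G Mod H\<^esub> order (G Mod H) = \<one>\<^bsub>G Mod H\<^esub>"
    by (rule Q.pow_order_eq_1)
  hence "(H #> x) [^]\<^bsub>G Mod H\<^esub> card (rcosets H) = H"
    by (simp add: order_def FactGroup_def)
  hence "H #> (x [^] card (rcosets H)) = H"
    using FactGroup_pow[OF x, of "card (rcosets H)"] by simp
  thus ?thesis using rcos_self[of "x [^] card (rcosets H)" H] x is_subgroup by simp
qed

context finite_group
begin

text \<open>If the center has prime index in a centralizer, no subgroup lies strictly between them. This is how
  generating sets are recognized below.\<close>

lemma centralizer_subset_of_prime_index:
  assumes v: "v \<in> carrier G - center G" and K: "subgroup K G" "center G \<subseteq> K" "v \<in> K"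
    and p: "card (centralizer G v) = p * card (center G)" "Factorial_Ring.prime p"
  shows "centralizer G v \<subseteq> K"
proof -
  note C = noncentral_centralizer[OF v]
  have s: "subgroup (K \<inter> centralizer G v) G"
    using subgroups_Inter_pair[OF K(1) C(4)] .
  have "card (center G) dvd card (K \<inter> centralizer G v)"
    using K(2) C(5) by (intro card_subgroup_dvd[OF center_subgroup s]) blast
  then obtain k where k: "card (K \<inter> centralizer G v) = k * card (center G)" by (metis dvd_def mult.commute)
  have z: "0 < card (center G)" using card_subgroup_pos center_subgroup by blast
  have "k * card (center G) dvd p * card (center G)"
    using card_subgroup_dvd[OF s C(4)] k p by simp
  hence "k dvd p" using z by simp
  moreover have "2 * card (center G) \<le> k * card (center G)"
    unfolding k[symmetric] using K v C by (intro proper_subgroup_card[OF center_subgroup s]) auto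
  hence "k \<noteq> 1" using z by simp
  ultimately have "k = p" using p(2) by (auto simp: prime_nat_iff)
  hence "card (K \<inter> centralizer G v) = card (centralizer G v)" using k p by simp
  hence "K \<inter> centralizer G v = centralizer G v"
    using finite_subset_carrier[OF centralizer_subset] by (intro card_subset_eq) auto
  thus ?thesis by blast
qed

text \<open>In the quotient of the centralizer by the center, the order of an element divides the index.\<close>

lemma pow_index_center:
  assumes v: "v \<in> carrier G - center G" and p: "card (centralizer G v) = p * card (center G)"
  shows "v [^] p \<in> center G"
proof -
  note C = noncentral_centralizer[OF v]
  let ?C = "G\<lparr>carrier := centralizer G v\<rparr>"
  interpret C: group ?C by (rule subgroup_imp_group[OF C(4)])
  have sub: "subgroup (center G) ?C" using subgroup_incl[OF center_subgroup C(4,5)] .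
  interpret N: normal "center G" ?C
  proof (rule C.normalI[OF sub], rule ballI)
    fix x assume "x \<in> carrier ?C"
    hence "x \<in> carrier G" using centralizer_subset[of G v] by auto
    thus "center G #>\<^bsub>?C\<^esub> x = x <#\<^bsub>?C\<^esub> center G"
      by (auto simp: r_coset_def l_coset_def center_def)
  qed
  have fin: "finite (carrier ?C)" using finite_subset_carrier[OF centralizer_subset] by simp
  have "card (rcosets\<^bsub>?C\<^esub> (center G)) * card (center G) = p * card (center G)"
    using C.lagrange[OF sub] p by (simp add: order_def)
  moreover have "0 < card (center G)" using card_subgroup_pos center_subgroup by blast
  ultimately have "card (rcosets\<^bsub>?C\<^esub> (center G)) = p" by simp
  moreover have "v [^]\<^bsub>?C\<^esub> card (rcosets\<^bsub>?C\<^esub> (center G)) \<in> center G"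
    using C(3) fin by (intro N.pow_card_rcosets_mem) auto
  ultimately show ?thesis by (simp flip: nat_pow_consistent)
qed

end

section \<open>Permutation representations\<close>

context finite_group
begin

lemma pow_card_subgroup:
  assumes H: "subgroup H G" and x: "x \<in> H"
  shows "x [^] card H = \<one>"
proof -
  interpret H: group "G\<lparr>carrier := H\<rparr>" by (rule subgroup_imp_group[OF H])
  have "x [^]\<^bsub>G\<lparr>carrier := H\<rparr>\<^esub> order (G\<lparr>carrier := H\<rparr>) = \<one>\<^bsub>G\<lparr>carrier := H\<rparr>\<^esub>"
    using x by (intro H.pow_order_eq_1) simp
  thus ?thesis by (simp add: order_def flip: nat_pow_consistent)
qed

lemma subgroup_eq_carrier:
  assumes H: "subgroup H G" and "order G \<le> card H"
  shows "H = carrier G"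
  using card_seteq[OF finite_carrier subgroup.subset[OF H]] assms(2) by (simp add: order_def)

text \<open>The square of an element of the second coset lies in the first.\<close>

lemma square_mem_index_two:
  assumes H: "subgroup H G" and index: "2 * card H = order G" and q: "q \<in> carrier G"
  shows "q \<otimes> q \<in> H"
proof (cases "q \<in> H")
  case True
  thus ?thesis using H by (simp add: subgroup.m_closed)
next
  case False
  note Hc = subgroup.subset[OF H]
  let ?qH = "(\<lambda>h. q \<otimes> h) ` H"
  have mem: "h' = q \<otimes> h \<Longrightarrow> False" if "h \<in> H" "h' \<in> H" for h h'
  proof -
    assume "h' = q \<otimes> h"
    hence "q = h' \<otimes> inv h" using that q Hc by (metis inv_solve_right subset_iff)
    thus False using False that H by (simp add: subgroup.m_closed subgroup.m_inv_closed)
  qed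
  hence dis: "H \<inter> ?qH = {}" by blast
  have "card ?qH = card H" using q Hc by (intro card_image) (auto simp: inj_on_def subset_eq)
  hence "card (H \<union> ?qH) = order G"
    using dis index finite_subset_carrier[OF Hc] by (simp add: card_Un_disjoint)
  moreover have "H \<union> ?qH \<subseteq> carrier G" using Hc q by auto
  ultimately have all: "H \<union> ?qH = carrier G"
    using card_subset_eq[OF finite_carrier] by (simp add: order_def)
  show ?thesis
  proof (rule ccontr)
    assume "q \<otimes> q \<notin> H"
    hence "q \<otimes> q \<in> ?qH" using all q by blast
    then obtain h where h: "h \<in> H" "q \<otimes> q = q \<otimes> h" by blast
    thus False using False q Hc by auto
  qed
qed

end

lemma finite_group_sym_group: "finite_group (sym_group n)"
proof -
  interpret group "sym_group n" by (rule sym_group_is_group)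
  have "finite {p. p permutes {1..n}}" by (rule finite_permutations) simp
  thus ?thesis by unfold_locales (simp add: sym_group_def)
qed

text \<open>A three-cycle is the square of its square, hence lies in every subgroup of index two.\<close>

lemma index_two_subgroup_sym_group:
  assumes H: "subgroup H (sym_group n)" and index: "2 * card H = fact n" and n: "2 \<le> n"
  shows "H = carrier (alt_group n)"
proof -
  interpret S: finite_group "sym_group n" by (rule finite_group_sym_group)
  interpret A: group "alt_group n" by (rule alt_group_is_group)
  have three: "p \<in> H" if "p \<in> three_cycles n" for p
  proof -
    obtain cs where cs: "p = cycle_of_list cs" "cycle cs" "length cs = 3" using \<open>p \<in> three_cycles n\<close> by auto
    then obtain a b c where abc: "cs = [a, b, c]" by (auto simp: length_Suc_conv numeral_3_eq_3)
    have p: "p \<in> carrier (sym_group n)"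
      using three_cycles_incl[of n] \<open>p \<in> three_cycles n\<close> by (auto simp: alt_group_carrier sym_group_carrier)
    have "p \<circ> p \<circ> p = id"
      using cs(2) unfolding cs(1) abc by (auto simp: fun_eq_iff Transposition.transpose_def)
    hence "(p \<circ> p) \<circ> (p \<circ> p) = p" by (simp add: comp_assoc)
    moreover have "(p \<circ> p) \<circ> (p \<circ> p) \<in> H"
      using S.square_mem_index_two[OF H _ S.m_closed[OF p p]] index
      by (simp add: sym_group_mult sym_group_card_carrier order_def)
    ultimately show ?thesis by simp
  qed
  have "g \<in> H" if "g \<in> generate (alt_group n) (three_cycles n)" for g
    using that
  proof (induction rule: generate.induct)
    case one
    show ?case using subgroup.one_closed[OF H] by (simp add: sym_group_one alt_group_one id_def)
  next
    case (inv p)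
    have "p \<in> carrier (alt_group n)" using three_cycles_incl inv by blast
    moreover have "p \<in> carrier (sym_group n)" using calculation by (simp add: alt_group_carrier sym_group_carrier)
    ultimately have "inv\<^bsub>alt_group n\<^esub> p = inv\<^bsub>sym_group n\<^esub> p"
      by (simp add: alt_group_inv_equality)
    thus ?case using subgroup.m_inv_closed[OF H three[OF inv]] by simp
  next
    case (eng p q)
    thus ?case using subgroup.m_closed[OF H] unfolding alt_group_mult sym_group_mult by blast
  qed (rule three)
  hence sub: "carrier (alt_group n) \<subseteq> H"
    using alt_group_carrier_as_three_cycles[of n] by blast
  have "card (carrier (alt_group n)) = card H"
    using alt_group_card_carrier[OF n] index by simp
  thus ?thesis using card_subset_eq[OF S.finite_subset_carrier[OF subgroup.subset[OF H]] sub] by simp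
qed

context finite_group
begin

lemma embedding_of_faithful_action:
  assumes E: "finite E" and closed: "\<And>g x. g \<in> carrier G \<Longrightarrow> x \<in> E \<Longrightarrow> \<phi> g x \<in> E"
    and mult: "\<And>g h x. g \<in> carrier G \<Longrightarrow> h \<in> carrier G \<Longrightarrow> x \<in> E \<Longrightarrow> \<phi> (g \<otimes> h) x = \<phi> g (\<phi> h x)"
    and one: "\<And>x. x \<in> E \<Longrightarrow> \<phi> \<one> x = x"
    and faithful: "\<And>g. g \<in> carrier G \<Longrightarrow> (\<And>x. x \<in> E \<Longrightarrow> \<phi> g x = x) \<Longrightarrow> g = \<one>"
  shows "\<exists>h \<in> hom G (sym_group (card E)). inj_on h (carrier G)"
proof -
  let ?n = "card E"
  obtain e where e: "bij_betw e {1..?n} E" using ex_bij_betw_nat_finite_1[OF E] by blast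
  define d where "d = inv_into {1..?n} e"
  have ed: "e i \<in> E" "d (e i) = i" if "i \<in> {1..?n}" for i
    using that e by (auto simp: bij_betw_def d_def)
  have de: "d x \<in> {1..?n}" "e (d x) = x" if "x \<in> E" for x
    using that e inv_into_into[of x e "{1..?n}"] f_inv_into_f[of x e "{1..?n}"]
    by (auto simp: bij_betw_def d_def simp del: atLeastAtMost_iff)
  define \<rho> where "\<rho> g i = (if i \<in> {1..?n} then d (\<phi> g (e i)) else i)" for g i
  have \<rho>mult: "\<rho> (g \<otimes> h) = \<rho> g \<circ> \<rho> h" if "g \<in> carrier G" "h \<in> carrier G" for g h
  proof
    fix i
    show "\<rho> (g \<otimes> h) i = (\<rho> g \<circ> \<rho> h) i"
      using that ed[of i] de[OF closed] by (cases "i \<in> {1..?n}") (simp_all add: \<rho>_def mult del: atLeastAtMost_iff)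
  qed
  have \<rho>one: "\<rho> \<one> = id" using ed one by (auto simp: \<rho>_def fun_eq_iff)
  have perm: "\<rho> g permutes {1..?n}" if g: "g \<in> carrier G" for g
  proof (rule bij_imp_permutes)
    have "\<rho> g ` {1..?n} \<subseteq> {1..?n}" if "g \<in> carrier G" for g
      using that ed closed de(1) by (auto simp: \<rho>_def simp del: atLeastAtMost_iff)
    moreover have "\<rho> g (\<rho> (inv g) i) = i" "\<rho> (inv g) (\<rho> g i) = i" for i
      using \<rho>mult[of g "inv g"] \<rho>mult[of "inv g" g] g \<rho>one by (metis comp_apply id_apply inv_closed l_inv r_inv)+
    ultimately show "bij_betw (\<rho> g) {1..?n} {1..?n}"
      using g by (intro bij_betwI[of _ _ _ "\<rho> (inv g)"]) auto
  qed (auto simp: \<rho>_def)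
  have "\<rho> \<in> hom G (sym_group ?n)"
    using perm \<rho>mult by (auto simp: hom_def sym_group_carrier sym_group_mult)
  moreover have "inj_on \<rho> (carrier G)"
  proof (rule inj_onI)
    fix g h assume gh: "g \<in> carrier G" "h \<in> carrier G" "\<rho> g = \<rho> h"
    have "\<rho> (inv h \<otimes> g) = id"
      using gh \<rho>mult[of "inv h" g] \<rho>mult[of "inv h" h] \<rho>one by simp
    have "\<phi> (inv h \<otimes> g) x = x" if x: "x \<in> E" for x
    proof -
      have "d (\<phi> (inv h \<otimes> g) x) = d x"
        using fun_cong[OF \<open>\<rho> (inv h \<otimes> g) = id\<close>, of "d x"] de[OF x] by (simp add: \<rho>_def del: atLeastAtMost_iff)
      thus ?thesis using de(2) closed[of "inv h \<otimes> g" x] x gh by (metis inv_closed m_closed)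
    qed
    hence "inv h \<otimes> g = \<one>" using faithful gh by simp
    thus "g = h" using gh by (metis inv_closed inv_equality inv_inv)
  qed
  ultimately show ?thesis by blast
qed

lemma iso_sym_group_of_embedding:
  assumes h: "h \<in> hom G (sym_group n)" and inj: "inj_on h (carrier G)" and card: "order G = fact n"
  shows "G \<cong> sym_group n"
proof -
  interpret S: finite_group "sym_group n" by (rule finite_group_sym_group)
  have "h ` carrier G \<subseteq> carrier (sym_group n)" using h by (auto simp: hom_def)
  hence "h ` carrier G = carrier (sym_group n)"
    using card_image[OF inj] card S.finite_carrier by (intro card_subset_eq) (auto simp: sym_group_card_carrier order_def)
  thus ?thesis using h inj by (auto simp: is_iso_def iso_def bij_betw_def)
qed

lemma iso_alt_group_of_embedding:
  assumes h: "h \<in> hom G (sym_group n)" and inj: "inj_on h (carrier G)" and card: "2 * order G = fact n"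
    and n: "2 \<le> n"
  shows "G \<cong> alt_group n"
proof -
  interpret h: group_hom G "sym_group n" h
    by (rule group_hom.intro[OF is_group sym_group_is_group]) (simp add: group_hom_axioms_def h)
  have "h ` carrier G = carrier (alt_group n)"
    using h.img_is_subgroup card_image[OF inj] card n by (intro index_two_subgroup_sym_group) (auto simp: order_def)
  moreover have "h \<in> hom G (alt_group n)"
    using h calculation by (auto simp: hom_def alt_group_mult sym_group_mult)
  ultimately show ?thesis using inj by (auto simp: is_iso_def iso_def bij_betw_def)
qed

end

context small_centralizer_group
begin

section \<open>Trivial center\<close>

lemma mem_centralizer_class: "v \<in> carrier G - center G \<Longrightarrow> v \<in> centralizer_class (card (centralizer G v))"
  by (simp add: centralizer_class_def)

lemma class_size_finite: "finite (centralizer_class c)"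
  by (rule finite_subset_carrier) (auto simp: centralizer_class_def)

lemma obtain_in_class:
  assumes "class_size c \<noteq> 0"
  obtains v where "v \<in> carrier G - center G" "v \<in> carrier G" "card (centralizer G v) = c" "v \<in> centralizer_class c"
proof -
  have "centralizer_class c \<noteq> {}" using assms by auto
  then obtain v where "v \<in> centralizer_class c" by blast
  thus ?thesis by (intro that[of v]) (auto simp: centralizer_class_def)
qed

lemma conj_action_mult:
  assumes "g \<in> carrier G" "h \<in> carrier G" "x \<in> carrier G"
  shows "(g \<otimes> h) \<otimes> x \<otimes> inv (g \<otimes> h) = g \<otimes> (h \<otimes> x \<otimes> inv h) \<otimes> inv g"
  using assms by (simp add: inv_mult_group m_assoc)

lemma conj_class_conj:
  assumes v: "v \<in> carrier G" and w: "w \<in> conj_class v" and g: "g \<in> carrier G"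
  shows "g \<otimes> w \<otimes> inv g \<in> conj_class v"
proof -
  obtain h where h: "h \<in> carrier G" "w = h \<otimes> v \<otimes> inv h" using w by (auto simp: conj_class_def)
  have "g \<otimes> w \<otimes> inv g = (g \<otimes> h) \<otimes> v \<otimes> inv (g \<otimes> h)"
    using conj_action_mult[OF g h(1) v] h(2) by simp
  thus ?thesis using g h(1) unfolding conj_class_def by blast
qed

text \<open>Distinct centralizers of noncentral elements meet only in the center, so an element that centralizes two
  noncommuting members of a conjugacy class is central.\<close>

lemma conj_class_embedding:
  assumes z: "card (center G) = 1" and v: "v \<in> carrier G - center G"
    and ord: "order G = card (centralizer G v) * m" and m: "card (centralizer G v) \<le> m"
  shows "\<exists>h \<in> hom G (sym_group m). inj_on h (carrier G)"
proof -
  have vc: "v \<in> carrier G" using v by simp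
  have Z: "center G = {\<one>}"
    using z subgroup.one_closed[OF center_subgroup] by (auto simp: card_1_singleton_iff)
  have cpos: "0 < card (centralizer G v)" using card_subgroup_pos noncentral_centralizer(4)[OF v] by blast
  have cm: "card (conj_class v) = m"
    using card_conj_class[OF vc] ord cpos by (metis mult.commute nat_mult_eq_cancel1)
  have "\<not> conj_class v \<subseteq> centralizer G v - center G"
  proof
    assume "conj_class v \<subseteq> centralizer G v - center G"
    moreover have "finite (centralizer G v - center G)"
      using centralizer_subset[of G v] by (intro finite_subset_carrier) blast
    ultimately have "m \<le> card (centralizer G v - center G)" using cm card_mono by blast
    also have "\<dots> < card (centralizer G v)"
      using noncentral_centralizer(5)[OF v] z cpos finite_subset_carrier[OF center_subset]
      by (simp add: card_Diff_subset)
    finally show False using m by simp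
  qed
  then obtain w where w: "w \<in> conj_class v" "w \<notin> centralizer G v - center G" by blast
  have wG: "w \<in> carrier G - center G"
  proof -
    obtain g where "g \<in> carrier G" "w = g \<otimes> v \<otimes> inv g" using w(1) by (auto simp: conj_class_def)
    thus ?thesis
      using centralizer_class_conj[OF mem_centralizer_class[OF v]] by (simp add: centralizer_class_def)
  qed
  hence wv: "w \<notin> centralizer G v" using w by blast
  have "\<exists>h \<in> hom G (sym_group (card (conj_class v))). inj_on h (carrier G)"
  proof (rule embedding_of_faithful_action[where \<phi> = "\<lambda>g x. g \<otimes> x \<otimes> inv g"])
    show "finite (conj_class v)" using conj_class_subset[OF vc] by (rule finite_subset_carrier)
  next
    fix g assume g: "g \<in> carrier G" and stab: "\<And>x. x \<in> conj_class v \<Longrightarrow> g \<otimes> x \<otimes> inv g = x"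
    have "g \<in> centralizer G v" "g \<in> centralizer G w"
      using stab[OF conj_class_self[OF vc]] stab[OF w(1)] conj_eq_iff[of g] g vc wG by (auto simp: centralizer_def)
    hence "g \<in> center G"
      using centralizer_eq[OF v, of g] centralizer_eq[OF wG, of g] wv noncentral_centralizer(3)[OF wG] by blast
    thus "g = \<one>" using Z by simp
  next
    fix g h x assume "g \<in> carrier G" "h \<in> carrier G" "x \<in> conj_class v"
    thus "(g \<otimes> h) \<otimes> x \<otimes> inv (g \<otimes> h) = g \<otimes> (h \<otimes> x \<otimes> inv h) \<otimes> inv g"
      using conj_class_subset[OF vc] by (intro conj_action_mult) auto
  next
    fix x assume "x \<in> conj_class v"
    hence "x \<in> carrier G" using conj_class_subset[OF vc] by blast
    thus "\<one> \<otimes> x \<otimes> inv \<one> = x" by simp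
  qed (use conj_class_conj[OF vc] in auto)
  thus ?thesis by (simp add: cm)
qed

lemma iso_S3:
  assumes z: "card (center G) = 1" and ord: "order G = 6" and N: "class_size 2 \<noteq> 0"
  shows "G \<cong> sym_group 3"
proof -
  obtain v where v: "v \<in> carrier G - center G" "card (centralizer G v) = 2"
    using obtain_in_class[OF N] by blast
  have "\<exists>h \<in> hom G (sym_group 3). inj_on h (carrier G)"
    using v ord by (intro conj_class_embedding[OF z v(1)]) simp_all
  thus ?thesis using iso_sym_group_of_embedding ord by (auto simp: fact_numeral)
qed

lemma iso_A4:
  assumes z: "card (center G) = 1" and ord: "order G = 12" and N: "class_size 3 \<noteq> 0"
  shows "G \<cong> alt_group 4"
proof -
  obtain v where v: "v \<in> carrier G - center G" "card (centralizer G v) = 3"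
    using obtain_in_class[OF N] by blast
  have "\<exists>h \<in> hom G (sym_group 4). inj_on h (carrier G)"
    using v ord by (intro conj_class_embedding[OF z v(1)]) simp_all
  thus ?thesis using iso_alt_group_of_embedding[of _ 4] ord by (auto simp: fact_numeral)
qed

text \<open>The fifteen elements with centralizer of order four form one class and are distributed over
  five centralizers, which the group permutes transitively by conjugation. The kernel of this action is a
  union of conjugacy classes, which have at least twelve elements each apart from the trivial
  one, while transitivity on five points bounds its order by twelve.\<close>

lemma iso_A5:
  assumes z: "card (center G) = 1" and ord: "order G = 60" and N: "class_size 4 = 15"
  shows "G \<cong> alt_group 5"
proof -
  let ?E = "centralizer G ` centralizer_class 4"
  let ?c = "\<lambda>g A. (\<lambda>w. g \<otimes> w \<otimes> inv g) ` A"
  have Z: "center G = {\<one>}"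
    using z subgroup.one_closed[OF center_subgroup] by (auto simp: card_1_singleton_iff)
  have cardE: "card ?E = 5" using card_centralizer_class_partition[of 4] N z by simp
  have finE: "finite ?E" using class_size_finite by simp
  have Ec: "A \<subseteq> carrier G" if "A \<in> ?E" for A using \<open>A \<in> ?E\<close> centralizer_subset[of G] by auto
  have closed: "?c g A \<in> ?E" if "g \<in> carrier G" "A \<in> ?E" for g A
  proof -
    obtain v where v: "v \<in> centralizer_class 4" "A = centralizer G v" using \<open>A \<in> ?E\<close> by blast
    have "?c g A = centralizer G (g \<otimes> v \<otimes> inv g)"
      using v centralizer_conj(1)[of v g] that(1) by (simp add: centralizer_class_def)
    thus ?thesis using centralizer_class_conj[OF v(1) that(1)] by blast
  qed
  have mult: "?c (g \<otimes> h) A = ?c g (?c h A)" if "g \<in> carrier G" "h \<in> carrier G" "A \<in> ?E" for g h A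
    unfolding image_image using Ec[OF that(3)] conj_action_mult[OF that(1,2)] by (intro image_cong) auto
  have one: "?c \<one> A = A" if "A \<in> ?E" for A
  proof -
    have "\<one> \<otimes> w \<otimes> inv \<one> = w" if "w \<in> A" for w using Ec[OF \<open>A \<in> ?E\<close>] that by auto
    thus ?thesis by simp
  qed
  obtain v where v: "v \<in> carrier G - center G" "v \<in> carrier G" "card (centralizer G v) = 4" "v \<in> centralizer_class 4"
    using obtain_in_class[of 4] N by auto
  have "card (conj_class v) = 15" using card_conj_class[OF v(2)] v(3) ord by simp
  moreover have "conj_class v \<subseteq> centralizer_class 4"
    using centralizer_class_conj[OF v(4)] by (auto simp: conj_class_def)
  ultimately have class_v: "conj_class v = centralizer_class 4"
    using N class_size_finite by (intro card_subset_eq) auto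
  let ?C = "centralizer G v"
  have trans: "\<exists>g \<in> carrier G. ?c g ?C = A" if A: "A \<in> ?E" for A
  proof -
    obtain w where w: "w \<in> conj_class v" "A = centralizer G w" using A class_v by blast
    then obtain g where "g \<in> carrier G" "w = g \<otimes> v \<otimes> inv g" by (auto simp: conj_class_def)
    thus ?thesis using centralizer_conj(1)[OF v(2)] w(2) by auto
  qed
  \<comment> \<open>\<open>s\<close> chooses coset representatives of the stabilizer of \<open>?C\<close>, and \<open>K\<close> is the kernel.\<close>
  define s where "s A = (SOME g. g \<in> carrier G \<and> ?c g ?C = A)" for A
  have s: "s A \<in> carrier G" "?c (s A) ?C = A" if "A \<in> ?E" for A
    using someI_ex[of "\<lambda>g. g \<in> carrier G \<and> ?c g ?C = A"] trans[OF that] unfolding s_def by blast+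
  define K where "K = {g \<in> carrier G. \<forall>A \<in> ?E. ?c g A = A}"
  have CE: "?C \<in> ?E" using v(4) by blast
  have "inj_on (\<lambda>(A, k). s A \<otimes> k) (?E \<times> K)"
  proof (rule inj_onI)
    fix p q assume pq: "p \<in> ?E \<times> K" "q \<in> ?E \<times> K"
      "(case p of (A, k) \<Rightarrow> s A \<otimes> k) = (case q of (A, k) \<Rightarrow> s A \<otimes> k)"
    obtain A k B l where p: "p = (A, k)" "q = (B, l)" by (cases p, cases q)
    have *: "A \<in> ?E" "B \<in> ?E" "k \<in> K" "l \<in> K" "s A \<otimes> k = s B \<otimes> l" using pq p by auto
    have "?c (s A \<otimes> k) ?C = A" if "A \<in> ?E" "k \<in> K" for A k
    proof -
      have k: "k \<in> carrier G" "?c k ?C = ?C" using that(2) CE by (auto simp: K_def)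
      show ?thesis using mult[OF s(1)[OF that(1)] k(1) CE] s(2)[OF that(1)] unfolding k(2) by simp
    qed
    hence "A = B" using * by metis
    moreover have "k = l" using * calculation s(1)[of A] by (auto simp: K_def)
    ultimately show "p = q" using p by simp
  qed
  moreover have "(\<lambda>(A, k). s A \<otimes> k) ` (?E \<times> K) \<subseteq> carrier G" using s(1) by (auto simp: K_def)
  ultimately have "card (?E \<times> K) \<le> order G"
    using card_inj_on_le finite_carrier by (fastforce simp: order_def)
  hence cardK: "card K \<le> 12" using cardE ord by (simp add: card_cartesian_product)
  have K1: "g = \<one>" if g: "g \<in> K" for g
  proof (rule ccontr)
    assume "g \<noteq> \<one>"
    hence gG: "g \<in> carrier G - center G" "g \<in> carrier G" using g Z by (auto simp: K_def)
    have "conj_class g \<subseteq> K"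
    proof
      fix k assume "k \<in> conj_class g"
      then obtain h where h: "h \<in> carrier G" "k = h \<otimes> g \<otimes> inv h" by (auto simp: conj_class_def)
      have "?c k A = A" if A: "A \<in> ?E" for A
      proof -
        have "?c k A = ?c h (?c g (?c (inv h) A))"
          unfolding h(2)
          using mult[OF m_closed[OF h(1) gG(2)] inv_closed[OF h(1)] A]
            mult[OF h(1) gG(2) closed[OF inv_closed[OF h(1)] A]] by simp
        also have "?c g (?c (inv h) A) = ?c (inv h) A"
          using g closed[OF inv_closed[OF h(1)] A] unfolding K_def by blast
        also have "?c h (?c (inv h) A) = A" using mult[of h "inv h" A] one[OF A] A h by simp
        finally show ?thesis .
      qed
      thus "k \<in> K" using h gG by (simp add: K_def)
    qed
    moreover have "\<one> \<in> K" using one by (simp add: K_def)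
    ultimately have "insert \<one> (conj_class g) \<subseteq> K" by blast
    moreover have "finite K" by (rule finite_subset_carrier) (auto simp: K_def)
    ultimately have "card (insert \<one> (conj_class g)) \<le> 12" using cardK card_mono le_trans by blast
    moreover have "\<one> \<notin> conj_class g"
    proof
      assume "\<one> \<in> conj_class g"
      then obtain h where "h \<in> carrier G" "h \<otimes> g \<otimes> inv h = \<one>" by (auto simp: conj_class_def)
      thus False using center_conj[OF gG(2)] Z gG by auto
    qed
    moreover have "finite (conj_class g)" using conj_class_subset[OF gG(2)] finite_subset_carrier by blast
    ultimately have "card (conj_class g) \<le> 11" by simp
    hence "card (conj_class g) * card (centralizer G g) \<le> 11 * 5"
      using card_centralizer_le[OF gG(1)] z by (intro mult_le_mono) auto
    thus False using card_conj_class[OF gG(2)] ord by simp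
  qed
  have "\<exists>h \<in> hom G (sym_group (card ?E)). inj_on h (carrier G)"
    using finE closed mult one K1 by (intro embedding_of_faithful_action[where \<phi> = ?c]) (auto simp: K_def)
  thus ?thesis using iso_alt_group_of_embedding[of _ 5] ord cardE by (auto simp: fact_numeral)
qed

end

context group
begin

lemma inv_mult_cancel: "x \<in> carrier G \<Longrightarrow> y \<in> carrier G \<Longrightarrow> inv x \<otimes> (x \<otimes> y) = y"
  and mult_inv_cancel: "x \<in> carrier G \<Longrightarrow> y \<in> carrier G \<Longrightarrow> x \<otimes> (inv x \<otimes> y) = y"
  by (simp_all flip: m_assoc)

lemmas word_simps = m_assoc inv_mult_cancel mult_inv_cancel inv_mult_group

lemma pow_2: "x \<in> carrier G \<Longrightarrow> x [^] (2::nat) = x \<otimes> x"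
  by (simp add: numeral_2_eq_2)

lemma conj_pow:
  assumes "b \<in> carrier G" "x \<in> carrier G"
  shows "b \<otimes> x [^] (n::nat) \<otimes> inv b = (b \<otimes> x \<otimes> inv b) [^] n"
proof (induction n)
  case (Suc n)
  thus ?case using conj_mult[of b "x [^] n" x] assms by simp
qed (use assms in simp)

end

context small_centralizer_group
begin

lemma centralizer_cong:
  assumes "v \<in> carrier G - center G" "w \<in> centralizer G v" "w \<notin> center G"
  shows "centralizer G w = centralizer G v" "w \<in> carrier G - center G"
    "w \<in> centralizer_class (card (centralizer G v))"
proof -
  show 1: "centralizer G w = centralizer G v" using assms by (intro centralizer_eq) auto
  show "w \<in> carrier G - center G" using assms(2,3) centralizer_subset[of G v] by auto
  thus "w \<in> centralizer_class (card (centralizer G v))" using 1 by (simp add: centralizer_class_def)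
qed

lemma centralizer_minus_center_eq_class:
  assumes "v \<in> centralizer_class c" and "class_size c = c - card (center G)"
  shows "centralizer G v - center G = centralizer_class c"
proof (rule card_subset_eq[OF class_size_finite])
  have v: "v \<in> carrier G - center G" "card (centralizer G v) = c"
    using assms(1) by (auto simp: centralizer_class_def)
  show "centralizer G v - center G \<subseteq> centralizer_class c"
    using centralizer_cong(3)[OF v(1)] v(2) by blast
  show "card (centralizer G v - center G) = class_size c"
    using assms(2) v noncentral_centralizer(5)[OF v(1)] finite_subset_carrier[OF center_subset]
    by (simp add: card_Diff_subset)
qed

text \<open>Outside the centralizer of an element \<open>a\<close> of order five all elements are involutions, and
  \<open>b\<close> and \<open>b \<otimes> a\<close> being involutions means that \<open>b\<close> inverts \<open>a\<close>.\<close>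

lemma presentation_order_10:
  assumes z: "card (center G) = 1" and ord: "order G = 10"
    and N: "class_size 2 = 5" "class_size 3 = 0" "class_size 4 = 0" "class_size 5 = 4"
  shows "\<exists>a b. satisfies_presentation G (gen2 a b) (metacyclic_relators 5 2 0 [Inv 0])"
proof -
  have Z: "center G = {\<one>}"
    using z subgroup.one_closed[OF center_subgroup] by (auto simp: card_1_singleton_iff)
  obtain a where a: "a \<in> carrier G - center G" "a \<in> carrier G" "card (centralizer G a) = 5" "a \<in> centralizer_class 5"
    using obtain_in_class[of 5] N by auto
  obtain b where b: "b \<in> carrier G - center G" "b \<in> carrier G" "card (centralizer G b) = 2" "b \<in> centralizer_class 2"
    using obtain_in_class[of 2] N by auto
  have A: "centralizer G a - center G = centralizer_class 5"
    using a(4) N z by (intro centralizer_minus_center_eq_class) simp_all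
  have sq: "x \<otimes> x = \<one>" if x: "x \<in> carrier G" "x \<notin> centralizer G a" for x
  proof -
    have xZ: "x \<in> carrier G - center G" using x center_subset_centralizer[OF a(2)] by blast
    have "x \<notin> centralizer_class 5" using A x by blast
    moreover have "class_size (card (centralizer G x)) \<noteq> 0"
      using mem_centralizer_class[OF xZ] class_size_finite by auto
    moreover have "card (centralizer G x) \<in> {2, 3, 4, 5}"
      using noncentral_centralizer(1)[OF xZ] card_centralizer_le[OF xZ] z by auto
    ultimately have "card (centralizer G x) = 2"
      using N xZ by (auto simp: centralizer_class_def)
    hence "x [^] (2::nat) = \<one>"
      using pow_card_subgroup[OF noncentral_centralizer(4,3)[OF xZ]] by simp
    thus ?thesis using x by (simp add: pow_2)
  qed
  have bA: "b \<notin> centralizer G a"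
  proof
    assume "b \<in> centralizer G a"
    hence "b \<in> centralizer_class 5" using A b(1) by blast
    thus False using b(3) by (simp add: centralizer_class_def)
  qed
  have baA: "b \<otimes> a \<notin> centralizer G a"
  proof
    assume "b \<otimes> a \<in> centralizer G a"
    hence "b \<otimes> a \<otimes> inv a \<in> centralizer G a"
      using noncentral_centralizer(3,4)[OF a(1)] by (simp add: subgroup.m_closed subgroup.m_inv_closed)
    thus False using bA a b by (simp add: m_assoc)
  qed
  have "b \<otimes> b = \<one>" using sq b bA by simp
  moreover have "b \<otimes> a \<otimes> (b \<otimes> a) = \<one>" using sq[OF _ baA] a b by simp
  hence "b \<otimes> a \<otimes> b \<otimes> a = \<one>" using a b by (simp add: m_assoc)
  hence "b \<otimes> a \<otimes> b = inv a" using a b by (metis inv_equality inv_inv inv_closed m_closed)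
  moreover have "inv b = b" using \<open>b \<otimes> b = \<one>\<close> b by (metis inv_equality)
  moreover have "a [^] (5::nat) = \<one>"
    using pow_card_subgroup[OF noncentral_centralizer(4,3)[OF a(1)]] a by simp
  moreover have "generate G {a, b} = carrier G"
  proof -
    let ?K = "generate G {a, b}"
    have K: "subgroup ?K G" using a b by (intro generate_is_subgroup) auto
    have ab: "a \<in> ?K" "b \<in> ?K" by (auto intro: generate.incl)
    have ZK: "center G \<subseteq> ?K" using Z generate.one[of G] by simp
    have "centralizer G a \<subseteq> ?K"
      using a z ab ZK K by (intro centralizer_subset_of_prime_index[of a ?K 5]) simp_all
    moreover have "centralizer G b \<subseteq> ?K"
      using b z ab ZK K by (intro centralizer_subset_of_prime_index[of b ?K 2]) simp_all
    ultimately have "5 dvd card ?K" "2 dvd card ?K"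
      using card_subgroup_dvd[OF noncentral_centralizer(4) K] a b by metis+
    moreover have "0 < card ?K" using card_subgroup_pos[OF K] .
    ultimately have "10 \<le> card ?K" by presburger
    thus ?thesis using ord by (intro subgroup_eq_carrier[OF K]) simp
  qed
  ultimately have "satisfies_presentation G (gen2 a b) (metacyclic_relators 5 2 0 [Inv 0])"
    using a b by (intro satisfies_metacyclic) (simp_all add: pow_2)
  thus ?thesis by blast
qed

text \<open>The four nontrivial powers of an element \<open>a\<close> of order five form one class, so that some \<open>b\<close>
  conjugates \<open>a\<close> to its square; then \<open>b\<close> acts with order four.\<close>

lemma presentation_order_20:
  assumes z: "card (center G) = 1" and ord: "order G = 20"
    and N: "class_size 2 = 0" "class_size 3 = 0" "class_size 5 = 4"
  shows "\<exists>a b. satisfies_presentation G (gen2 a b) (metacyclic_relators 5 4 0 [Gen 0, Gen 0])"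
proof -
  have Z: "center G = {\<one>}"
    using z subgroup.one_closed[OF center_subgroup] by (auto simp: card_1_singleton_iff)
  obtain a where a: "a \<in> carrier G - center G" "a \<in> carrier G" "card (centralizer G a) = 5" "a \<in> centralizer_class 5"
    using obtain_in_class[of 5] N by auto
  have A: "centralizer G a - center G = centralizer_class 5"
    using a(4) N z by (intro centralizer_minus_center_eq_class) simp_all
  have a5: "a [^] (5::nat) = \<one>"
    using pow_card_subgroup[OF noncentral_centralizer(4,3)[OF a(1)]] a by simp
  have a1: "a \<noteq> \<one>" using a Z by auto
  have "conj_class a = centralizer_class 5"
  proof (rule card_subset_eq[OF class_size_finite])
    show "conj_class a \<subseteq> centralizer_class 5"
      using centralizer_class_conj[OF a(4)] by (auto simp: conj_class_def)
    show "card (conj_class a) = class_size 5"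
      using card_conj_class[OF a(2)] a(3) ord N by simp
  qed
  moreover have "a \<otimes> a \<in> centralizer G a - center G"
  proof -
    have "a \<otimes> a \<noteq> \<one>"
    proof
      assume "a \<otimes> a = \<one>"
      hence "a [^] (2::nat) = \<one>" using a by (simp add: pow_2)
      moreover have "a [^] (5::nat) = a [^] (2::nat) \<otimes> a [^] (2::nat) \<otimes> a"
        using a by (simp add: numeral_eq_Suc m_assoc)
      ultimately show False using a5 a1 a by simp
    qed
    thus ?thesis using a Z by (simp add: centralizer_def m_assoc)
  qed
  ultimately have "a \<otimes> a \<in> conj_class a" using A by simp
  then obtain b where b: "b \<in> carrier G" "b \<otimes> a \<otimes> inv b = a \<otimes> a" by (auto simp: conj_class_def)
  have bA: "b \<notin> centralizer G a"
  proof
    assume "b \<in> centralizer G a"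
    hence "b \<otimes> a \<otimes> inv b = a" using conj_eq_iff[OF b(1) a(2) a(2)] by (simp add: centralizer_def)
    thus False using b a a1 by simp
  qed
  hence bZ: "b \<in> carrier G - center G" using b center_subset_centralizer[OF a(2)] by blast
  have cb: "card (centralizer G b) = 4"
  proof -
    have "b \<notin> centralizer_class 5" using A bA by blast
    moreover have "class_size (card (centralizer G b)) \<noteq> 0"
      using mem_centralizer_class[OF bZ] class_size_finite by auto
    moreover have "card (centralizer G b) \<in> {2, 3, 4, 5}"
      using noncentral_centralizer(1)[OF bZ] card_centralizer_le[OF bZ] z by auto
    ultimately show ?thesis
      using N bZ by (auto simp: centralizer_class_def)
  qed
  have b4: "b [^] (4::nat) = \<one>"
    using pow_card_subgroup[OF noncentral_centralizer(4,3)[OF bZ]] cb by simp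
  have b2: "b \<otimes> b \<noteq> \<one>"
  proof
    assume bb: "b \<otimes> b = \<one>"
    have "a = (b \<otimes> b) \<otimes> a \<otimes> inv (b \<otimes> b)" using bb a by simp
    also have "\<dots> = b \<otimes> (a \<otimes> a) \<otimes> inv b" using a b(1) conj_action_mult[of b b a] b(2) by simp
    also have "\<dots> = a \<otimes> a \<otimes> (a \<otimes> a)" using conj_mult[OF b(1) a(2) a(2)] b(2) by simp
    finally have "\<one> = a \<otimes> (a \<otimes> a)" using a by (simp add: m_assoc)
    hence 3: "a [^] (3::nat) = \<one>" using a by (simp add: numeral_eq_Suc m_assoc)
    have "a [^] (5::nat) = a [^] (3::nat) \<otimes> (a \<otimes> a)" using a by (simp add: numeral_eq_Suc m_assoc)
    hence "a \<otimes> a = \<one>" using 3 a5 a by simp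
    thus False using \<open>a \<otimes> a \<in> centralizer G a - center G\<close> Z by simp
  qed
  have "generate G {a, b} = carrier G"
  proof -
    let ?K = "generate G {a, b}"
    have K: "subgroup ?K G" using a b by (intro generate_is_subgroup) auto
    have ab: "a \<in> ?K" "b \<in> ?K" by (auto intro: generate.incl)
    have ZK: "center G \<subseteq> ?K" using Z generate.one[of G] by simp
    have "centralizer G a \<subseteq> ?K"
      using a z ab ZK K by (intro centralizer_subset_of_prime_index[of a ?K 5]) simp_all
    hence "5 dvd card ?K"
      using card_subgroup_dvd[OF noncentral_centralizer(4) K] a by metis
    moreover have "4 dvd card ?K"
    proof -
      have s: "subgroup (?K \<inter> centralizer G b) G"
        using subgroups_Inter_pair[OF K noncentral_centralizer(4)[OF bZ]] .
      have "b \<in> ?K \<inter> centralizer G b" using ab noncentral_centralizer(3)[OF bZ] by blast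
      hence "{\<one>, b, b \<otimes> b} \<subseteq> ?K \<inter> centralizer G b"
        using subgroup.one_closed[OF s] subgroup.m_closed[OF s] by blast
      moreover have "card {\<one>, b, b \<otimes> b} = 3"
        using b2 b bZ Z by auto
      ultimately have "3 \<le> card (?K \<inter> centralizer G b)"
        using card_mono[OF finite_subset_carrier[OF subgroup.subset[OF s]]] by metis
      moreover have "card (?K \<inter> centralizer G b) dvd 4"
        using card_subgroup_dvd[OF s noncentral_centralizer(4)[OF bZ]] cb by simp
      ultimately have "card (?K \<inter> centralizer G b) = 4"
        using dvd_imp_le[of "card (?K \<inter> centralizer G b)" 4] by (cases "card (?K \<inter> centralizer G b) = 3") auto
      moreover have "card (?K \<inter> centralizer G b) dvd card ?K"
        by (rule card_subgroup_dvd[OF s K]) blast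
      ultimately show ?thesis by simp
    qed
    moreover have "0 < card ?K" using card_subgroup_pos[OF K] .
    ultimately have "20 \<le> card ?K" by presburger
    thus ?thesis using ord by (intro subgroup_eq_carrier[OF K]) simp
  qed
  hence "satisfies_presentation G (gen2 a b) (metacyclic_relators 5 4 0 [Gen 0, Gen 0])"
    using a b a5 b4 by (intro satisfies_metacyclic) simp_all
  thus ?thesis by blast
qed

section \<open>Center of order two\<close>

lemma center_2:
  assumes "card (center G) = 2"
  obtains t where "center G = {\<one>, t}" "t \<noteq> \<one>" "t \<in> carrier G" "t \<otimes> t = \<one>"
    "\<And>g. g \<in> carrier G \<Longrightarrow> t \<otimes> g = g \<otimes> t"
proof -
  have 1: "\<one> \<in> center G" using subgroup.one_closed[OF center_subgroup] .
  hence "card (center G - {\<one>}) = 1" using assms by simp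
  then obtain t where "center G - {\<one>} = {t}" by (rule card_1_singletonE)
  hence t: "center G = {\<one>, t}" "t \<noteq> \<one>" using 1 by auto
  have tc: "t \<in> center G" using t by simp
  hence tG: "t \<in> carrier G" by (simp add: center_def)
  have "t \<otimes> t \<in> center G" using subgroup.m_closed[OF center_subgroup tc tc] .
  moreover have "t \<otimes> t \<noteq> t" using tG t(2) by simp
  ultimately have "t \<otimes> t = \<one>" using t(1) by simp
  moreover have "t \<otimes> g = g \<otimes> t" if "g \<in> carrier G" for g
    using tc \<open>g \<in> carrier G\<close> by (simp add: center_def)
  ultimately show ?thesis by (rule that[OF t tG])
qed

lemma centralizer_times_center:
  assumes v: "v \<in> carrier G - center G" and s: "s \<in> center G"
  shows "centralizer G (s \<otimes> v) = centralizer G v" "s \<otimes> v \<in> carrier G - center G"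
proof -
  have "s \<in> carrier G" using s center_subset[of G] by blast
  have "s \<otimes> v \<notin> center G"
  proof
    assume "s \<otimes> v \<in> center G"
    hence "inv s \<otimes> (s \<otimes> v) \<in> center G"
      using s center_subgroup by (simp add: subgroup.m_closed subgroup.m_inv_closed)
    thus False using v \<open>s \<in> carrier G\<close> by (simp add: inv_mult_cancel)
  qed
  moreover have "s \<otimes> v \<in> centralizer G v"
    using noncentral_centralizer(3,4,5)[OF v] s by (auto intro: subgroup.m_closed)
  ultimately show "centralizer G (s \<otimes> v) = centralizer G v" "s \<otimes> v \<in> carrier G - center G"
    using centralizer_cong[OF v] by auto
qed

lemma centralizer_index_two:
  assumes v: "v \<in> carrier G - center G" and c: "card (centralizer G v) = 2 * card (center G)"
    and w: "w \<in> centralizer G v" "w \<notin> center G"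
  obtains s where "s \<in> center G" "w = s \<otimes> v"
proof -
  note C = noncentral_centralizer[OF v]
  let ?vZ = "(\<lambda>s. s \<otimes> v) ` center G"
  have vG: "v \<in> carrier G" using v by simp
  have Zc: "\<And>s. s \<in> center G \<Longrightarrow> s \<in> carrier G" using center_subset[of G] by blast
  have "?vZ \<subseteq> centralizer G v - center G"
    using C centralizer_times_center(2)[OF v] by (auto intro: subgroup.m_closed)
  moreover have "card ?vZ = card (center G)"
    using Zc vG by (intro card_image) (auto simp: inj_on_def)
  moreover have "card (centralizer G v - center G) = card (center G)"
    using c C(5) finite_subset_carrier[OF center_subset] by (simp add: card_Diff_subset)
  moreover have "finite (centralizer G v - center G)"
    using centralizer_subset[of G v] by (intro finite_subset_carrier) blast
  ultimately have "?vZ = centralizer G v - center G" by (intro card_subset_eq) auto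
  thus ?thesis using w that by blast
qed

text \<open>An element with centralizer of order six has a central cube; if this cube is the central involution,
  multiplying the element by the involution makes it trivial.\<close>

lemma element_of_order_3:
  assumes z: "card (center G) = 2" and N: "class_size 6 \<noteq> 0"
  obtains c where "c \<in> centralizer_class 6" "c [^] (3::nat) = \<one>"
proof -
  obtain t where t: "center G = {\<one>, t}" "t \<noteq> \<one>" "t \<in> carrier G" "t \<otimes> t = \<one>"
    "\<And>g. g \<in> carrier G \<Longrightarrow> t \<otimes> g = g \<otimes> t" using center_2[OF z] by blast
  obtain v where v: "v \<in> carrier G - center G" "v \<in> carrier G" "card (centralizer G v) = 6" "v \<in> centralizer_class 6"
    using obtain_in_class[OF N] by blast
  have "v [^] (3::nat) \<in> center G" using pow_index_center[OF v(1), of 3] v(3) z by simp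
  then consider "v [^] (3::nat) = \<one>" | "v [^] (3::nat) = t" using t(1) by blast
  thus ?thesis
  proof cases
    case 1
    thus ?thesis using that v by blast
  next
    case 2
    have "(t \<otimes> v) [^] (3::nat) = t [^] (3::nat) \<otimes> v [^] (3::nat)"
      using t(3,5) v by (intro pow_mult_distrib) auto
    also have "t [^] (3::nat) = t" using t(3,4) by (simp add: numeral_eq_Suc)
    finally have "(t \<otimes> v) [^] (3::nat) = \<one>" using 2 t(4) by simp
    moreover have "t \<otimes> v \<in> centralizer_class 6"
      using centralizer_times_center[OF v(1), of t] t(1) v(3) by (simp add: centralizer_class_def)
    ultimately show ?thesis using that by blast
  qed
qed

text \<open>If the four elements with centralizer of order six formed a single class, then an element
  and its product with the central involution \<open>t\<close> would be conjugate although their cubes, which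
  are central, differ by \<open>t\<close>.\<close>

lemma orders_center_2:
  assumes z: "card (center G) = 2"
  shows "(order G, class_size 4, class_size 6) \<in> {(8, 6, 0), (12, 6, 4), (24, 6, 16)}"
proof -
  have False if ord: "order G = 24" and N: "class_size 6 = 4"
  proof -
    obtain t where t: "center G = {\<one>, t}" "t \<noteq> \<one>" "t \<in> carrier G" "t \<otimes> t = \<one>"
      "\<And>g. g \<in> carrier G \<Longrightarrow> t \<otimes> g = g \<otimes> t" using center_2[OF z] by blast
    obtain c where c: "c \<in> centralizer_class 6" "c [^] (3::nat) = \<one>"
      using element_of_order_3[OF z] N by auto
    have cG: "c \<in> carrier G - center G" "c \<in> carrier G" "card (centralizer G c) = 6"
      using c(1) by (auto simp: centralizer_class_def)
    have "conj_class c = centralizer_class 6"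
    proof (rule card_subset_eq[OF class_size_finite])
      show "conj_class c \<subseteq> centralizer_class 6"
        using centralizer_class_conj[OF c(1)] by (auto simp: conj_class_def)
      show "card (conj_class c) = class_size 6"
        using card_conj_class[OF cG(2)] cG(3) ord N by simp
    qed
    moreover have "t \<otimes> c \<in> centralizer_class 6"
      using centralizer_times_center[OF cG(1), of t] t(1) cG(3) by (simp add: centralizer_class_def)
    ultimately obtain g where g: "g \<in> carrier G" "t \<otimes> c = g \<otimes> c \<otimes> inv g" by (auto simp: conj_class_def)
    have "(t \<otimes> c) [^] (3::nat) = \<one>"
      using conj_pow[OF g(1) cG(2), of 3] c(2) g by simp
    moreover have "(t \<otimes> c) [^] (3::nat) = t [^] (3::nat) \<otimes> c [^] (3::nat)"
      using t(3,5) cG by (intro pow_mult_distrib) auto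
    moreover have "t [^] (3::nat) = t" using t(3,4) by (simp add: numeral_eq_Suc)
    ultimately show False using c(2) t(2,3) by simp
  qed
  thus ?thesis using class_sizes_center_2[OF z] by auto
qed

text \<open>Let \<open>a\<close> be of order three and \<open>b\<close> outside its centralizer. As \<open>b \<otimes> b\<close> is central, conjugation by \<open>b\<close>
  interchanges \<open>a\<close> and \<open>c = b \<otimes> a \<otimes> inv b\<close>. Their product commutes with \<open>b\<close> and is therefore central;
  having trivial cube it is trivial, so \<open>b\<close> inverts \<open>a\<close>. The two groups are distinguished by
  whether \<open>b \<otimes> b\<close> is trivial.\<close>

lemma presentation_order_12:
  assumes z: "card (center G) = 2" and ord: "order G = 12" and N: "class_size 6 = 4"
  shows "(\<exists>a b. satisfies_presentation G (gen2 a b) (metacyclic_relators 6 2 0 [Inv 0])) \<or>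
    (\<exists>a b. satisfies_presentation G (gen2 a b) (metacyclic_relators 3 4 0 [Inv 0]))"
proof -
  obtain t where t: "center G = {\<one>, t}" "t \<noteq> \<one>" "t \<in> carrier G" "t \<otimes> t = \<one>"
    "\<And>g. g \<in> carrier G \<Longrightarrow> t \<otimes> g = g \<otimes> t" using center_2[OF z] by blast
  obtain a where a: "a \<in> centralizer_class 6" "a [^] (3::nat) = \<one>"
    using element_of_order_3[OF z] N by auto
  have aG: "a \<in> carrier G - center G" "a \<in> carrier G" "card (centralizer G a) = 6"
    using a(1) by (auto simp: centralizer_class_def)
  let ?A = "centralizer G a"
  note C = noncentral_centralizer[OF aG(1)]
  have A: "?A - center G = centralizer_class 6"
    using a(1) N z by (intro centralizer_minus_center_eq_class) simp_all
  have "?A \<noteq> carrier G" using aG(3) ord by (auto simp: order_def)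
  then obtain b where b: "b \<in> carrier G" "b \<notin> ?A" using centralizer_subset[of G a] by blast
  have bZ: "b \<in> carrier G - center G" using b center_subset_centralizer[OF aG(2)] by blast
  have b2: "b \<otimes> b \<in> center G"
  proof -
    have "b \<notin> centralizer_class 6" using A b by blast
    hence "card (centralizer G b) \<noteq> 6" using bZ by (simp add: centralizer_class_def)
    moreover have "4 \<le> card (centralizer G b)" "card (centralizer G b) \<le> 6" "2 dvd card (centralizer G b)"
      using noncentral_centralizer(1,6)[OF bZ] card_centralizer_le[OF bZ] z by auto
    ultimately have "card (centralizer G b) = 4" by presburger
    thus ?thesis using pow_index_center[OF bZ, of 2] z b by (simp add: pow_2)
  qed
  define c where "c = b \<otimes> a \<otimes> inv b"
  have cA: "c \<in> ?A" "c \<in> carrier G"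
    using centralizer_class_conj[OF a(1) b(1)] A b aG unfolding c_def by auto
  have ca: "a \<otimes> c = c \<otimes> a" using cA by (simp add: centralizer_def)
  have c3: "c [^] (3::nat) = \<one>"
    using conj_pow[OF b(1) aG(2), of 3] a b by (simp add: c_def)
  have bc: "b \<otimes> c \<otimes> inv b = a"
  proof -
    have "b \<otimes> c \<otimes> inv b = (b \<otimes> b) \<otimes> a \<otimes> inv (b \<otimes> b)"
      using conj_action_mult[OF b(1) b(1) aG(2)] by (simp add: c_def)
    also have "\<dots> = a" using b2 aG b by (subst conj_eq_iff) (auto simp: center_def)
    finally show ?thesis .
  qed
  define d where "d = c \<otimes> a"
  have dG: "d \<in> carrier G" "d \<in> ?A" using cA aG C by (auto simp: d_def intro: subgroup.m_closed)
  have "b \<otimes> d \<otimes> inv b = d"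
    using conj_mult[OF b(1) cA(2) aG(2)] bc ca by (simp add: d_def c_def[symmetric])
  hence bd: "b \<in> centralizer G d" using conj_eq_iff[OF b(1) dG(1) dG(1)] b by (simp add: centralizer_def)
  have "d \<in> center G"
    using centralizer_cong(1)[OF aG(1) dG(2)] bd b(2) by blast
  moreover have d3: "d [^] (3::nat) = \<one>"
    using pow_mult_distrib[of c a 3] ca cA aG c3 a(2) by (simp add: d_def)
  moreover have "t [^] (3::nat) = t" using t(3,4) by (simp add: numeral_eq_Suc)
  ultimately have "d = \<one>" using t(1,2) by auto
  hence "c = inv a" using cA aG by (simp add: d_def inv_equality)
  hence ba: "b \<otimes> a \<otimes> inv b = inv a" by (simp add: c_def)
  have gen: "generate G S = carrier G" if S: "S \<subseteq> carrier G" "t \<in> generate G S" "a \<in> generate G S" "b \<in> generate G S" for S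
  proof -
    let ?K = "generate G S"
    have K: "subgroup ?K G" using S(1) by (rule generate_is_subgroup)
    have ZK: "center G \<subseteq> ?K" using t(1) S(2) generate.one[of G] by simp
    have "?A \<subseteq> ?K"
      using aG z S(3) ZK K by (intro centralizer_subset_of_prime_index[of a ?K 3]) simp_all
    hence "2 * card ?A \<le> card ?K" using b S(4) by (intro proper_subgroup_card[OF C(4) K]) auto
    thus ?thesis using ord aG(3) by (intro subgroup_eq_carrier[OF K]) simp
  qed
  from b2 t(1) consider "b \<otimes> b = \<one>" | "b \<otimes> b = t" by blast
  thus ?thesis
  proof cases
    case 1
    let ?a = "t \<otimes> a"
    have ta: "t \<otimes> a = a \<otimes> t" using t(5) aG by simp
    have a3: "?a [^] (3::nat) = t"
      using pow_mult_distrib[OF ta t(3) aG(2), of 3] t(3) a(2) \<open>t [^] (3::nat) = t\<close> by simp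
    have "?a [^] (6::nat) = ?a [^] (3::nat) \<otimes> ?a [^] (3::nat)"
      using t(3) aG(2) by (simp add: nat_pow_mult)
    hence a6: "?a [^] (6::nat) = \<one>" using a3 t(4) by simp
    have it: "inv t = t" using t(3,4) by (metis inv_equality)
    have "b \<otimes> ?a \<otimes> inv b = (b \<otimes> t \<otimes> inv b) \<otimes> inv a"
      using conj_mult[OF b(1) t(3) aG(2)] ba by simp
    also have "b \<otimes> t \<otimes> inv b = t" using conj_eq_iff[OF b(1) t(3) t(3)] t(5)[OF b(1)] by simp
    also have "t \<otimes> inv a = inv ?a" using it t(3,5) aG by (simp add: inv_mult_group)
    finally have "b \<otimes> ?a \<otimes> inv b = inv ?a" .
    moreover have "generate G {?a, b} = carrier G"
    proof (rule gen)
      have ag: "?a \<in> generate G {?a, b}" by (rule generate.incl) simp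
      show s: "{?a, b} \<subseteq> carrier G" using t(3) aG b by simp
      show tg: "t \<in> generate G {?a, b}" using pow_mem_generate[OF s ag, of 3] a3 by simp
      show "a \<in> generate G {?a, b}"
        using generate.eng[OF tg ag] t(3,4) aG by (simp flip: m_assoc)
      show "b \<in> generate G {?a, b}" by (rule generate.incl) simp
    qed
    ultimately have "satisfies_presentation G (gen2 ?a b) (metacyclic_relators 6 2 0 [Inv 0])"
      using t(3) aG b a6 1 by (intro satisfies_metacyclic) (simp_all add: pow_2)
    thus ?thesis by blast
  next
    case 2
    have "b [^] (4::nat) = (b \<otimes> b) \<otimes> (b \<otimes> b)" using b by (simp add: numeral_eq_Suc m_assoc)
    hence b4: "b [^] (4::nat) = \<one>" using 2 t(4) by simp
    have "generate G {a, b} = carrier G"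
    proof (rule gen)
      have bg: "b \<in> generate G {a, b}" by (rule generate.incl) simp
      thus "t \<in> generate G {a, b}" "b \<in> generate G {a, b}" using generate.eng[OF bg bg] 2 by simp_all
      show "a \<in> generate G {a, b}" by (rule generate.incl) simp
    qed (use aG b in simp)
    hence "satisfies_presentation G (gen2 a b) (metacyclic_relators 3 4 0 [Inv 0])"
      using aG b b4 a ba by (intro satisfies_metacyclic) simp_all
    thus ?thesis by blast
  qed
qed

end

section \<open>Centers of order three and four\<close>

context finite_group
begin

definition commutator :: "'a \<Rightarrow> 'a \<Rightarrow> 'a" where
  "commutator x y = x \<otimes> y \<otimes> inv (y \<otimes> x)"

lemma commutator_closed [simp]: "x \<in> carrier G \<Longrightarrow> y \<in> carrier G \<Longrightarrow> commutator x y \<in> carrier G"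
  by (simp add: commutator_def)

lemma mult_commutator: "x \<in> carrier G \<Longrightarrow> y \<in> carrier G \<Longrightarrow> x \<otimes> y = commutator x y \<otimes> (y \<otimes> x)"
  by (simp add: commutator_def m_assoc)

lemma commutator_eqI:
  assumes "x \<in> carrier G" "y \<in> carrier G" "k \<in> carrier G" "x \<otimes> y = k \<otimes> (y \<otimes> x)"
  shows "commutator x y = k"
  using assms by (simp add: commutator_def m_assoc)

lemma commutator_eq_one: "x \<in> carrier G \<Longrightarrow> y \<in> carrier G \<Longrightarrow> commutator x y = \<one> \<longleftrightarrow> x \<otimes> y = y \<otimes> x"
  using mult_commutator[of x y] commutator_eqI[of x y \<one>] by auto

lemma conj_commutator: "x \<in> carrier G \<Longrightarrow> y \<in> carrier G \<Longrightarrow> x \<otimes> y \<otimes> inv x = commutator x y \<otimes> y"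
  by (simp add: commutator_def word_simps)

lemma centerD: "z \<in> center G \<Longrightarrow> z \<in> carrier G" "z \<in> center G \<Longrightarrow> g \<in> carrier G \<Longrightarrow> z \<otimes> g = g \<otimes> z"
  by (simp_all add: center_def)

lemma center_left_commute:
  assumes "z \<in> center G" "x \<in> carrier G" "y \<in> carrier G"
  shows "x \<otimes> (z \<otimes> y) = z \<otimes> (x \<otimes> y)"
  using assms centerD by (metis m_assoc)

lemma center_closed: "z \<in> center G \<Longrightarrow> w \<in> center G \<Longrightarrow> z \<otimes> w \<in> center G"
  "z \<in> center G \<Longrightarrow> inv z \<in> center G" "\<one> \<in> center G"
  using center_subgroup by (simp_all add: subgroup.m_closed subgroup.m_inv_closed subgroup.one_closed)

lemma center_square_mult:
  assumes "z \<in> center G" "x \<in> carrier G"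
  shows "(z \<otimes> x) \<otimes> (z \<otimes> x) = (z \<otimes> z) \<otimes> (x \<otimes> x)"
proof -
  have "(z \<otimes> x) \<otimes> (z \<otimes> x) = z \<otimes> (x \<otimes> (z \<otimes> x))" using assms centerD(1) by (simp add: m_assoc)
  also have "x \<otimes> (z \<otimes> x) = z \<otimes> (x \<otimes> x)" using assms by (intro center_left_commute)
  finally show ?thesis using assms centerD(1) by (simp add: m_assoc)
qed

lemma commutator_center_mult:
  assumes "z \<in> center G" "x \<in> carrier G" "y \<in> carrier G"
  shows "commutator (z \<otimes> x) y = commutator x y" and "commutator x (z \<otimes> y) = commutator x y"
proof -
  have z: "z \<in> carrier G" using assms centerD by blast
  have "z \<otimes> x \<otimes> y = z \<otimes> (commutator x y \<otimes> (y \<otimes> x))"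
    using assms z mult_commutator[of x y] by (simp add: m_assoc)
  also have "\<dots> = commutator x y \<otimes> (z \<otimes> (y \<otimes> x))"
    using assms center_left_commute[of z "commutator x y" "y \<otimes> x"] by simp
  also have "z \<otimes> (y \<otimes> x) = y \<otimes> (z \<otimes> x)"
    using assms center_left_commute[of z y x] by simp
  finally show "commutator (z \<otimes> x) y = commutator x y" using assms z by (intro commutator_eqI) simp_all
  have "x \<otimes> (z \<otimes> y) = z \<otimes> (commutator x y \<otimes> (y \<otimes> x))"
    using assms z mult_commutator[of x y] center_left_commute[of z x y] by simp
  also have "\<dots> = commutator x y \<otimes> (z \<otimes> (y \<otimes> x))"
    using assms center_left_commute[of z "commutator x y" "y \<otimes> x"] by simp
  also have "z \<otimes> (y \<otimes> x) = (z \<otimes> y) \<otimes> x" using assms z by (simp add: m_assoc)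
  finally show "commutator x (z \<otimes> y) = commutator x y" using assms z by (intro commutator_eqI) simp_all
qed

end

text \<open>Central squares make the commutator a central, bilinear and alternating map into the
  elements of order two.\<close>

locale central_squares = finite_group +
  assumes square_center: "x \<in> carrier G \<Longrightarrow> x \<otimes> x \<in> center G"
begin

text \<open>A commutator is a product of squares and inverses of squares.\<close>

lemma commutator_center:
  assumes x: "x \<in> carrier G" and y: "y \<in> carrier G" shows "commutator x y \<in> center G"
proof -
  have i: "inv (x \<otimes> x) \<in> center G" using x square_center center_closed by blast
  have "commutator x y = (x \<otimes> y) \<otimes> (x \<otimes> y) \<otimes> (inv y \<otimes> (inv (x \<otimes> x) \<otimes> inv y))"
    using x y by (simp add: commutator_def word_simps)
  also have "inv y \<otimes> (inv (x \<otimes> x) \<otimes> inv y) = inv (x \<otimes> x) \<otimes> (inv y \<otimes> inv y)"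
    using i y by (intro center_left_commute) simp_all
  also have "inv y \<otimes> inv y = inv (y \<otimes> y)" using y by (simp add: inv_mult_group)
  finally show ?thesis using x y square_center center_closed i by simp
qed

lemma commutator_mult_left:
  assumes "x \<in> carrier G" "x' \<in> carrier G" "y \<in> carrier G"
  shows "commutator (x \<otimes> x') y = commutator x y \<otimes> commutator x' y"
proof (rule commutator_eqI)
  let ?k = "commutator x y" and ?l = "commutator x' y"
  have k: "?k \<in> center G" "?l \<in> center G" "?k \<in> carrier G" "?l \<in> carrier G"
    using assms commutator_center by simp_all
  have "x \<otimes> x' \<otimes> y = x \<otimes> (?l \<otimes> (y \<otimes> x'))"
    using assms mult_commutator[of x' y] by (simp add: m_assoc)
  also have "\<dots> = ?l \<otimes> (x \<otimes> (y \<otimes> x'))" using assms k by (intro center_left_commute) simp_all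
  also have "x \<otimes> (y \<otimes> x') = ?k \<otimes> (y \<otimes> x) \<otimes> x'"
    using assms mult_commutator[of x y] by (simp flip: m_assoc)
  also have "?l \<otimes> (?k \<otimes> (y \<otimes> x) \<otimes> x') = ?k \<otimes> (?l \<otimes> (y \<otimes> (x \<otimes> x')))"
    using assms k center_left_commute[of ?k ?l "y \<otimes> (x \<otimes> x')"] by (simp add: m_assoc)
  finally show "x \<otimes> x' \<otimes> y = ?k \<otimes> ?l \<otimes> (y \<otimes> (x \<otimes> x'))" using assms k by (simp add: m_assoc)
qed (use assms in simp_all)

lemma commutator_square:
  assumes "x \<in> carrier G" "y \<in> carrier G"
  shows "commutator x y \<otimes> commutator x y = \<one>"
proof -
  have "commutator (x \<otimes> x) y = \<one>"
    using assms square_center centerD by (simp add: commutator_eq_one)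
  thus ?thesis using commutator_mult_left[of x x y] assms by simp
qed

lemma commutator_sym:
  assumes "x \<in> carrier G" "y \<in> carrier G"
  shows "commutator y x = commutator x y"
proof -
  have "commutator y x = inv (commutator x y)" using assms by (simp add: commutator_def word_simps)
  thus ?thesis using commutator_square[OF assms] assms by (metis commutator_closed inv_equality)
qed

lemma commutator_self: "x \<in> carrier G \<Longrightarrow> commutator x x = \<one>"
  by (simp add: commutator_eq_one)

lemma commutator_mult_right:
  assumes "x \<in> carrier G" "y \<in> carrier G" "y' \<in> carrier G"
  shows "commutator x (y \<otimes> y') = commutator x y \<otimes> commutator x y'"
  using assms commutator_mult_left[of y y' x] commutator_sym by simp

lemma square_mult:
  assumes "x \<in> carrier G" "y \<in> carrier G"
  shows "(x \<otimes> y) \<otimes> (x \<otimes> y) = commutator x y \<otimes> ((x \<otimes> x) \<otimes> (y \<otimes> y))"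
proof -
  let ?k = "commutator x y"
  have k: "?k \<in> center G" "?k \<in> carrier G" using assms commutator_center by simp_all
  have "(x \<otimes> y) \<otimes> (x \<otimes> y) = x \<otimes> ((y \<otimes> x) \<otimes> y)" using assms by (simp add: m_assoc)
  also have "y \<otimes> x = ?k \<otimes> (x \<otimes> y)" using assms mult_commutator[of y x] commutator_sym by simp
  also have "x \<otimes> (?k \<otimes> (x \<otimes> y) \<otimes> y) = ?k \<otimes> (x \<otimes> ((x \<otimes> y) \<otimes> y))"
    using assms k center_left_commute[of ?k x "x \<otimes> y \<otimes> y"] by (simp add: m_assoc)
  finally show ?thesis using assms by (simp add: m_assoc)
qed

end

context small_centralizer_group
begin

lemma central_squares_of_index:
  assumes "\<And>v. v \<in> carrier G - center G \<Longrightarrow> card (centralizer G v) = 2 * card (center G)"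
  shows "central_squares G"
proof
  fix x assume x: "x \<in> carrier G"
  show "x \<otimes> x \<in> center G"
  proof (cases "x \<in> center G")
    case False
    thus ?thesis using pow_index_center[of x 2] assms[of x] x by (simp add: pow_2)
  qed (simp add: center_closed)
qed

text \<open>With a center of order three commutators are central of order dividing both two and three.\<close>

lemma card_center_ne_3: "card (center G) \<noteq> 3"
proof
  assume z: "card (center G) = 3"
  have c: "card (centralizer G v) = 2 * card (center G)" if v: "v \<in> carrier G - center G" for v
  proof -
    have "6 \<le> card (centralizer G v)" "card (centralizer G v) \<le> 7" "3 dvd card (centralizer G v)"
      using noncentral_centralizer(1,6)[OF v] card_centralizer_le[OF v] z by auto
    thus ?thesis using z by presburger
  qed
  interpret central_squares G using c by (rule central_squares_of_index)
  have "x \<otimes> y = y \<otimes> x" if xy: "x \<in> carrier G" "y \<in> carrier G" for x y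
  proof -
    let ?k = "commutator x y"
    have "?k [^] (3::nat) = \<one>"
      using pow_card_subgroup[OF center_subgroup commutator_center[OF xy]] z by simp
    moreover have "?k [^] (3::nat) = ?k \<otimes> ?k \<otimes> ?k" using xy by (simp add: numeral_eq_Suc)
    ultimately have "?k = \<one>" using commutator_square[OF xy] xy by simp
    thus ?thesis using commutator_eq_one xy by simp
  qed
  thus False using noncommutative group_comm_groupI by blast
qed

text \<open>In order 32 the commutator with a fixed \<open>a\<close> takes all four central values. If \<open>b\<close> and \<open>c\<close>
  realize distinct values \<open>s\<close> and \<open>t\<close>, then one of the pairs \<open>(b, c)\<close>, \<open>(b, ac)\<close>, \<open>(ab, c)\<close>,
  \<open>(ab, ac)\<close> commutes, by bilinearity. But noncentral commuting elements differ by a central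
  factor and so have the same commutator with \<open>a\<close>.\<close>

lemma orders_center_4:
  assumes z: "card (center G) = 4"
  shows "order G = 16" and "central_squares G"
proof -
  have c8: "card (centralizer G v) = 2 * card (center G)" if v: "v \<in> carrier G - center G" for v
  proof -
    have "8 \<le> card (centralizer G v)" "card (centralizer G v) \<le> 8"
      using noncentral_centralizer(1)[OF v] card_centralizer_le[OF v] z by auto
    thus ?thesis using z by simp
  qed
  show cs: "central_squares G" using c8 by (rule central_squares_of_index)
  interpret central_squares G by (rule cs)
  have False if ord: "order G = 32"
  proof -
    obtain a where a: "a \<in> carrier G - center G" "a \<in> carrier G" using exists_noncentral by blast
    let ?aZ = "(\<lambda>s. s \<otimes> a) ` center G"
    have "conj_class a \<subseteq> ?aZ"
      using a commutator_center conj_commutator by (auto simp: conj_class_def)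
    moreover have "card ?aZ = card (center G)"
      using a centerD(1) by (intro card_image) (auto simp: inj_on_def)
    moreover have "card (conj_class a) = 4"
      using card_conj_class[OF a(2)] c8[OF a(1)] ord z by simp
    moreover have "finite ?aZ" using finite_subset_carrier[OF center_subset] by simp
    ultimately have class_a: "conj_class a = ?aZ" using z by (intro card_subset_eq) simp_all
    have onto: "\<exists>g \<in> carrier G. commutator g a = s" if s: "s \<in> center G" for s
    proof -
      have "s \<otimes> a \<in> conj_class a" using s class_a by blast
      then obtain g where g: "g \<in> carrier G" "s \<otimes> a = g \<otimes> a \<otimes> inv g" by (auto simp: conj_class_def)
      thus ?thesis using conj_commutator[OF g(1) a(2)] a centerD(1)[OF s] by auto
    qed
    have "card (center G - {\<one>}) = 3" using z center_closed(3) by simp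
    then obtain s where s: "s \<in> center G" "s \<noteq> \<one>" by (metis Diff_iff card.empty ex_in_conv insertCI zero_neq_numeral)
    have "card (center G - {\<one>, s}) = 2" using z center_closed(3) s by (simp add: card_Diff_subset)
    then obtain t where t: "t \<in> center G" "t \<noteq> \<one>" "t \<noteq> s"
      by (metis Diff_iff card.empty ex_in_conv insertCI zero_neq_numeral)
    obtain b where b: "b \<in> carrier G" "commutator b a = s" using onto s by blast
    obtain c where c: "c \<in> carrier G" "commutator c a = t" using onto t by blast
    have ss: "s \<otimes> s = \<one>" "t \<otimes> t = \<one>" using commutator_square b c a by auto
    have sc: "s \<in> carrier G" "t \<in> carrier G" using s t centerD by auto
    have st: "s \<otimes> t \<noteq> \<one>" "s \<otimes> t \<noteq> s" "s \<otimes> t \<noteq> t"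
      using s t sc ss by (auto simp: inv_equality) (metis inv_equality inv_unique)
    have "{\<one>, s, t, s \<otimes> t} = center G"
    proof (rule card_subset_eq)
      show "finite (center G)" using finite_subset_carrier[OF center_subset] .
      show "{\<one>, s, t, s \<otimes> t} \<subseteq> center G" using s t center_closed by simp
      show "card {\<one>, s, t, s \<otimes> t} = card (center G)" using z s t st by (simp add: eq_commute)
    qed
    hence u: "commutator b c \<in> {\<one>, s, t, s \<otimes> t}" using commutator_center b c by simp
    have key: False
      if pq: "p \<in> carrier G" "q \<in> carrier G" "commutator p a = s" "commutator q a = t" "commutator p q = \<one>" for p q
    proof -
      have noncentral: "g \<in> carrier G - center G" if "g \<in> carrier G" "commutator g a \<noteq> \<one>" for g
        using that a centerD(2)[of g a] by (auto simp: commutator_eq_one)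
      have p: "p \<in> carrier G - center G" "q \<in> carrier G - center G" using pq noncentral s t by auto
      have "p \<in> centralizer G q" using pq by (simp add: centralizer_def commutator_eq_one)
      then obtain w where "w \<in> center G" "p = w \<otimes> q"
        using centralizer_index_two[OF p(2) c8[OF p(2)], of p] p by blast
      thus False using commutator_center_mult(1)[of w q a] pq a t by simp
    qed
    have ab: "commutator (a \<otimes> b) a = s" "commutator (a \<otimes> c) a = t"
      using a b c sc by (simp_all add: commutator_mult_left commutator_self)
    have bac: "commutator b (a \<otimes> c) = s \<otimes> commutator b c"
      using a b c by (simp add: commutator_mult_right)
    have abc: "commutator (a \<otimes> b) c = t \<otimes> commutator b c"
      using a b c commutator_sym[of c a] by (simp add: commutator_mult_left)
    have abac: "commutator (a \<otimes> b) (a \<otimes> c) = s \<otimes> (t \<otimes> commutator b c)"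
      using a b c ab abc by (simp add: commutator_mult_right[of "a \<otimes> b"])
    have "s \<otimes> (t \<otimes> (s \<otimes> t)) = \<one>"
    proof -
      have "t \<otimes> (s \<otimes> t) = s \<otimes> (t \<otimes> t)" using s sc by (intro center_left_commute)
      thus ?thesis using ss sc by simp
    qed
    from u consider "commutator b c = \<one>" | "commutator b c = s" | "commutator b c = t" | "commutator b c = s \<otimes> t" by blast
    thus False
    proof cases
      case 1 thus ?thesis using key[of b c] b c by simp
    next
      case 2 thus ?thesis using key[of b "a \<otimes> c"] a b c ab bac ss by simp
    next
      case 3 thus ?thesis using key[of "a \<otimes> b" c] a b c ab abc ss by simp
    next
      case 4 thus ?thesis using key[of "a \<otimes> b" "a \<otimes> c"] a b c ab abac \<open>s \<otimes> (t \<otimes> (s \<otimes> t)) = \<one>\<close> by simp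
    qed
  qed
  thus "order G = 16" using order_candidates_center_4[OF z] by blast
qed

end

context finite_group
begin

lemma generate_eq_carrier:
  assumes S: "S \<subseteq> carrier G" and Z: "center G \<subseteq> generate G S"
    and ab: "a \<in> generate G S" "b \<in> generate G S" "a \<otimes> b \<noteq> b \<otimes> a" and ord: "order G \<le> 4 * card (center G)"
  shows "generate G S = carrier G"
proof -
  have K: "subgroup (generate G S) G" using S by (rule generate_is_subgroup)
  have "a \<in> carrier G" "b \<in> carrier G" using ab(1,2) subgroup.subset[OF K] by auto
  hence "4 * card (center G) \<le> card (generate G S)"
    using four_cosets(3)[OF K Z ab] center_subset_centralizer[of a G] center_subset_centralizer[of b G] by simp
  thus ?thesis using ord by (intro subgroup_eq_carrier[OF K]) simp
qed

end

section \<open>Groups of order eight and sixteen\<close>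

context central_squares
begin

text \<open>Any two of the elements \<open>x\<close>, \<open>y\<close> and \<open>x \<otimes> y\<close> have commutator \<open>t\<close>, and the product of the three
  squares is \<open>t\<close> as well. So if two of the squares lie outside \<open>{\<one>, t}\<close>, the third lies inside,
  and two of the three elements can be chosen whose squares have one of four normal forms.\<close>

lemma square_types:
  assumes xy: "x \<in> carrier G" "y \<in> carrier G" and t: "t = commutator x y"
    and elem: "\<And>v. v \<in> center G \<Longrightarrow> v \<otimes> v = \<one>"
    and two: "\<And>v w. v \<in> center G - {\<one>, t} \<Longrightarrow> w \<in> center G - {\<one>, t} \<Longrightarrow> w = v \<or> w = t \<otimes> v"
  obtains a b where "a \<in> carrier G" "b \<in> carrier G" "commutator a b = t"
    "a \<otimes> a = t \<and> b \<otimes> b = \<one> \<or> a \<otimes> a = t \<and> b \<otimes> b = t \<or> a \<otimes> a \<notin> {\<one>, t} \<and> b \<otimes> b = \<one> \<or>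
     a \<otimes> a = t \<and> b \<otimes> b \<notin> {\<one>, t}"
proof -
  let ?P = "\<lambda>a b. a \<in> carrier G \<and> b \<in> carrier G \<and> commutator a b = t \<and>
    (a \<otimes> a = t \<and> b \<otimes> b = \<one> \<or> a \<otimes> a = t \<and> b \<otimes> b = t \<or> a \<otimes> a \<notin> {\<one>, t} \<and> b \<otimes> b = \<one> \<or>
     a \<otimes> a = t \<and> b \<otimes> b \<notin> {\<one>, t})"
  let ?w = "x \<otimes> y"
  have tZ: "t \<in> center G" "t \<in> carrier G" "t \<otimes> t = \<one>"
    using t xy commutator_center commutator_square by auto
  have k: "commutator x y = t" "commutator y x = t" "commutator x ?w = t" "commutator ?w x = t"
    using xy t tZ commutator_sym[of y x] by (simp_all add: commutator_mult_left commutator_mult_right commutator_self)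
  have w2: "?w \<otimes> ?w = t \<otimes> ((x \<otimes> x) \<otimes> (y \<otimes> y))" using square_mult xy t by simp
  have c: "?w \<in> carrier G" using xy by simp
  have sq: "x \<otimes> x \<in> center G" "y \<otimes> y \<in> center G" using xy square_center by auto
  have "\<exists>a b. ?P a b"
  proof (cases "x \<otimes> x \<in> {\<one>, t}")
    case True
    then consider "x \<otimes> x = \<one>" | "x \<otimes> x = t" by blast
    thus ?thesis
    proof cases
      case 1
      have "y \<otimes> y = \<one> \<Longrightarrow> ?P ?w x" using 1 w2 xy c k tZ by simp
      moreover have "y \<otimes> y \<noteq> \<one> \<Longrightarrow> ?P y x" using 1 xy k by auto
      ultimately show ?thesis by blast
    next
      case 2
      hence "?P x y" using xy k by auto
      thus ?thesis by blast
    qed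
  next
    case X: False
    show ?thesis
    proof (cases "y \<otimes> y \<in> {\<one>, t}")
      case True
      hence "?P x y \<or> ?P y x" using X xy k by auto
      thus ?thesis by blast
    next
      case Y: False
      have "y \<otimes> y = x \<otimes> x \<or> y \<otimes> y = t \<otimes> (x \<otimes> x)" using two[of "x \<otimes> x" "y \<otimes> y"] sq X Y by blast
      thus ?thesis
      proof
        assume "y \<otimes> y = x \<otimes> x"
        hence "?w \<otimes> ?w = t" using w2 elem[OF sq(1)] tZ by simp
        hence "?P ?w x" using X xy c k by simp
        thus ?thesis by blast
      next
        assume "y \<otimes> y = t \<otimes> (x \<otimes> x)"
        hence "?w \<otimes> ?w = t \<otimes> (t \<otimes> ((x \<otimes> x) \<otimes> (x \<otimes> x)))"
          using w2 center_left_commute[OF tZ(1), of "x \<otimes> x" "x \<otimes> x"] xy by simp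
        hence "?w \<otimes> ?w = \<one>" using elem[OF sq(1)] tZ by simp
        hence "?P x ?w" using X xy c k by simp
        thus ?thesis by blast
      qed
    qed
  qed
  thus ?thesis using that by blast
qed

lemma conj_by_commutator:
  assumes "a \<in> carrier G" "b \<in> carrier G" "commutator a b = t"
  shows "b \<otimes> a \<otimes> inv b = t \<otimes> a" and "t \<in> center G" and "t \<otimes> t = \<one>" and "t \<in> carrier G"
  using assms conj_commutator[of b a] commutator_sym[of a b] commutator_center[of a b]
    commutator_square[of a b] by auto

lemma pow_4: "x \<in> carrier G \<Longrightarrow> x [^] (4::nat) = (x \<otimes> x) \<otimes> (x \<otimes> x)"
  by (simp add: numeral_eq_Suc m_assoc)

lemma conj_by_commutator_inv:
  assumes "a \<in> carrier G" "b \<in> carrier G" "commutator a b = t" "a \<otimes> a = t"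
  shows "b \<otimes> a \<otimes> inv b = inv a" and "a [^] (4::nat) = \<one>"
proof -
  note t = conj_by_commutator[OF assms(1-3)]
  have "t \<otimes> a \<otimes> a = \<one>" using t assms by (simp add: m_assoc)
  hence "t \<otimes> a = inv a" using t assms by (intro inv_equality[symmetric]) simp_all
  thus "b \<otimes> a \<otimes> inv b = inv a" using t(1) by simp
  show "a [^] (4::nat) = \<one>" using pow_4 assms t by simp
qed

end

context small_centralizer_group
begin

lemma exists_noncommuting: "\<exists>x \<in> carrier G. \<exists>y \<in> carrier G. x \<otimes> y \<noteq> y \<otimes> x"
  using noncommutative group_comm_groupI by blast

lemma presentation_order_8:
  assumes z: "card (center G) = 2" and ord: "order G = 8" and N: "class_size 6 = 0"
  shows "(\<exists>a b. satisfies_presentation G (gen2 a b) (metacyclic_relators 4 2 0 [Inv 0])) \<or>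
    (\<exists>a b. satisfies_presentation G (gen2 a b) (metacyclic_relators 4 2 2 [Inv 0]))"
proof -
  have c: "card (centralizer G v) = 2 * card (center G)" if v: "v \<in> carrier G - center G" for v
  proof -
    have "class_size (card (centralizer G v)) \<noteq> 0"
      using mem_centralizer_class[OF v] class_size_finite by auto
    hence "card (centralizer G v) \<noteq> 6" using N by auto
    moreover have "4 \<le> card (centralizer G v)" "card (centralizer G v) \<le> 6" "2 dvd card (centralizer G v)"
      using noncentral_centralizer(1,6)[OF v] card_centralizer_le[OF v] z by auto
    ultimately show ?thesis using z by presburger
  qed
  interpret central_squares G using c by (rule central_squares_of_index)
  obtain x y where xy: "x \<in> carrier G" "y \<in> carrier G" "x \<otimes> y \<noteq> y \<otimes> x" using exists_noncommuting by blast
  define t where "t = commutator x y"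
  have t1: "t \<noteq> \<one>" using xy commutator_eq_one by (simp add: t_def)
  have tZ: "t \<in> center G" using xy commutator_center by (simp add: t_def)
  obtain t' where t': "center G = {\<one>, t'}" using center_2[OF z] by metis
  have Z: "center G = {\<one>, t}" using t' tZ t1 by auto
  have tt: "t \<otimes> t = \<one>" using xy commutator_square by (simp add: t_def)
  have elem: "v \<otimes> v = \<one>" if "v \<in> center G" for v using that Z tt by auto
  have two: "w = v \<or> w = t \<otimes> v" if "v \<in> center G - {\<one>, t}" "w \<in> center G - {\<one>, t}" for v w
    using that Z by auto
  obtain a b where ab: "a \<in> carrier G" "b \<in> carrier G" "commutator a b = t"
    "a \<otimes> a = t \<and> b \<otimes> b = \<one> \<or> a \<otimes> a = t \<and> b \<otimes> b = t \<or> a \<otimes> a \<notin> {\<one>, t} \<and> b \<otimes> b = \<one> \<or>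
     a \<otimes> a = t \<and> b \<otimes> b \<notin> {\<one>, t}"
    using square_types[OF xy(1,2) t_def elem two] by blast
  have sq: "a \<otimes> a = t" "b \<otimes> b = \<one> \<or> b \<otimes> b = t"
    using ab(4) square_center[OF ab(1)] square_center[OF ab(2)] Z by auto
  note r = conj_by_commutator_inv[OF ab(1-3) sq(1)]
  have gen: "generate G {a, b} = carrier G"
  proof (rule generate_eq_carrier)
    have a: "a \<in> generate G {a, b}" by (rule generate.incl) simp
    thus "a \<in> generate G {a, b}" .
    show "b \<in> generate G {a, b}" by (rule generate.incl) simp
    show "center G \<subseteq> generate G {a, b}" unfolding Z using generate.eng[OF a a] generate.one[of G] sq by simp
    show "a \<otimes> b \<noteq> b \<otimes> a" using ab t1 commutator_eq_one by metis
  qed (use ab ord z in simp_all)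
  from sq(2) show ?thesis
  proof
    assume "b \<otimes> b = \<one>"
    hence "satisfies_presentation G (gen2 a b) (metacyclic_relators 4 2 0 [Inv 0])"
      using ab r gen by (intro satisfies_metacyclic) (simp_all add: pow_2)
    thus ?thesis by blast
  next
    assume "b \<otimes> b = t"
    hence "satisfies_presentation G (gen2 a b) (metacyclic_relators 4 2 2 [Inv 0])"
      using ab r gen sq by (intro satisfies_metacyclic) (simp_all add: pow_2)
    thus ?thesis by blast
  qed
qed

lemma center_4:
  assumes z: "card (center G) = 4" and t: "t \<in> center G" "t \<noteq> \<one>" "t \<otimes> t = \<one>" and u: "u \<in> center G" "u \<notin> {\<one>, t}"
  shows "center G = {\<one>, t, u, t \<otimes> u}"
proof -
  have c: "t \<in> carrier G" "u \<in> carrier G" using t u centerD by auto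
  have "t \<otimes> u \<noteq> \<one>" using t u c by (metis inv_equality inv_inv insertCI)
  moreover have "t \<otimes> u \<noteq> t" "t \<otimes> u \<noteq> u" using t u c by auto
  ultimately have "card {\<one>, t, u, t \<otimes> u} = 4" using t u by (auto simp: eq_commute)
  hence "{\<one>, t, u, t \<otimes> u} = center G"
    using z t u center_closed finite_subset_carrier[OF center_subset] by (intro card_subset_eq) auto
  thus ?thesis by simp
qed

text \<open>For an elementary abelian center the four cases are those of the choice of squares above. If the
  center is cyclic, a factor from the center changes a square within \<open>{\<one>, t}\<close> at will; then
  either all squares can be brought into \<open>{\<one>, t}\<close>, or a generator of the center is a square.\<close>

lemma presentation_order_16:
  assumes z: "card (center G) = 4"
  shows "(\<exists>a b c. satisfies_presentation G (gen3 a b c) (extension_relators 0 2 0 [Gen 0] [Gen 1])) \<or>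
    (\<exists>a b c. satisfies_presentation G (gen3 a b c) (extension_relators 2 2 0 [Gen 0] [Gen 1])) \<or>
    (\<exists>a b c. satisfies_presentation G (gen3 a b c) (extension_relators 0 2 2 [Gen 0] [Gen 1])) \<or>
    (\<exists>a b c. satisfies_presentation G (gen3 a b c) central_commutator_relators) \<or>
    (\<exists>a b. satisfies_presentation G (gen2 a b) (metacyclic_relators 4 4 0 [Inv 0])) \<or>
    (\<exists>a b. satisfies_presentation G (gen2 a b) (metacyclic_relators 8 2 0 (replicate 5 (Gen 0))))"
proof -
  have ord: "order G = 16" using orders_center_4(1)[OF z] .
  interpret central_squares G by (rule orders_center_4(2)[OF z])
  obtain x y where xy: "x \<in> carrier G" "y \<in> carrier G" "x \<otimes> y \<noteq> y \<otimes> x" using exists_noncommuting by blast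
  define t where "t = commutator x y"
  have t: "t \<in> center G" "t \<noteq> \<one>" "t \<otimes> t = \<one>" "t \<in> carrier G"
    using xy commutator_eq_one commutator_center commutator_square by (simp_all add: t_def)
  have Z: "center G = {\<one>, t, u, t \<otimes> u}" if "u \<in> center G" "u \<notin> {\<one>, t}" for u
    using center_4[OF z t(1-3) that] .
  have gen: "generate G S = carrier G"
    if "S \<subseteq> carrier G" "a \<in> generate G S" "b \<in> generate G S" "commutator a b = t"
      "t \<in> generate G S" "u \<in> generate G S" "u \<in> center G" "u \<notin> {\<one>, t}" for S a b u
  proof (rule generate_eq_carrier)
    show "center G \<subseteq> generate G S"
      unfolding Z[OF that(7,8)] using that generate.one[of G S] generate.eng[OF that(5,6)] by simp
    have "a \<in> carrier G" "b \<in> carrier G" using that generate_in_carrier by auto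
    thus "a \<otimes> b \<noteq> b \<otimes> a" using that(4) t(2) commutator_eq_one[of a b] by auto
  qed (use that ord z in simp_all)
  have "card (center G - {\<one>, t}) = 2" using z center_closed(3) t by (simp add: card_Diff_subset)
  then obtain u where u: "u \<in> center G" "u \<notin> {\<one>, t}"
    by (metis Diff_iff card.empty ex_in_conv zero_neq_numeral)
  have uG: "u \<in> carrier G" using u centerD by blast
  have uconj: "u \<otimes> g \<otimes> inv u = g" if "g \<in> carrier G" for g
    using conj_eq_iff[OF uG that that] centerD(2)[OF u(1) that] by simp
  show ?thesis
  proof (cases "\<forall>v \<in> center G. v \<otimes> v = \<one>")
    case elem: True
    have two: "w = v \<or> w = t \<otimes> v" if "v \<in> center G - {\<one>, t}" "w \<in> center G - {\<one>, t}" for v w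
      using Z[of v] that by auto
    obtain a b where ab: "a \<in> carrier G" "b \<in> carrier G" "commutator a b = t"
      and types: "a \<otimes> a = t \<and> b \<otimes> b = \<one> \<or> a \<otimes> a = t \<and> b \<otimes> b = t \<or> a \<otimes> a \<notin> {\<one>, t} \<and> b \<otimes> b = \<one> \<or>
     a \<otimes> a = t \<and> b \<otimes> b \<notin> {\<one>, t}"
      using square_types[OF xy(1,2) t_def _ two] elem by blast
    have sqc: "a \<otimes> a \<in> center G" "b \<otimes> b \<in> center G" using ab square_center by auto
    note conj = conj_by_commutator(1)[OF ab]
    from types consider "a \<otimes> a = t" "b \<otimes> b = \<one>" | "a \<otimes> a = t" "b \<otimes> b = t"
      | "a \<otimes> a \<notin> {\<one>, t}" "b \<otimes> b = \<one>" | "a \<otimes> a = t" "b \<otimes> b \<notin> {\<one>, t}" by blast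
    thus ?thesis
    proof cases
      case 1
      have g: "g \<in> generate G {a, b, u}" if "g \<in> {a, b, u}" for g using that by (rule generate.incl)
      have "generate G {a, b, u} = carrier G"
        using ab u uG g generate.eng[of a G "{a, b, u}" a] 1 by (intro gen[of _ a b u]) auto
      hence "satisfies_presentation G (gen3 a b u) (extension_relators 0 2 0 [Gen 0] [Gen 1])"
        using conj_by_commutator_inv[OF ab 1(1)] ab uG uconj 1 elem u
        by (intro satisfies_extension) (simp_all add: pow_2)
      thus ?thesis by blast
    next
      case 2
      have g: "g \<in> generate G {a, b, u}" if "g \<in> {a, b, u}" for g using that by (rule generate.incl)
      have "generate G {a, b, u} = carrier G"
        using ab u uG g generate.eng[of a G "{a, b, u}" a] 2 by (intro gen[of _ a b u]) auto
      hence "satisfies_presentation G (gen3 a b u) (extension_relators 2 2 0 [Gen 0] [Gen 1])"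
        using conj_by_commutator_inv[OF ab 2(1)] ab uG uconj 2 elem u
        by (intro satisfies_extension) (simp_all add: pow_2)
      thus ?thesis by blast
    next
      case 3
      have g: "g \<in> generate G {a, t, b}" if "g \<in> {a, t, b}" for g using that by (rule generate.incl)
      have "generate G {a, t, b} = carrier G"
        using ab t(4) g generate.eng[of a G "{a, t, b}" a] 3 sqc by (intro gen[of _ a b "a \<otimes> a"]) auto
      moreover have "a [^] (4::nat) = \<one>" using pow_4 ab elem sqc by simp
      moreover have "t \<otimes> a = a \<otimes> t" "t \<otimes> b = b \<otimes> t" using centerD(2)[OF t(1)] ab by auto
      ultimately have "satisfies_presentation G (gen3 a t b) central_commutator_relators"
        using conj ab t(3,4) 3 by (intro satisfies_central_commutator) (simp_all add: pow_2)
      thus ?thesis by blast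
    next
      case 4
      have g: "g \<in> generate G {a, b}" if "g \<in> {a, b}" for g using that by (rule generate.incl)
      have "generate G {a, b} = carrier G"
        using ab g generate.eng[of a G "{a, b}" a] generate.eng[of b G "{a, b}" b] 4 sqc
        by (intro gen[of _ a b "b \<otimes> b"]) auto
      moreover have "b [^] (4::nat) = \<one>" using pow_4 ab elem sqc by simp
      ultimately have "satisfies_presentation G (gen2 a b) (metacyclic_relators 4 4 0 [Inv 0])"
        using conj_by_commutator_inv[OF ab 4(1)] ab by (intro satisfies_metacyclic) simp_all
      thus ?thesis by blast
    qed
  next
    case False
    \<comment> \<open>The center is cyclic, and outside the subgroup of order two all squares are \<open>t\<close>.\<close>
    have vv: "v \<otimes> v = t" if v: "v \<in> center G" "v \<notin> {\<one>, t}" for v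
    proof -
      obtain w where w: "w \<in> center G" "w \<otimes> w \<noteq> \<one>" using False by blast
      hence wt: "w \<notin> {\<one>, t}" using t by auto
      have wG: "w \<in> carrier G" using w centerD by blast
      have "w \<otimes> w \<in> {\<one>, t, w, t \<otimes> w}" using center_closed(1)[OF w(1) w(1)] Z[OF w(1) wt] by simp
      hence ww: "w \<otimes> w = t" using w wt wG t(4) by auto
      have "v = w \<or> v = t \<otimes> w" using v Z[OF w(1) wt] by blast
      thus ?thesis using ww center_square_mult[OF t(1) wG] t by auto
    qed
    have uu: "u \<otimes> u = t" using vv u by blast
    have adjust: "\<exists>x' \<in> carrier G. x' \<otimes> x' = r \<and> commutator x' y = commutator x y \<and> commutator y x' = commutator y x"
      if "x \<in> carrier G" "y \<in> carrier G" "x \<otimes> x \<in> {\<one>, t}" "r \<in> {\<one>, t}" for x y r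
    proof (cases "x \<otimes> x = r")
      case True thus ?thesis using that by blast
    next
      case False
      have "(u \<otimes> x) \<otimes> (u \<otimes> x) = t \<otimes> (x \<otimes> x)" using center_square_mult[OF u(1) that(1)] uu by simp
      hence "(u \<otimes> x) \<otimes> (u \<otimes> x) = r" using False that(3,4) t by auto
      thus ?thesis using that uG commutator_center_mult[OF u(1)] by (intro bexI[of _ "u \<otimes> x"]) auto
    qed
    have M: ?thesis if ab: "a \<in> carrier G" "b \<in> carrier G" "commutator a b = t" "b \<otimes> b \<in> {\<one>, t}" "a \<otimes> a \<notin> {\<one>, t}" for a b
    proof -
      obtain b' where b: "b' \<in> carrier G" "b' \<otimes> b' = \<one>" "commutator a b' = t"
        using adjust[OF ab(2,1,4), of \<one>] ab(3) by auto
      have sqc: "a \<otimes> a \<in> center G" using ab square_center by auto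
      have a4: "a [^] (4::nat) = t" using pow_4 ab vv sqc by simp
      have g: "g \<in> generate G {a, b'}" if "g \<in> {a, b'}" for g using that by (rule generate.incl)
      have "generate G {a, b'} = carrier G"
        using ab b g generate.eng[of a G "{a, b'}" a] pow_mem_generate[of "{a, b'}" a 4] a4 sqc
        by (intro gen[of _ a b' "a \<otimes> a"]) auto
      moreover have "a [^] (8::nat) = a [^] (4::nat) \<otimes> a [^] (4::nat)" using ab by (simp add: nat_pow_mult)
      moreover have "a [^] (5::nat) = a [^] (4::nat) \<otimes> a" using ab by (simp add: numeral_eq_Suc)
      ultimately have "satisfies_presentation G (gen2 a b') (metacyclic_relators 8 2 0 (replicate 5 (Gen 0)))"
        using conj_by_commutator(1)[OF ab(1) b(1,3)] ab b a4 t(3)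
        by (intro satisfies_metacyclic) (simp_all add: pow_2 word_value_replicate)
      thus ?thesis by blast
    qed
    show ?thesis
    proof (cases "x \<otimes> x \<in> {\<one>, t}")
      case X: True
      show ?thesis
      proof (cases "y \<otimes> y \<in> {\<one>, t}")
        case Y: True
        obtain a where a: "a \<in> carrier G" "a \<otimes> a = t" "commutator a y = t"
          using adjust[OF xy(1,2) X, of t] t_def by auto
        obtain b where b: "b \<in> carrier G" "b \<otimes> b = \<one>" "commutator a b = t"
          using adjust[OF xy(2) a(1) Y, of \<one>] a(3) by auto
        note ab = a(1) b(1) b(3)
        have g: "g \<in> generate G {a, b, u}" if "g \<in> {a, b, u}" for g using that by (rule generate.incl)
        have "generate G {a, b, u} = carrier G"
          using ab u uG g generate.eng[of a G "{a, b, u}" a] a(2) by (intro gen[of _ a b u]) auto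
        hence "satisfies_presentation G (gen3 a b u) (extension_relators 0 2 2 [Gen 0] [Gen 1])"
          using conj_by_commutator_inv[OF ab a(2)] ab uG uconj a b uu
          by (intro satisfies_extension) (simp_all add: pow_2)
        thus ?thesis by blast
      next
        case False
        thus ?thesis using M[OF xy(2,1) _ X] xy commutator_sym[of x y] t_def by simp
      qed
    next
      case X: False
      show ?thesis
      proof (cases "y \<otimes> y \<in> {\<one>, t}")
        case Y: True
        thus ?thesis using M[OF xy(1,2) t_def[symmetric] Y X] by simp
      next
        case Y: False
        have sqc: "x \<otimes> x \<in> center G" "y \<otimes> y \<in> center G" using xy square_center by auto
        have "y \<otimes> y = x \<otimes> x \<or> y \<otimes> y = t \<otimes> (x \<otimes> x)" using Z[OF sqc(1) X] sqc(2) Y by blast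
        hence "(x \<otimes> x) \<otimes> (y \<otimes> y) \<in> {\<one>, t}"
        proof
          assume "y \<otimes> y = x \<otimes> x"
          thus ?thesis using vv[OF sqc(1) X] by simp
        next
          assume y: "y \<otimes> y = t \<otimes> (x \<otimes> x)"
          have "(x \<otimes> x) \<otimes> (t \<otimes> (x \<otimes> x)) = t \<otimes> ((x \<otimes> x) \<otimes> (x \<otimes> x))"
            using t(1) xy by (intro center_left_commute) simp_all
          thus ?thesis using vv[OF sqc(1) X] y t(3) by simp
        qed
        hence W: "(x \<otimes> y) \<otimes> (x \<otimes> y) \<in> {\<one>, t}" using square_mult[OF xy(1,2)] t t_def by auto
        have "commutator x (x \<otimes> y) = t" using xy t_def t(4) by (simp add: commutator_mult_right commutator_self)
        thus ?thesis using M[OF xy(1) _ _ W X] xy by simp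
      qed
    qed
  qed
qed

end

section \<open>Groups of order twenty-four\<close>

context small_centralizer_group
begin

text \<open>The six elements with centralizer of order four form, together with the center, the Sylow
  2-subgroup, which is therefore normal. An element \<open>c\<close> of order three permutes its three
  subgroups of index two cyclically; so for \<open>a\<close> outside the center, \<open>a\<close> and \<open>b = c a c\<^sup>-\<^sup>1\<close>
  generate it modulo the center, and \<open>c b c\<^sup>-\<^sup>1\<close> is \<open>a b\<close> up to the central involution. Since
  these three elements are conjugate they have the same square, which makes the Sylow subgroup a
  quaternion group. The sign is removed by passing to inverses.\<close>

lemma presentation_order_24:
  assumes z: "card (center G) = 2" and ord: "order G = 24" and N: "class_size 4 = 6" "class_size 6 \<noteq> 0"
  shows "\<exists>a b c. satisfies_presentation G (gen3 a b c) (extension_relators 2 3 0 [Gen 1] [Gen 0, Gen 1])"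
proof -
  obtain t where Z: "center G = {\<one>, t}" and t: "t \<noteq> \<one>" "t \<in> carrier G" "t \<otimes> t = \<one>"
    using center_2[OF z] by metis
  have fZ: "finite (center G)" using Z by simp
  have fp: "Factorial_Ring.prime (2::nat)" by simp
  obtain S where S: "subgroup S G" "card S = 8"
    using sylow_thm[OF fp is_group _ finite_carrier, of 3 3] ord by auto
  have SX: "S = center G \<union> centralizer_class 4"
  proof (rule card_subset_eq)
    show "S \<subseteq> center G \<union> centralizer_class 4"
    proof (rule subsetI, rule ccontr)
      fix x assume x: "x \<in> S" "x \<notin> center G \<union> centralizer_class 4"
      have xG: "x \<in> carrier G - center G" "x \<in> carrier G" using x subgroup.subset[OF S(1)] by auto
      have "card (centralizer G x) \<noteq> 4" using x(2) xG by (simp add: centralizer_class_def) blast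
      moreover have "4 \<le> card (centralizer G x)" "card (centralizer G x) \<le> 6" "2 dvd card (centralizer G x)"
        using noncentral_centralizer(1,6)[OF xG(1)] card_centralizer_le[OF xG(1)] z by auto
      ultimately have c6: "card (centralizer G x) = 6" by presburger
      have "x [^] (6::nat) = \<one>" using pow_card_subgroup[OF noncentral_centralizer(4,3)[OF xG(1)]] c6 by simp
      moreover have "x [^] (8::nat) = \<one>" using pow_card_subgroup[OF S(1) x(1)] S(2) by simp
      moreover have "x [^] (8::nat) = x [^] (6::nat) \<otimes> x [^] (2::nat)" using xG by (simp add: nat_pow_mult)
      ultimately have "x [^] (2::nat) = \<one>" using xG by simp
      moreover have "x [^] (3::nat) = x [^] (2::nat) \<otimes> x" using xG by (simp add: numeral_eq_Suc)
      moreover have "x [^] (3::nat) \<in> center G" using pow_index_center[OF xG(1), of 3] c6 z by simp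
      ultimately show False using xG by simp
    qed
    show "finite (center G \<union> centralizer_class 4)" using fZ class_size_finite by simp
    have "center G \<inter> centralizer_class 4 = {}" by (auto simp: centralizer_class_def)
    thus "card S = card (center G \<union> centralizer_class 4)"
      using S(2) z N(1) fZ class_size_finite by (simp add: card_Un_disjoint)
  qed
  obtain a where a: "a \<in> carrier G - center G" "a \<in> carrier G" "card (centralizer G a) = 4" "a \<in> centralizer_class 4"
    using obtain_in_class[of 4] N by auto
  obtain c where c: "c \<in> centralizer_class 6" "c [^] (3::nat) = \<one>"
    using element_of_order_3[OF z] N by auto
  have cG: "c \<in> carrier G - center G" "c \<in> carrier G" "card (centralizer G c) = 6"
    using c(1) by (auto simp: centralizer_class_def)
  define \<gamma> where "\<gamma> g = c \<otimes> g \<otimes> inv c" for g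
  have \<gamma>c: "\<gamma> g \<in> carrier G" if "g \<in> carrier G" for g using that cG by (simp add: \<gamma>_def)
  have \<gamma>m: "\<gamma> (g \<otimes> h) = \<gamma> g \<otimes> \<gamma> h" if "g \<in> carrier G" "h \<in> carrier G" for g h
    using that cG conj_mult by (simp add: \<gamma>_def)
  have \<gamma>Z: "\<gamma> m = m" if "m \<in> center G" for m
    using that cG conj_eq_iff[of c m m] centerD[of m] by (simp add: \<gamma>_def)
  have \<gamma>3: "\<gamma> (\<gamma> (\<gamma> g)) = g" if "g \<in> carrier G" for g
  proof -
    have "\<gamma> (\<gamma> (\<gamma> g)) = c [^] (3::nat) \<otimes> g \<otimes> inv (c [^] (3::nat))"
      using that cG by (simp add: \<gamma>_def numeral_eq_Suc inv_mult_group m_assoc)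
    thus ?thesis using c(2) that by simp
  qed
  have \<gamma>4: "\<gamma> g \<in> centralizer_class 4" if "g \<in> centralizer_class 4" for g
    using that cG centralizer_class_conj by (simp add: \<gamma>_def)
  define b where "b = \<gamma> a"
  have b: "b \<in> centralizer_class 4" "b \<in> carrier G" "b \<notin> center G"
    using \<gamma>4[OF a(4)] by (auto simp: b_def centralizer_class_def)
  have ca: "c \<notin> centralizer G a"
    using centralizer_cong(1)[OF a(1), of c] a(3) cG by auto
  have ab: "a \<otimes> b \<noteq> b \<otimes> a"
  proof
    assume "a \<otimes> b = b \<otimes> a"
    hence "b \<in> centralizer G a" using b by (simp add: centralizer_def)
    then obtain s where s: "s \<in> center G" "b = s \<otimes> a"
      using centralizer_index_two[OF a(1), of b] a(3) z b(3) by auto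
    have sG: "s \<in> carrier G" using s centerD by blast
    have g: "\<gamma> (s \<otimes> x) = s \<otimes> \<gamma> x" if "x \<in> carrier G" for x using that s sG \<gamma>m \<gamma>Z by simp
    have "\<gamma> a = s \<otimes> a" using s(2) by (simp add: b_def)
    hence "s \<otimes> (s \<otimes> (s \<otimes> a)) = a" using \<gamma>3[OF a(2)] g sG a(2) by simp
    hence "s \<noteq> t" using t a Z cG ca \<open>\<gamma> a = s \<otimes> a\<close>
      by (metis \<gamma>_def conj_eq_iff l_one m_assoc m_closed r_cancel_one centralizer_def mem_Collect_eq)
    hence "\<gamma> a = a" using s(1) Z \<open>\<gamma> a = s \<otimes> a\<close> a by simp
    hence "c \<otimes> a = a \<otimes> c" using conj_eq_iff cG a by (simp add: \<gamma>_def)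
    thus False using ca cG by (simp add: centralizer_def)
  qed
  have cenZ: "center G \<subseteq> centralizer G a" "center G \<subseteq> centralizer G b"
    using center_subset_centralizer[of a G] center_subset_centralizer[of b G] a b by auto
  have abS: "a \<in> S" "b \<in> S" "center G \<subseteq> S" using SX a b by auto
  let ?U = "(\<lambda>m. a \<otimes> b \<otimes> m) ` center G \<union> ((\<lambda>m. b \<otimes> m) ` center G \<union> ((\<lambda>m. a \<otimes> m) ` center G \<union> center G))"
  have "?U = S"
    using four_cosets(1,2)[OF S(1) abS(3,1,2) ab cenZ] S(2) z finite_subset_carrier[OF subgroup.subset[OF S(1)]]
    by (intro card_subset_eq) simp_all
  moreover have "\<gamma> b \<in> S" using \<gamma>4[OF b(1)] SX by blast
  moreover have "\<gamma> b \<notin> center G" using \<gamma>4[OF b(1)] by (simp add: centralizer_class_def)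
  ultimately consider m where "m \<in> center G" "\<gamma> b = a \<otimes> b \<otimes> m"
    | m where "m \<in> center G" "\<gamma> b = b \<otimes> m" | m where "m \<in> center G" "\<gamma> b = a \<otimes> m" by blast
  then obtain m where m: "m \<in> center G" "\<gamma> b = a \<otimes> b \<otimes> m"
  proof cases
    case 1 thus ?thesis using that by blast
  next
    case (2 m)
    have mG: "m \<in> carrier G" using 2 centerD by blast
    have eq: "\<gamma> b = \<gamma> (a \<otimes> m)" using 2 \<gamma>m[OF a(2) mG] \<gamma>Z by (simp add: b_def)
    have "b = \<gamma> (\<gamma> (\<gamma> b))" using \<gamma>3[OF b(2)] by (rule sym)
    also have "\<dots> = a \<otimes> m" unfolding eq using a mG by (intro \<gamma>3) simp
    finally have "b = a \<otimes> m" .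
    hence "a \<otimes> b = b \<otimes> a" using a mG centerD(2)[OF 2(1) a(2)] by (simp add: m_assoc)
    thus ?thesis using ab by blast
  next
    case (3 m)
    have mG: "m \<in> carrier G" using 3 centerD by blast
    have "\<gamma> (\<gamma> b) = b \<otimes> m" using 3 \<gamma>m[OF a(2) mG] \<gamma>Z by (simp add: b_def)
    hence "a = b \<otimes> m" using \<gamma>3[OF a(2)] by (simp add: b_def)
    hence "a \<otimes> b = b \<otimes> a" using b mG centerD(2)[OF 3(1) b(2)] by (simp add: m_assoc)
    thus ?thesis using ab by blast
  qed
  have mG: "m \<in> carrier G" and mm: "m \<otimes> m = \<one>" using m(1) Z t by auto
  have aZ: "a \<otimes> a \<in> center G" using pow_index_center[OF a(1), of 2] a z by (simp add: pow_2)
  have bb: "b \<otimes> b = a \<otimes> a" using \<gamma>m[OF a(2) a(2)] \<gamma>Z[OF aZ] by (simp add: b_def)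
  have "\<gamma> b \<otimes> \<gamma> b = a \<otimes> a" using \<gamma>m[OF b(2) b(2)] bb \<gamma>Z[OF aZ] by simp
  moreover have "(a \<otimes> b \<otimes> m) \<otimes> (a \<otimes> b \<otimes> m) = (a \<otimes> b) \<otimes> (a \<otimes> b)"
  proof -
    have "a \<otimes> b \<otimes> m = m \<otimes> (a \<otimes> b)" using centerD(2)[OF m(1)] a b by simp
    thus ?thesis using center_square_mult[OF m(1), of "a \<otimes> b"] mm a b by simp
  qed
  ultimately have "a \<otimes> (b \<otimes> (a \<otimes> b)) = a \<otimes> a" using m(2) a b by (simp add: m_assoc)
  hence bab: "b \<otimes> (a \<otimes> b) = a" using a b by simp
  have ba: "b \<otimes> a \<otimes> inv b = inv a"
  proof -
    have "b \<otimes> a \<otimes> inv b = b \<otimes> (a \<otimes> b) \<otimes> inv (b \<otimes> b)" using a b by (simp add: word_simps)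
    thus ?thesis unfolding bab bb using a by (simp add: word_simps)
  qed
  have aa: "a \<otimes> a = t"
  proof -
    have "a \<otimes> a \<noteq> \<one>"
    proof
      assume "a \<otimes> a = \<one>"
      hence "inv a = a" using a by (metis inv_equality)
      thus False using ba ab conj_eq_iff[OF b(2) a(2) a(2)] by simp
    qed
    thus ?thesis using aZ Z by auto
  qed
  have a4: "a [^] (4::nat) = \<one>"
  proof -
    have "a [^] (4::nat) = (a \<otimes> a) \<otimes> (a \<otimes> a)" using a by (simp add: numeral_eq_Suc m_assoc)
    thus ?thesis using aa t by simp
  qed
  have gen: "generate G T = carrier G"
    if T: "T \<subseteq> carrier G" "a \<in> generate G T" "b \<in> generate G T" "c \<in> generate G T" for T
  proof -
    let ?K = "generate G T"
    have K: "subgroup ?K G" using T(1) by (rule generate_is_subgroup)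
    have ZK: "center G \<subseteq> ?K" using generate.eng[OF T(2) T(2)] aa generate.one[of G T] Z by simp
    have "centralizer G c \<subseteq> ?K"
      using cG z T(4) ZK K by (intro centralizer_subset_of_prime_index[of c ?K 3]) simp_all
    hence "6 dvd card ?K" using card_subgroup_dvd[OF noncentral_centralizer(4)[OF cG(1)] K] cG(3) by simp
    moreover have "8 dvd card ?K"
    proof -
      have KS: "subgroup (?K \<inter> S) G" using subgroups_Inter_pair[OF K S(1)] .
      have "4 * card (center G) \<le> card (?K \<inter> S)"
        using four_cosets(3)[OF KS _ _ _ ab cenZ] ZK abS T by blast
      moreover have "card (?K \<inter> S) \<le> card S"
        using finite_subset_carrier[OF subgroup.subset[OF S(1)]] by (intro card_mono) auto
      ultimately have "card (?K \<inter> S) = 8" using z S(2) by simp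
      moreover have "card (?K \<inter> S) dvd card ?K" by (rule card_subgroup_dvd[OF KS K]) blast
      ultimately show ?thesis by simp
    qed
    moreover have "0 < card ?K" using card_subgroup_pos[OF K] .
    ultimately have "24 \<le> card ?K" by presburger
    thus ?thesis using ord by (intro subgroup_eq_carrier[OF K]) simp
  qed
  from m(1) Z consider "m = \<one>" | "m = t" by blast
  thus ?thesis
  proof cases
    case 1
    have g: "g \<in> generate G {a, b, c}" if "g \<in> {a, b, c}" for g using that by (rule generate.incl)
    have "generate G {a, b, c} = carrier G" using a b cG g by (intro gen) auto
    moreover have "c \<otimes> a \<otimes> inv c = b" "c \<otimes> b \<otimes> inv c = a \<otimes> b"
      using m(2) 1 a b by (simp_all add: \<gamma>_def b_def)
    ultimately have "satisfies_presentation G (gen3 a b c) (extension_relators 2 3 0 [Gen 1] [Gen 0, Gen 1])"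
      using a b cG c(2) a4 bb ba by (intro satisfies_extension) (simp_all add: pow_2)
    thus ?thesis by blast
  next
    case 2
    let ?a = "inv a" and ?b = "inv b"
    have iG: "?a \<in> carrier G" "?b \<in> carrier G" using a b by auto
    have "inv a = a \<otimes> t"
    proof (rule inv_equality)
      have "a \<otimes> t \<otimes> a = t \<otimes> (a \<otimes> a)" using center_left_commute[of t a a] Z a t by (simp add: m_assoc)
      thus "a \<otimes> t \<otimes> a = \<one>" using aa t by simp
    qed (use a t in auto)
    moreover have "b \<otimes> a = inv a \<otimes> b" using ba a b conj_eq_iff[OF b(2) a(2) iG(1)] by simp
    ultimately have "b \<otimes> a = a \<otimes> b \<otimes> t" using centerD(2)[of t b] Z a b t by (simp add: m_assoc)
    hence \<gamma>b: "\<gamma> b = b \<otimes> a" using m(2) 2 by simp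
    have "c \<otimes> ?a \<otimes> inv c = ?b" using conj_inv[OF cG(2) a(2)] by (simp add: b_def \<gamma>_def)
    moreover have "c \<otimes> ?b \<otimes> inv c = ?a \<otimes> ?b"
      using conj_inv[OF cG(2) b(2)] \<gamma>b a b by (simp add: \<gamma>_def inv_mult_group)
    moreover have "?b \<otimes> ?a \<otimes> inv ?b = inv ?a"
    proof -
      have "?b \<otimes> ?a \<otimes> inv ?b = ?b \<otimes> (b \<otimes> a \<otimes> inv b) \<otimes> b" using ba b by simp
      also have "\<dots> = a" using a b by (simp add: word_simps)
      finally show ?thesis using a by simp
    qed
    moreover have "?b \<otimes> ?b = ?a \<otimes> ?a" using bb a b by (simp flip: inv_mult_group)
    moreover have "?a [^] (4::nat) = \<one>" using a4 a by (simp add: nat_pow_inv)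
    moreover have "generate G {?a, ?b, c} = carrier G"
    proof (rule gen)
      have "inv ?a \<in> generate G {?a, ?b, c}" "inv ?b \<in> generate G {?a, ?b, c}"
        by (rule generate.inv; simp)+
      thus "a \<in> generate G {?a, ?b, c}" "b \<in> generate G {?a, ?b, c}" using a b by auto
      show "c \<in> generate G {?a, ?b, c}" by (rule generate.incl) simp
    qed (use iG cG in auto)
    ultimately have "satisfies_presentation G (gen3 ?a ?b c) (extension_relators 2 3 0 [Gen 1] [Gen 0, Gen 1])"
      using iG cG c(2) by (intro satisfies_extension) (simp_all add: pow_2)
    thus ?thesis by blast
  qed
qed

section \<open>The classification up to presentations\<close>

lemma classification:
  "order G = 6 \<and> G \<cong> sym_group 3 \<or> order G = 12 \<and> G \<cong> alt_group 4 \<or> order G = 60 \<and> G \<cong> alt_group 5 \<or>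
   order G = 10 \<and> (\<exists>f. satisfies_presentation G f (metacyclic_relators 5 2 0 [Inv 0])) \<or>
   order G = 20 \<and> (\<exists>f. satisfies_presentation G f (metacyclic_relators 5 4 0 [Gen 0, Gen 0])) \<or>
   order G = 8 \<and> (\<exists>f. satisfies_presentation G f (metacyclic_relators 4 2 0 [Inv 0])) \<or>
   order G = 8 \<and> (\<exists>f. satisfies_presentation G f (metacyclic_relators 4 2 2 [Inv 0])) \<or>
   order G = 12 \<and> (\<exists>f. satisfies_presentation G f (metacyclic_relators 6 2 0 [Inv 0])) \<or>
   order G = 12 \<and> (\<exists>f. satisfies_presentation G f (metacyclic_relators 3 4 0 [Inv 0])) \<or>
   order G = 24 \<and> (\<exists>f. satisfies_presentation G f (extension_relators 2 3 0 [Gen 1] [Gen 0, Gen 1])) \<or>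
   order G = 16 \<and> ((\<exists>f. satisfies_presentation G f (extension_relators 0 2 0 [Gen 0] [Gen 1])) \<or>
    (\<exists>f. satisfies_presentation G f (extension_relators 2 2 0 [Gen 0] [Gen 1])) \<or>
    (\<exists>f. satisfies_presentation G f (extension_relators 0 2 2 [Gen 0] [Gen 1])) \<or>
    (\<exists>f. satisfies_presentation G f central_commutator_relators) \<or>
    (\<exists>f. satisfies_presentation G f (metacyclic_relators 4 4 0 [Inv 0])) \<or>
    (\<exists>f. satisfies_presentation G f (metacyclic_relators 8 2 0 (replicate 5 (Gen 0)))))"
proof -
  have "card (center G) \<noteq> 0" using center_pos by simp
  with card_center_le_4 card_center_ne_3
  consider (1) "card (center G) = 1" | (2) "card (center G) = 2" | (4) "card (center G) = 4" by linarith
  thus ?thesis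
  proof cases
    case z: 1
    from class_sizes_center_1[OF z]
    consider "order G = 6" "class_size 2 = 3"
      | "order G = 10" "class_size 2 = 5" "class_size 3 = 0" "class_size 4 = 0" "class_size 5 = 4"
      | "order G = 12" "class_size 3 = 8" | "order G = 20" "class_size 2 = 0" "class_size 3 = 0" "class_size 5 = 4"
      | "order G = 60" "class_size 4 = 15"
      by auto
    thus ?thesis
    proof cases
      case 1 thus ?thesis using iso_S3[OF z] by simp
    next
      case 2 thus ?thesis using presentation_order_10[OF z] by metis
    next
      case 3 thus ?thesis using iso_A4[OF z] by simp
    next
      case 4 thus ?thesis using presentation_order_20[OF z] by metis
    next
      case 5 thus ?thesis using iso_A5[OF z] by simp
    qed
  next
    case z: 2
    from orders_center_2[OF z]
    consider "order G = 8" "class_size 6 = 0" | "order G = 12" "class_size 6 = 4"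
      | "order G = 24" "class_size 4 = 6" "class_size 6 = 16"
      by auto
    thus ?thesis
    proof cases
      case 1 thus ?thesis using presentation_order_8[OF z] by metis
    next
      case 2 thus ?thesis using presentation_order_12[OF z] by metis
    next
      case 3
      hence "class_size 6 \<noteq> 0" by simp
      thus ?thesis using presentation_order_24[OF z 3(1,2)] 3(1) by metis
    qed
  next
    case z: 4
    show ?thesis using orders_center_4(1)[OF z] presentation_order_16[OF z] by metis
  qed
qed

end

section \<open>Concrete groups given by generators and relations\<close>

lemma semidirect_product_group:
  assumes N: "group N" and H: "group H"
    and closed: "\<And>h n. h \<in> carrier H \<Longrightarrow> n \<in> carrier N \<Longrightarrow> \<phi> h n \<in> carrier N"
    and hom: "\<And>h n n'. h \<in> carrier H \<Longrightarrow> n \<in> carrier N \<Longrightarrow> n' \<in> carrier N \<Longrightarrow>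
      \<phi> h (n \<otimes>\<^bsub>N\<^esub> n') = \<phi> h n \<otimes>\<^bsub>N\<^esub> \<phi> h n'"
    and mult: "\<And>h h' n. h \<in> carrier H \<Longrightarrow> h' \<in> carrier H \<Longrightarrow> n \<in> carrier N \<Longrightarrow> \<phi> (h \<otimes>\<^bsub>H\<^esub> h') n = \<phi> h (\<phi> h' n)"
    and one: "\<And>n. n \<in> carrier N \<Longrightarrow> \<phi> \<one>\<^bsub>H\<^esub> n = n"
  shows "group (semidirect_product N H \<phi>)"
proof -
  interpret N: group N by (rule N)
  interpret H: group H by (rule H)
  have one': "\<phi> h \<one>\<^bsub>N\<^esub> = \<one>\<^bsub>N\<^esub>" if "h \<in> carrier H" for h
    using hom[OF that N.one_closed N.one_closed] closed[OF that N.one_closed] by simp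
  show ?thesis
  proof (rule groupI)
    fix p assume "p \<in> carrier (semidirect_product N H \<phi>)"
    then obtain n h where p: "p = (n, h)" "n \<in> carrier N" "h \<in> carrier H"
      by (auto simp: semidirect_product_def)
    let ?q = "(\<phi> (inv\<^bsub>H\<^esub> h) (inv\<^bsub>N\<^esub> n), inv\<^bsub>H\<^esub> h)"
    have "\<phi> (inv\<^bsub>H\<^esub> h) (inv\<^bsub>N\<^esub> n) \<otimes>\<^bsub>N\<^esub> \<phi> (inv\<^bsub>H\<^esub> h) n = \<one>\<^bsub>N\<^esub>"
      using p one' by (simp flip: hom)
    thus "\<exists>q\<in>carrier (semidirect_product N H \<phi>).
        q \<otimes>\<^bsub>semidirect_product N H \<phi>\<^esub> p = \<one>\<^bsub>semidirect_product N H \<phi>\<^esub>"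
      using p closed by (intro bexI[of _ ?q]) (simp_all add: semidirect_product_def)
  qed (auto simp: semidirect_product_def closed hom mult one N.m_assoc H.m_assoc)
qed

lemma group_inversion_semidirect:
  assumes "even m" shows "group (inversion_semidirect n m)"
proof -
  interpret N: comm_group "integer_mod_group n" by simp
  have "even (k mod int m) = even k" for k :: int
    using assms by (simp add: dvd_mod_iff)
  thus ?thesis
    unfolding inversion_semidirect_def
    by (intro semidirect_product_group)
      (simp_all add: N.inv_mult[simplified] del: inv_integer_mod_group)
qed

lemma carrier_inversion_semidirect:
  "0 < n \<Longrightarrow> 0 < m \<Longrightarrow> carrier (inversion_semidirect n m) = {0..<int n} \<times> {0..<int m}"
  by (simp add: inversion_semidirect_def semidirect_product_def carrier_integer_mod_group)

lemma mult_inversion_semidirect: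
  assumes "0 < n" "y \<in> {0..<int n}"
  shows "(x, k) \<otimes>\<^bsub>inversion_semidirect n m\<^esub> (y, l) =
    ((x + (if even k then y else - y)) mod int n, (k + l) mod int m)"
  using assms by (simp add: inversion_semidirect_def semidirect_product_def carrier_integer_mod_group mod_simps)

lemma one_inversion_semidirect: "\<one>\<^bsub>inversion_semidirect n m\<^esub> = (0, 0)"
  by (simp add: inversion_semidirect_def semidirect_product_def)

lemma order_inversion_semidirect: "0 < n \<Longrightarrow> 0 < m \<Longrightarrow> order (inversion_semidirect n m) = n * m"
  by (simp add: order_def carrier_inversion_semidirect card_cartesian_product)

lemma inversion_semidirect_relations:
  assumes n: "2 \<le> n" and m: "even m" "0 < m"
  defines "D \<equiv> inversion_semidirect n m"
  shows "(1, 0) \<in> carrier D" "(0, 1) \<in> carrier D" "generate D {(1, 0), (0, 1)} = carrier D"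
    "(1, 0) [^]\<^bsub>D\<^esub> n = \<one>\<^bsub>D\<^esub>" "(0, 1) [^]\<^bsub>D\<^esub> m = \<one>\<^bsub>D\<^esub>"
    "(0, 1) \<otimes>\<^bsub>D\<^esub> (1, 0) \<otimes>\<^bsub>D\<^esub> inv\<^bsub>D\<^esub> (0, 1) = inv\<^bsub>D\<^esub> (1, 0)"
proof -
  have m2: "2 \<le> m" using m by presburger
  have nm: "0 < n" "0 < m" using n m by auto
  interpret D: group D unfolding D_def by (rule group_inversion_semidirect[OF m(1)])
  note carrier = carrier_inversion_semidirect[OF nm, folded D_def]
  note mult = mult_inversion_semidirect[OF nm(1), where m = m, folded D_def]
  show a: "(1, 0) \<in> carrier D" and b: "(0, 1) \<in> carrier D" using n m2 by (auto simp: carrier)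
  have one: "\<one>\<^bsub>D\<^esub> = (0, 0)" by (simp add: D_def one_inversion_semidirect)
  have r1: "1 \<in> {0..<int n}" and r0: "0 \<in> {0..<int n}" using n by auto
  have apow: "(1, 0) [^]\<^bsub>D\<^esub> i = (int i mod int n, 0)" for i :: nat
  proof (induction i)
    case (Suc i)
    thus ?case using mult[OF r1] by (simp add: mod_simps add.commute)
  qed (simp add: one)
  have bpow: "(0, 1) [^]\<^bsub>D\<^esub> i = (0, int i mod int m)" for i :: nat
  proof (induction i)
    case (Suc i)
    thus ?case using mult[OF r0] by (simp add: mod_simps add.commute)
  qed (simp add: one)
  show "(1, 0) [^]\<^bsub>D\<^esub> n = \<one>\<^bsub>D\<^esub>" "(0, 1) [^]\<^bsub>D\<^esub> m = \<one>\<^bsub>D\<^esub>"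
    using apow bpow by (simp_all add: one)
  have ia: "inv\<^bsub>D\<^esub> (1, 0) = (-1 mod int n, 0)"
  proof (rule D.inv_equality)
    show "(-1 mod int n, 0) \<otimes>\<^bsub>D\<^esub> (1, 0) = \<one>\<^bsub>D\<^esub>"
      unfolding mult[OF r1] one by (simp add: mod_simps)
    show "(-1 mod int n, 0) \<in> carrier D" using nm by (simp add: carrier)
  qed (rule a)
  have "(0, 1) \<otimes>\<^bsub>D\<^esub> (1, 0) = inv\<^bsub>D\<^esub> (1, 0) \<otimes>\<^bsub>D\<^esub> (0, 1)"
    unfolding ia mult[OF r1] mult[OF r0] by simp
  thus "(0, 1) \<otimes>\<^bsub>D\<^esub> (1, 0) \<otimes>\<^bsub>D\<^esub> inv\<^bsub>D\<^esub> (0, 1) = inv\<^bsub>D\<^esub> (1, 0)"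
    using a b by (simp add: D.m_assoc)
  show "generate D {(1, 0), (0, 1)} = carrier D"
  proof (rule equalityI)
    show "generate D {(1, 0), (0, 1)} \<subseteq> carrier D" using a b by (intro D.generate_incl) auto
    show "carrier D \<subseteq> generate D {(1, 0), (0, 1)}"
    proof
      fix p assume "p \<in> carrier D"
      then obtain x k where p: "p = (x, k)" "x \<in> {0..<int n}" "k \<in> {0..<int m}" by (auto simp: carrier)
      have "p = (1, 0) [^]\<^bsub>D\<^esub> nat x \<otimes>\<^bsub>D\<^esub> (0, 1) [^]\<^bsub>D\<^esub> nat k"
        unfolding apow bpow mult[OF r0] using p by simp
      moreover have "(1, 0) \<in> generate D {(1, 0), (0, 1)}" "(0, 1) \<in> generate D {(1, 0), (0, 1)}"
        by (auto intro: generate.incl)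
      ultimately show "p \<in> generate D {(1, 0), (0, 1)}"
        using D.pow_mem_generate[of "{(1, 0), (0, 1)}"] a b by (auto intro: generate.eng)
    qed
  qed
qed

lemma satisfies_inversion_semidirect:
  assumes n: "2 \<le> n" and m: "even m" "0 < m"
  shows "satisfies_presentation (inversion_semidirect n m) (gen2 (1, 0) (0, 1)) (metacyclic_relators n m 0 [Inv 0])"
proof -
  interpret group "inversion_semidirect n m" by (rule group_inversion_semidirect[OF m(1)])
  note r = inversion_semidirect_relations[OF assms]
  show ?thesis using r by (intro satisfies_metacyclic) simp_all
qed

lemma quaternion_mult_assoc: "quaternion_mult (quaternion_mult p q) r = quaternion_mult p (quaternion_mult q r)"
  by (cases p; cases q; cases r) (simp add: algebra_simps)

lemma group_quaternion_group: "group quaternion_group"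
proof (rule groupI)
  fix p assume p: "p \<in> carrier quaternion_group"
  show "\<exists>q\<in>carrier quaternion_group. q \<otimes>\<^bsub>quaternion_group\<^esub> p = \<one>\<^bsub>quaternion_group\<^esub>"
    using p unfolding quaternion_group_def by auto
next
  fix p q r show "p \<otimes>\<^bsub>quaternion_group\<^esub> q \<otimes>\<^bsub>quaternion_group\<^esub> r =
      p \<otimes>\<^bsub>quaternion_group\<^esub> (q \<otimes>\<^bsub>quaternion_group\<^esub> r)"
    by (simp add: quaternion_group_def quaternion_mult_assoc)
qed (auto simp: quaternion_group_def)

lemma quaternion_relations:
  defines "Q \<equiv> quaternion_group"
  shows "(0, 1, 0, 0) \<in> carrier Q" "(0, 0, 1, 0) \<in> carrier Q"
    "generate Q {(0, 1, 0, 0), (0, 0, 1, 0)} = carrier Q"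
    "(0, 1, 0, 0) [^]\<^bsub>Q\<^esub> (4::nat) = \<one>\<^bsub>Q\<^esub>" "(0, 0, 1, 0) [^]\<^bsub>Q\<^esub> (2::nat) = (0, 1, 0, 0) [^]\<^bsub>Q\<^esub> (2::nat)"
    "(0, 0, 1, 0) \<otimes>\<^bsub>Q\<^esub> (0, 1, 0, 0) \<otimes>\<^bsub>Q\<^esub> inv\<^bsub>Q\<^esub> (0, 0, 1, 0) = inv\<^bsub>Q\<^esub> (0, 1, 0, 0)"
proof -
  interpret Q: group Q unfolding Q_def by (rule group_quaternion_group)
  let ?i = "(0, 1, 0, 0) :: int \<times> int \<times> int \<times> int" and ?j = "(0, 0, 1, 0) :: int \<times> int \<times> int \<times> int"
  have mult: "p \<otimes>\<^bsub>Q\<^esub> q = quaternion_mult p q" for p q by (simp add: Q_def quaternion_group_def)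
  have one: "\<one>\<^bsub>Q\<^esub> = (1, 0, 0, 0)" by (simp add: Q_def quaternion_group_def)
  show i: "?i \<in> carrier Q" and j: "?j \<in> carrier Q" by (simp_all add: Q_def quaternion_group_def)
  show "?i [^]\<^bsub>Q\<^esub> (4::nat) = \<one>\<^bsub>Q\<^esub>" "?j [^]\<^bsub>Q\<^esub> (2::nat) = ?i [^]\<^bsub>Q\<^esub> (2::nat)"
    by (simp_all add: numeral_eq_Suc mult one)
  have ii: "inv\<^bsub>Q\<^esub> ?i = (0, -1, 0, 0)" by (rule Q.inv_equality) (simp_all add: mult one i, simp add: Q_def quaternion_group_def)
  have "?j \<otimes>\<^bsub>Q\<^esub> ?i = inv\<^bsub>Q\<^esub> ?i \<otimes>\<^bsub>Q\<^esub> ?j" unfolding ii mult by simp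
  thus "?j \<otimes>\<^bsub>Q\<^esub> ?i \<otimes>\<^bsub>Q\<^esub> inv\<^bsub>Q\<^esub> ?j = inv\<^bsub>Q\<^esub> ?i" using i j by (simp add: Q.m_assoc)
  let ?K = "generate Q {?i, ?j}"
  have gi: "?i \<in> ?K" "?j \<in> ?K" by (auto intro: generate.incl)
  have e: "quaternion_mult p q \<in> ?K" if "p \<in> ?K" "q \<in> ?K" for p q using generate.eng[OF that] by (simp add: mult)
  have m1: "(-1, 0, 0, 0) \<in> ?K" using e[OF gi(1) gi(1)] by simp
  have k: "(0, 0, 0, 1) \<in> ?K" using e[OF gi] by simp
  have "carrier Q \<subseteq> ?K"
    using gi k m1 e[OF m1 gi(1)] e[OF m1 gi(2)] e[OF m1 k] generate.one[of Q "{?i, ?j}"]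
    by (auto simp: Q_def[symmetric] one) (simp add: Q_def quaternion_group_def; auto)
  thus "?K = carrier Q" using Q.generate_incl i j by (intro equalityI) auto
qed

lemma satisfies_quaternion_group:
  "satisfies_presentation quaternion_group (gen2 (0, 1, 0, 0) (0, 0, 1, 0)) (metacyclic_relators 4 2 2 [Inv 0])"
proof -
  interpret group quaternion_group by (rule group_quaternion_group)
  show ?thesis using quaternion_relations by (intro satisfies_metacyclic) simp_all
qed

lemma order_quaternion_group: "order quaternion_group = 8"
  by (simp add: order_def quaternion_group_def)

lemma DirProd_nat_pow:
  "(x, y) [^]\<^bsub>G \<times>\<times> H\<^esub> (n::nat) = (x [^]\<^bsub>G\<^esub> n, y [^]\<^bsub>H\<^esub> n)"
  by (induction n) simp_all

text \<open>The case \<open>n = 4\<close> provides the group of which the central product is a quotient.\<close>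

lemma DirProd_cyclic_presentation:
  assumes D: "group D" and ab: "a \<in> carrier D" "b \<in> carrier D" "generate D {a, b} = carrier D"
    and rel: "a [^]\<^bsub>D\<^esub> (4::nat) = \<one>\<^bsub>D\<^esub>" "b [^]\<^bsub>D\<^esub> (2::nat) = a [^]\<^bsub>D\<^esub> k" "b \<otimes>\<^bsub>D\<^esub> a \<otimes>\<^bsub>D\<^esub> inv\<^bsub>D\<^esub> b = inv\<^bsub>D\<^esub> a"
    and n: "2 \<le> n"
  defines "P \<equiv> D \<times>\<times> integer_mod_group n"
  shows "group P" and "generate P {(a, 0), (b, 0), (\<one>\<^bsub>D\<^esub>, 1)} = carrier P"
    and "{(a, 0), (b, 0), (\<one>\<^bsub>D\<^esub>, 1)} \<subseteq> carrier P"
    and "n = 2 \<Longrightarrow> satisfies_presentation P (gen3 (a, 0) (b, 0) (\<one>\<^bsub>D\<^esub>, 1)) (extension_relators k 2 0 [Gen 0] [Gen 1])"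
proof -
  interpret D: group D by (rule D)
  let ?C = "integer_mod_group n"
  interpret C: group ?C by simp
  have C1: "1 \<in> carrier ?C" using n by simp
  show P: "group P" unfolding P_def by (rule DirProd_group[OF D]) simp
  interpret P: group P by (rule P)
  let ?S = "{(a, 0), (b, 0), (\<one>\<^bsub>D\<^esub>, 1)}"
  show S: "?S \<subseteq> carrier P" using ab C1 by (auto simp: P_def)
  have "(\<lambda>x. (x, 0)) \<in> hom D P" using C.r_one[of 0] by (auto simp: hom_def P_def)
  hence h: "group_hom D P (\<lambda>x. (x, 0))"
    by (intro group_hom.intro[OF D P]) (simp add: group_hom_axioms_def)
  show gen: "generate P ?S = carrier P"
  proof (rule equalityI)
    show "generate P ?S \<subseteq> carrier P" using S by (rule P.generate_incl)
    show "carrier P \<subseteq> generate P ?S"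
    proof
      fix p assume "p \<in> carrier P"
      then obtain x i where p: "p = (x, i)" "x \<in> carrier D" "i \<in> carrier ?C" by (auto simp: P_def)
      have "(\<lambda>x. (x, 0)) ` generate D {a, b} = generate P ((\<lambda>x. (x, 0)) ` {a, b})"
        using ab by (intro group_hom.generate_img[OF h, symmetric]) auto
      hence "(x, 0) \<in> generate P {(a, 0), (b, 0)}" using p(2) ab(3) by auto
      hence x: "(x, 0) \<in> generate P ?S" using P.mono_generate[of "{(a, 0), (b, 0)}" ?S] by auto
      have i: "0 \<le> i" "i < int n" using p(3) n by (auto simp: carrier_integer_mod_group)
      have "(\<one>\<^bsub>D\<^esub>, 1) [^]\<^bsub>P\<^esub> nat i \<in> generate P ?S"
        using S by (intro P.pow_mem_generate) (auto intro: generate.incl)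
      moreover have "(\<one>\<^bsub>D\<^esub>, 1) [^]\<^bsub>P\<^esub> nat i = (\<one>\<^bsub>D\<^esub>, i)"
        unfolding P_def DirProd_nat_pow using i C1 by simp
      ultimately have "(x, 0) \<otimes>\<^bsub>P\<^esub> (\<one>\<^bsub>D\<^esub>, i) \<in> generate P ?S" using x by (auto intro: generate.eng)
      thus "p \<in> generate P ?S" using p i by (simp add: P_def)
    qed
  qed
  show "satisfies_presentation P (gen3 (a, 0) (b, 0) (\<one>\<^bsub>D\<^esub>, 1)) (extension_relators k 2 0 [Gen 0] [Gen 1])" if "n = 2"
  proof (rule P.satisfies_extension)
    show "(a, 0) [^]\<^bsub>P\<^esub> (4::nat) = \<one>\<^bsub>P\<^esub>" "(b, 0) [^]\<^bsub>P\<^esub> (2::nat) = (a, 0) [^]\<^bsub>P\<^esub> k"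
      unfolding P_def DirProd_nat_pow rel(1,2) by simp_all
    show "(\<one>\<^bsub>D\<^esub>, 1) [^]\<^bsub>P\<^esub> (2::nat) = (a, 0) [^]\<^bsub>P\<^esub> (0::nat)"
      unfolding P_def DirProd_nat_pow \<open>n = 2\<close> by simp
    have inv0: "inv\<^bsub>P\<^esub> (x, 0) = (inv\<^bsub>D\<^esub> x, 0)" if "x \<in> carrier D" for x
      using that by (simp add: P_def inv_DirProd[OF D C.is_group])
    show "(b, 0) \<otimes>\<^bsub>P\<^esub> (a, 0) \<otimes>\<^bsub>P\<^esub> inv\<^bsub>P\<^esub> (b, 0) = inv\<^bsub>P\<^esub> (a, 0)"
      using rel(3) ab by (simp add: inv0) (simp add: P_def)
    have c: "(\<one>\<^bsub>D\<^esub>, 1) \<otimes>\<^bsub>P\<^esub> (x, 0) \<otimes>\<^bsub>P\<^esub> inv\<^bsub>P\<^esub> (\<one>\<^bsub>D\<^esub>, 1) = (x, 0)" if x: "(x, 0) \<in> carrier P" for x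
    proof -
      have "(\<one>\<^bsub>D\<^esub>, 1) \<otimes>\<^bsub>P\<^esub> (x, 0) = (x, 0) \<otimes>\<^bsub>P\<^esub> (\<one>\<^bsub>D\<^esub>, 1)"
        using x by (simp add: P_def)
      thus ?thesis using x S by (simp add: P.m_assoc)
    qed
    show "(\<one>\<^bsub>D\<^esub>, 1) \<otimes>\<^bsub>P\<^esub> (a, 0) \<otimes>\<^bsub>P\<^esub> inv\<^bsub>P\<^esub> (\<one>\<^bsub>D\<^esub>, 1) =
        word_value P (gen3 (a, 0) (b, 0) (\<one>\<^bsub>D\<^esub>, 1)) [Gen 0]"
      "(\<one>\<^bsub>D\<^esub>, 1) \<otimes>\<^bsub>P\<^esub> (b, 0) \<otimes>\<^bsub>P\<^esub> inv\<^bsub>P\<^esub> (\<one>\<^bsub>D\<^esub>, 1) =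
        word_value P (gen3 (a, 0) (b, 0) (\<one>\<^bsub>D\<^esub>, 1)) [Gen 1]"
      using c S by simp_all
  qed (use gen S in auto)
qed

section \<open>Centralizers in the alternating groups of degree at most five\<close>

lemma evenperm_two_points:
  assumes p: "p permutes {x, y}" and "evenperm p"
  shows "p = id"
proof -
  have px: "p x \<in> {x, y}" "p y \<in> {x, y}" using permutes_in_image[OF p] by blast+
  have inj: "p x = p y \<longleftrightarrow> x = y" using permutes_inj[OF p] by (auto dest: injD)
  show ?thesis
  proof (cases "p x = x")
    case True
    have "p y = y" using True px inj by auto
    have "p z = z" for z
      using True \<open>p y = y\<close> permutes_not_in[OF p, of z] by (cases "z \<in> {x, y}") auto
    thus ?thesis by (simp add: fun_eq_iff)
  next
    case False
    hence xy: "p x = y" "p y = x" using px inj by auto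
    have "p = Transposition.transpose x y"
      using xy permutes_not_in[OF p] by (auto simp: fun_eq_iff Transposition.transpose_def)
    thus ?thesis using \<open>evenperm p\<close> False xy by (simp add: evenperm_swap)
  qed
qed

lemma evenperm_fixing_one_of_three:
  assumes p: "p permutes T" and T: "card T = 3" and "evenperm p" and x: "x \<in> T" "p x = x"
  shows "p = id"
proof -
  have "card (T - {x}) = 2" using T x by simp
  then obtain y z where yz: "T - {x} = {y, z}" by (auto simp: card_2_iff)
  have "p permutes (T - {x})" by (rule permutes_superset[OF p]) (use x(2) in auto)
  thus ?thesis using evenperm_two_points \<open>evenperm p\<close> yz by simp
qed

lemma oddperm_of_three:
  assumes p: "p permutes T" and T: "card T = 3" and odd: "\<not> evenperm p"
  obtains x where "x \<in> T" "p x = x" "\<And>y. y \<in> T \<Longrightarrow> p y = y \<Longrightarrow> y = x"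
proof -
  have "p \<noteq> id" using odd by auto
  then obtain u where u: "p u \<noteq> u" by (auto simp: fun_eq_iff)
  hence uT: "u \<in> T" "p u \<in> T" using permutes_not_in[OF p] permutes_in_image[OF p] by auto
  have finT: "finite T" using T card.infinite by fastforce
  define q where "q = Transposition.transpose u (p u) \<circ> p"
  have "permutation p" using p finT by (auto simp: permutation_permutes)
  hence "evenperm q"
    unfolding q_def using odd u by (subst evenperm_comp) (auto simp: permutation_swap_id evenperm_swap)
  moreover have "q permutes T"
    unfolding q_def using p permutes_swap_id[OF uT] by (rule permutes_compose)
  moreover have "q u = u" by (simp add: q_def)
  ultimately have "q = id" using evenperm_fixing_one_of_three[OF _ T _ uT(1)] by blast
  hence pq: "p = Transposition.transpose u (p u)"
    unfolding q_def by (metis comp_id swap_id_idempotent o_assoc id_comp)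
  have "card (T - {u, p u}) = 1" using T uT u finT by (simp add: card_Diff_subset)
  then obtain x where x: "T - {u, p u} = {x}" by (rule card_1_singletonE)
  have ppu: "p (p u) = u" using pq by (metis transpose_apply_second)
  show ?thesis
  proof (rule that)
    show "x \<in> T" using x by blast
    show "p x = x" using x pq by (metis DiffD2 insertCI insertI1 transpose_apply_other)
    show "y = x" if "y \<in> T" "p y = y" for y
    proof -
      have "y \<noteq> u" "y \<noteq> p u" using that(2) u ppu by auto
      thus ?thesis using that(1) x by blast
    qed
  qed
qed

text \<open>Commuting nontrivial even permutations of five points have the same fixed points: if \<open>w\<close>
  fixes a point \<open>i\<close> that \<open>v\<close> moves, then \<open>w\<close> also fixes \<open>v i\<close> and must be a three-cycle on the
  remaining points, so that \<open>v\<close> interchanges \<open>i\<close> and \<open>v i\<close>. On the remaining points \<open>v\<close> is then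
  odd, a transposition with a single fixed point, which \<open>w\<close> would have to fix as well.\<close>

lemma commuting_evenperms_fixed_points:
  fixes v w :: "'a \<Rightarrow> 'a"
  assumes A: "card A = 5" and v: "v permutes A" "evenperm v" and w: "w permutes A" "evenperm w"
    and vw: "v \<circ> w = w \<circ> v" and i: "w i = i" "v i \<noteq> i"
  shows "w = id"
proof (rule ccontr)
  assume "w \<noteq> id"
  have finA: "finite A" using A card.infinite by fastforce
  have comm: "v (w x) = w (v x)" for x using vw by (metis comp_apply)
  define j where "j = v i"
  have j: "w j = j" using comm[of i] i(1) by (simp add: j_def)
  have ij: "i \<in> A" "j \<in> A" "i \<noteq> j"
    using i permutes_not_in[OF v(1)] permutes_in_image[OF v(1)] by (auto simp: j_def)
  let ?T = "A - {i, j}"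
  have T: "card ?T = 3" using A ij finA by (simp add: card_Diff_subset)
  have wT: "w permutes ?T" by (rule permutes_superset[OF w(1)]) (use i j in auto)
  have moved: "w x \<noteq> x" if "x \<in> ?T" for x
    using evenperm_fixing_one_of_three[OF wT T w(2) that] \<open>w \<noteq> id\<close> by blast
  have "w (v j) = v j" using comm[of j] j by simp
  moreover have "v j \<in> A" using ij permutes_in_image[OF v(1)] by blast
  moreover have "v j \<noteq> j" using permutes_inj[OF v(1)] ij by (metis injD j_def)
  ultimately have vj: "v j = i" using moved[of "v j"] by blast
  define u where "u = Transposition.transpose i j \<circ> v"
  have ux: "u x = v x" if "x \<in> ?T" for x
  proof -
    have "v x \<noteq> v i" "v x \<noteq> v j" using that permutes_inj[OF v(1)] by (auto dest: injD)
    thus ?thesis using vj by (simp add: u_def j_def)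
  qed
  have uA: "u permutes A" unfolding u_def using v(1) permutes_swap_id[OF ij(1,2)] by (rule permutes_compose)
  have "u i = i" "u j = j" using vj by (simp_all add: u_def flip: j_def)
  hence uT: "u permutes ?T" by (intro permutes_superset[OF uA]) blast
  have "permutation v" using v(1) finA by (auto simp: permutation_permutes)
  hence "\<not> evenperm u"
    unfolding u_def using v(2) ij by (subst evenperm_comp) (auto simp: permutation_swap_id evenperm_swap)
  then obtain x where x: "x \<in> ?T" "u x = x" "\<And>y. y \<in> ?T \<Longrightarrow> u y = y \<Longrightarrow> y = x"
    using oddperm_of_three[OF uT T] by metis
  have "w x \<in> ?T" using permutes_in_image[OF wT] x(1) by blast
  moreover have "u (w x) = w x" using ux[OF \<open>w x \<in> ?T\<close>] ux[OF x(1)] x(2) comm[of x] by simp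
  ultimately show False using x(3) moved[OF x(1)] by blast
qed

text \<open>An element of the centralizer is determined by the image of one point that \<open>v\<close> moves.\<close>

lemma centralizer_alt_group_5:
  assumes v: "v \<in> carrier (alt_group 5)" "v \<noteq> id"
  shows "card (centralizer (alt_group 5) v) \<le> 5"
proof -
  interpret A: group "alt_group 5" by (rule alt_group_is_group)
  obtain i where i: "v i \<noteq> i" using v(2) by (auto simp: fun_eq_iff)
  have vp: "v permutes {1..5}" "evenperm v" using v(1) by (auto simp: alt_group_carrier)
  have iA: "i \<in> {1..5}" using i permutes_not_in[OF vp(1)] by blast
  have "inj_on (\<lambda>w. w i) (centralizer (alt_group 5) v)"
  proof (rule inj_onI)
    fix p q assume pq: "p \<in> centralizer (alt_group 5) v" "q \<in> centralizer (alt_group 5) v" "p i = q i"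
    have c: "p \<in> carrier (alt_group 5)" "q \<in> carrier (alt_group 5)" "p \<circ> v = v \<circ> p" "q \<circ> v = v \<circ> q"
      using pq by (auto simp: centralizer_def alt_group_mult)
    define w where "w = inv' q \<circ> p"
    have bq: "bij q" using c(2) by (auto simp: alt_group_carrier intro: permutes_bij)
    have w: "w \<in> carrier (alt_group 5)"
      using A.m_closed[OF alt_group_inv_closed[OF c(2)] c(1)] by (simp add: w_def alt_group_mult)
    have "inv' q \<circ> v = v \<circ> inv' q"
      using c(4) bq by (metis bij_is_inj bij_is_surj comp_assoc comp_id id_comp inj_iff surj_iff)
    hence "v \<circ> w = w \<circ> v" using c(3) by (metis w_def comp_assoc)
    moreover have "w i = i" using pq(3) bq by (simp add: w_def bij_is_inj)
    ultimately have "w = id"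
      using commuting_evenperms_fixed_points[of "{1..5}" v w i] vp w i by (simp add: alt_group_carrier)
    thus "p = q" using bq unfolding w_def by (metis bij_is_surj comp_assoc comp_id id_comp surj_iff)
  qed
  moreover have "(\<lambda>w. w i) ` centralizer (alt_group 5) v \<subseteq> {1..5}"
    using iA by (auto simp: centralizer_def alt_group_carrier permutes_in_image simp del: atLeastAtMost_iff)
  ultimately have "card (centralizer (alt_group 5) v) \<le> card {1..5::nat}"
    by (intro card_inj_on_le) auto
  thus ?thesis by simp
qed

lemma finite_group_alt_group: "finite_group (alt_group n)"
proof -
  interpret S: finite_group "sym_group n" by (rule finite_group_sym_group)
  interpret A: group "alt_group n" by (rule alt_group_is_group)
  have "carrier (alt_group n) \<subseteq> carrier (sym_group n)" by (auto simp: alt_group_carrier sym_group_carrier)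
  thus ?thesis by unfold_locales (rule S.finite_subset_carrier)
qed

lemma (in finite_group) small_centralizersI:
  assumes "\<And>v. v \<in> carrier G - center G \<Longrightarrow> card (centralizer G v) \<le> 5"
  shows "small_centralizers G"
proof -
  have "0 < card (center G)" using card_subgroup_pos center_subgroup by blast
  thus ?thesis using assms by (fastforce simp: small_centralizers_def)
qed

lemma small_centralizers_alt_group:
  assumes "n \<le> 5" shows "small_centralizers (alt_group n)"
proof -
  interpret A: finite_group "alt_group n" by (rule finite_group_alt_group)
  interpret A5: finite_group "alt_group 5" by (rule finite_group_alt_group)
  have sub: "carrier (alt_group n) \<subseteq> carrier (alt_group 5)"
    using assms permutes_subset[of _ "{1..n}" "{1..5}"] by (auto simp: alt_group_carrier)
  show ?thesis
  proof (rule A.small_centralizersI)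
    fix v assume v: "v \<in> carrier (alt_group n) - center (alt_group n)"
    hence "v \<noteq> id" using A.center_closed(3) by (auto simp: alt_group_one)
    moreover have "centralizer (alt_group n) v \<subseteq> centralizer (alt_group 5) v"
      using sub by (auto simp: centralizer_def alt_group_mult)
    hence "card (centralizer (alt_group n) v) \<le> card (centralizer (alt_group 5) v)"
      using A5.finite_subset_carrier[OF centralizer_subset] by (rule card_mono[rotated])
    ultimately show "card (centralizer (alt_group n) v) \<le> 5"
      using centralizer_alt_group_5[of v] v sub by (meson DiffD1 le_trans subsetD)
  qed
qed

section \<open>The affine group over five elements and the special linear group over three\<close>

lemma UNIV_5: "(UNIV :: 5 set) = {0, 1, 2, 3, 4}"
proof -
  have "distinct [0, 1, 2, 3, 4 :: 5]" by simp
  hence "card {0, 1, 2, 3, 4 :: 5} = 5" by simp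
  thus ?thesis by (intro card_subset_eq[symmetric]) simp_all
qed

lemma all_5: "(\<forall>x::5. P x) \<longleftrightarrow> P 0 \<and> P 1 \<and> P 2 \<and> P 3 \<and> P 4"
  using UNIV_5 by (metis UNIV_I insertE singletonD)

lemma all_3: "(\<forall>x::3. P x) \<longleftrightarrow> P 0 \<and> P 1 \<and> P 2"
  using UNIV_2_3(2) by (metis UNIV_I insertE singletonD)

lemma set_product_3: "set (List.product [0, 1, 2 :: 3] [0, 1, 2 :: 3]) = UNIV"
proof -
  have "set [0, 1, 2 :: 3] = UNIV" by (simp add: UNIV_2_3(2))
  thus ?thesis by (simp only: set_product UNIV_Times_UNIV)
qed

lemma fermat_5: "x \<noteq> 0 \<Longrightarrow> x * x * x * x = 1" for x :: 5
proof -
  have "\<forall>x::5. x \<noteq> 0 \<longrightarrow> x * x * x * x = 1" unfolding all_5 by simp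
  thus "x \<noteq> 0 \<Longrightarrow> x * x * x * x = 1" by blast
qed

lemma mult_eq_0_5: "x * y = 0 \<longleftrightarrow> x = 0 \<or> y = 0" for x y :: 5
proof
  assume xy: "x * y = 0"
  show "x = 0 \<or> y = 0"
  proof (rule ccontr)
    assume "\<not> (x = 0 \<or> y = 0)"
    hence "y = x * x * x * x * y" using fermat_5[of x] by simp
    also have "\<dots> = x * x * x * (x * y)" by (simp only: mult.assoc)
    finally show False using xy \<open>\<not> (x = 0 \<or> y = 0)\<close> by simp
  qed
qed auto

definition affine_map :: "5 \<Rightarrow> 5 \<Rightarrow> 5 \<Rightarrow> 5" where
  "affine_map a b t = a * t + b"

lemma affine_map_comp: "affine_map a b \<circ> affine_map c d = affine_map (a * c) (a * d + b)"
  by (auto simp: affine_map_def fun_eq_iff algebra_simps)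

lemma affine_map_eq_iff: "affine_map a b = affine_map c d \<longleftrightarrow> a = c \<and> b = d"
proof
  assume "affine_map a b = affine_map c d"
  from fun_cong[OF this, of 0] fun_cong[OF this, of 1] show "a = c \<and> b = d" by (simp add: affine_map_def)
qed simp

lemma carrier_GA_1_5: "carrier GA_1_5 = (\<lambda>(a, b). affine_map a b) ` ((UNIV - {0}) \<times> UNIV)"
  by (auto simp: GA_1_5_def affine_map_def fun_eq_iff image_def)

lemma mult_GA_1_5: "f \<otimes>\<^bsub>GA_1_5\<^esub> g = f \<circ> g"
  by (simp add: GA_1_5_def)

lemma one_GA_1_5: "\<one>\<^bsub>GA_1_5\<^esub> = affine_map 1 0"
  by (simp add: GA_1_5_def affine_map_def fun_eq_iff)

lemma order_GA_1_5: "order GA_1_5 = 20"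
proof -
  have "card (carrier GA_1_5) = card ((UNIV - {0 :: 5}) \<times> (UNIV :: 5 set))"
    unfolding carrier_GA_1_5 by (rule card_image) (auto simp: inj_on_def affine_map_eq_iff)
  thus ?thesis by (simp add: order_def card_cartesian_product)
qed

text \<open>An affine map that commutes with \<open>t \<mapsto> a * t + b\<close> is determined by its slope if \<open>a \<noteq> 1\<close>, and by its
  constant term if \<open>a = 1\<close>.\<close>

lemma small_centralizer_group_GA_1_5: "small_centralizer_group GA_1_5"
proof -
  have "group GA_1_5"
  proof (rule groupI)
    fix f assume "f \<in> carrier GA_1_5"
    then obtain a b where f: "f = affine_map a b" "a \<noteq> 0" by (auto simp: carrier_GA_1_5)
    let ?c = "a * a * a"
    have "affine_map ?c (- (?c * b)) \<otimes>\<^bsub>GA_1_5\<^esub> f = \<one>\<^bsub>GA_1_5\<^esub>"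
      using fermat_5[OF f(2)] by (simp add: f(1) mult_GA_1_5 one_GA_1_5 affine_map_comp affine_map_eq_iff)
    moreover have "affine_map ?c (- (?c * b)) \<in> carrier GA_1_5" unfolding carrier_GA_1_5
      using f(2) by (intro image_eqI[of _ _ "(?c, - (?c * b))"]) (simp_all add: mult_eq_0_5)
    ultimately show "\<exists>g\<in>carrier GA_1_5. g \<otimes>\<^bsub>GA_1_5\<^esub> f = \<one>\<^bsub>GA_1_5\<^esub>" by blast
  next
    fix f g assume "f \<in> carrier GA_1_5" "g \<in> carrier GA_1_5"
    then obtain a b c d where "f = affine_map a b" "a \<noteq> 0" "g = affine_map c d" "c \<noteq> 0"
      by (auto simp: carrier_GA_1_5)
    hence "f \<otimes>\<^bsub>GA_1_5\<^esub> g = affine_map (a * c) (a * d + b)" "a * c \<noteq> 0"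
      by (simp_all add: mult_GA_1_5 affine_map_comp mult_eq_0_5)
    thus "f \<otimes>\<^bsub>GA_1_5\<^esub> g \<in> carrier GA_1_5" by (auto simp: carrier_GA_1_5)
  next
    show "\<one>\<^bsub>GA_1_5\<^esub> \<in> carrier GA_1_5" unfolding one_GA_1_5 carrier_GA_1_5
      by (rule image_eqI[of _ _ "(1, 0)"]) simp_all
  qed (auto simp: GA_1_5_def)
  then interpret group GA_1_5 .
  interpret finite_group GA_1_5
    by unfold_locales (simp add: carrier_GA_1_5)
  show ?thesis
  proof
    show "\<not> comm_group GA_1_5"
    proof
      assume "comm_group GA_1_5"
      then interpret C: comm_group GA_1_5 .
      have "affine_map 2 0 \<in> carrier GA_1_5" "affine_map 1 1 \<in> carrier GA_1_5" by (auto simp: carrier_GA_1_5)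
      from C.m_comm[OF this] show False by (simp add: mult_GA_1_5 affine_map_comp affine_map_eq_iff)
    qed
    show "small_centralizers GA_1_5"
    proof (rule small_centralizersI)
      fix v assume v: "v \<in> carrier GA_1_5 - center GA_1_5"
      then obtain a b where ab: "v = affine_map a b" "a \<noteq> 0" by (auto simp: carrier_GA_1_5)
      have n1: "a \<noteq> 1 \<or> b \<noteq> 0" using v ab center_closed(3) by (auto simp: one_GA_1_5)
      have cen: "\<exists>c d. w = affine_map c d \<and> c * b + d = a * d + b" if "w \<in> centralizer GA_1_5 v" for w
        using that by (auto simp: centralizer_def carrier_GA_1_5 mult_GA_1_5 ab(1) affine_map_comp affine_map_eq_iff)
      define f where "f w = (if a = 1 then w 0 else w 1 - w (0::5) :: 5)" for w
      have "inj_on f (centralizer GA_1_5 v)"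
      proof (rule inj_onI)
        fix p q assume pq: "p \<in> centralizer GA_1_5 v" "q \<in> centralizer GA_1_5 v" "f p = f q"
        obtain c d c' d' where p: "p = affine_map c d" "c * b + d = a * d + b"
          and q: "q = affine_map c' d'" "c' * b + d' = a * d' + b" using cen pq by metis
        show "p = q"
        proof (cases "a = 1")
          case True
          hence "(c - 1) * b = 0" "(c' - 1) * b = 0" using p q by (simp_all add: algebra_simps)
          hence "c = 1" "c' = 1" using n1 True by (simp_all add: mult_eq_0_5)
          thus ?thesis using pq(3) True by (simp add: f_def p q affine_map_def)
        next
          case False
          hence "c = c'" using pq(3) by (simp add: f_def p q affine_map_def)
          have "d - a * d = b - c * b" "d' - a * d' = b - c' * b"
            using p(2) q(2) by (simp_all add: algebra_simps)
          hence "d - a * d = d' - a * d'" using \<open>c = c'\<close> by simp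
          hence "(a - 1) * (d - d') = 0" by (simp add: algebra_simps)
          thus ?thesis using False \<open>c = c'\<close> by (simp add: p q mult_eq_0_5)
        qed
      qed
      hence "card (centralizer GA_1_5 v) \<le> card (UNIV :: 5 set)" by (rule card_inj_on_le) auto
      thus "card (centralizer GA_1_5 v) \<le> 5" by simp
    qed
  qed
qed

lemma mult_SL_2_3: "A \<otimes>\<^bsub>SL_2_3\<^esub> B = A ** B"
  by (simp add: SL_2_3_def)

lemma matrix_2_eq_iff: "A = B \<longleftrightarrow> A$1$1 = B$1$1 \<and> A$1$2 = B$1$2 \<and> A$2$1 = B$2$1 \<and> A$2$2 = B$2$2"
  for A B :: "'a^2^2"
  by (auto simp: vec_eq_iff forall_2)

lemma matrix_mult_2: "(A ** B)$i$j = A$i$1 * B$1$j + A$i$2 * B$2$j" for A B :: "'a::comm_ring_1^2^2"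
  by (simp add: matrix_matrix_mult_def sum_2)

definition matrix_2 :: "'a \<Rightarrow> 'a \<Rightarrow> 'a \<Rightarrow> 'a \<Rightarrow> 'a^2^2" where
  "matrix_2 a b c d = (\<chi> i j. if i = 1 then if j = 1 then a else b else if j = 1 then c else d)"

lemma matrix_2_simps [simp]:
  "matrix_2 a b c d $ 1 $ 1 = a" "matrix_2 a b c d $ 1 $ 2 = b"
  "matrix_2 a b c d $ 2 $ 1 = c" "matrix_2 a b c d $ 2 $ 2 = d"
  by (simp_all add: matrix_2_def)

lemma mat_1_2: "(mat 1 :: 'a::comm_ring_1^2^2) = matrix_2 1 0 0 1"
  by (simp add: matrix_2_eq_iff mat_def)

lemma order_SL_2_3: "order SL_2_3 = 24"
proof -
  let ?l = "List.product [0, 1, 2 :: 3] [0, 1, 2 :: 3]"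
  let ?P = "\<lambda>((a, b), (c, d)). a * d - b * c = (1 :: 3)"
  have "bij_betw (\<lambda>A. ((A$1$1, A$1$2), (A$2$1, A$2$2))) (carrier SL_2_3) {q. ?P q}"
    by (rule bij_betwI[where g = "\<lambda>((a, b), (c, d)). matrix_2 a b c d"])
      (auto simp: SL_2_3_def det_2 matrix_2_eq_iff)
  hence "order SL_2_3 = card {q. ?P q}" unfolding order_def by (rule bij_betw_same_card)
  also have "{q. ?P q} = set (filter ?P (List.product ?l ?l))"
    by (simp only: set_filter set_product[of ?l] set_product_3 UNIV_Times_UNIV UNIV_I simp_thms)
  also have "card \<dots> = length (filter ?P (List.product ?l ?l))"
    by (intro distinct_card distinct_filter distinct_product) simp_all
  also have "\<dots> = 24" by simp
  finally show ?thesis .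
qed

text \<open>The number of solutions of the equation that remains of \<open>det W = 1\<close> once two entries of a
  matrix \<open>W\<close> commuting with a given one have been eliminated.\<close>

lemma card_determinant_solutions:
  fixes b c s :: 3
  assumes "b \<noteq> 0"
  shows "card {(f, h). h * h + b * f * h * s - b * c * f * f = 1} \<le> 6"
proof -
  let ?P = "\<lambda>b s c (f, h). h * h + b * f * h * s - b * c * f * f = (1 :: 3)"
  let ?l = "List.product [0, 1, 2 :: 3] [0, 1, 2 :: 3]"
  have "\<forall>b s c. b \<noteq> 0 \<longrightarrow> length (filter (?P b s c) ?l) \<le> 6"
    by (simp add: all_3)
  hence len: "length (filter (?P b s c) ?l) \<le> 6" using assms by blast
  have sol: "{q. ?P b s c q} = set (filter (?P b s c) ?l)"
    by (simp only: set_filter set_product_3 UNIV_I simp_thms)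
  have "card {q. ?P b s c q} \<le> 6" unfolding sol by (rule le_trans[OF card_length len])
  thus ?thesis by (simp add: case_prod_unfold)
qed

lemma square_3: "b \<noteq> 0 \<Longrightarrow> b * b = 1" and inverse_3: "a * d = 1 \<Longrightarrow> a = d" for a b d :: 3
proof -
  have "\<forall>b::3. b \<noteq> 0 \<longrightarrow> b * b = 1" "\<forall>a d :: 3. a * d = 1 \<longrightarrow> a = d" by (simp_all add: all_3)
  thus "b \<noteq> 0 \<Longrightarrow> b * b = 1" "a * d = 1 \<Longrightarrow> a = d" by blast+
qed

text \<open>A noncentral matrix \<open>A\<close> has a nonzero entry off the diagonal. Then two entries of a matrix commuting
  with \<open>A\<close> determine the other two, and the determinant leaves at most six possibilities.\<close>

lemma small_centralizer_group_SL_2_3: "small_centralizer_group SL_2_3"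
proof -
  let ?S = "SL_2_3"
  have carrier: "A \<in> carrier ?S \<longleftrightarrow> A$1$1 * A$2$2 - A$1$2 * A$2$1 = 1" for A
    by (simp add: SL_2_3_def det_2)
  have one: "\<one>\<^bsub>?S\<^esub> = mat 1" by (simp add: SL_2_3_def)
  have "group ?S"
  proof (rule groupI)
    fix A assume A: "A \<in> carrier ?S"
    let ?B = "matrix_2 (A$2$2) (- A$1$2) (- A$2$1) (A$1$1)"
    have "?B ** A = mat 1" using A
      by (simp add: matrix_2_eq_iff matrix_mult_2 carrier mat_1_2 algebra_simps)
    moreover have "?B \<in> carrier ?S" using A by (simp add: carrier algebra_simps)
    ultimately show "\<exists>B\<in>carrier ?S. B \<otimes>\<^bsub>?S\<^esub> A = \<one>\<^bsub>?S\<^esub>" by (auto simp: mult_SL_2_3 one)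
  next
    fix A B assume "A \<in> carrier ?S" "B \<in> carrier ?S"
    thus "A \<otimes>\<^bsub>?S\<^esub> B \<in> carrier ?S" by (simp add: SL_2_3_def det_mul)
  qed (simp_all add: mult_SL_2_3 one matrix_mul_assoc, simp add: SL_2_3_def)
  then interpret group ?S .
  interpret finite_group ?S
    by unfold_locales (simp add: order_SL_2_3 card_ge_0_finite flip: order_def)
  have two: "2 \<le> card (center ?S)"
  proof -
    have "{mat 1, matrix_2 (-1) 0 0 (-1)} \<subseteq> center ?S"
      by (auto simp: center_def carrier mult_SL_2_3 matrix_2_eq_iff matrix_mult_2 mat_1_2)
    moreover have "mat 1 \<noteq> (matrix_2 (-1) 0 0 (-1) :: 3^2^2)" by (simp add: mat_1_2 matrix_2_eq_iff)
    hence "card {mat 1, matrix_2 (-1) 0 0 (-1) :: 3^2^2} = 2" by simp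
    ultimately show ?thesis using card_mono[OF finite_subset_carrier[OF center_subset]] by metis
  qed
  have six: "card (centralizer ?S A) \<le> 6" if A: "A \<in> carrier ?S - center ?S" for A
  proof -
    define a b c d where "a = A$1$1" and "b = A$1$2" and "c = A$2$1" and "d = A$2$2"
    note abcd = this
    have bc: "b \<noteq> 0 \<or> c \<noteq> 0"
    proof (rule ccontr)
      assume bc: "\<not> (b \<noteq> 0 \<or> c \<noteq> 0)"
      hence "a * d = 1" using A by (simp add: carrier abcd)
      hence "a = d" by (rule inverse_3)
      hence "A \<in> center ?S" using A bc
        by (auto simp: center_def mult_SL_2_3 matrix_2_eq_iff matrix_mult_2 abcd algebra_simps)
      thus False using A by blast
    qed
    have W: "b * W$2$1 = W$1$2 * c" "a * W$1$2 + b * W$2$2 = W$1$1 * b + W$1$2 * d"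
      "c * W$1$1 + d * W$2$1 = W$2$1 * a + W$2$2 * c" "W$1$1 * W$2$2 - W$1$2 * W$2$1 = 1"
      if "W \<in> centralizer ?S A" for W
    proof -
      have W: "W \<in> carrier ?S" "W ** A = A ** W" using that by (auto simp: centralizer_def mult_SL_2_3)
      have e: "(W ** A)$i$j = (A ** W)$i$j" for i j by (simp only: W(2))
      show "b * W$2$1 = W$1$2 * c"
        using e[of 1 1] by (simp add: matrix_mult_2 mult.commute flip: abcd)
      show "a * W$1$2 + b * W$2$2 = W$1$1 * b + W$1$2 * d"
        using e[of 1 2] by (simp add: matrix_mult_2 flip: abcd)
      show "c * W$1$1 + d * W$2$1 = W$2$1 * a + W$2$2 * c"
        using e[of 2 1] by (simp add: matrix_mult_2 flip: abcd)
      show "W$1$1 * W$2$2 - W$1$2 * W$2$1 = 1" using W(1) by (simp add: carrier)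
    qed
    show ?thesis
    proof (cases "b = 0")
      case False
      have bb: "b * b = 1" using square_3[OF False] .
      have e: "W$2$1 = b * W$1$2 * c" "W$1$1 = W$2$2 + b * W$1$2 * (a - d)" if "W \<in> centralizer ?S A" for W
      proof -
        have "W$2$1 = b * (b * W$2$1)" using bb by (simp flip: mult.assoc)
        thus "W$2$1 = b * W$1$2 * c" using W(1)[OF that] by (simp add: mult.assoc)
        have "W$1$1 = b * (W$1$1 * b)" using bb by (simp add: mult.assoc mult.left_commute[of b])
        also have "W$1$1 * b = b * W$2$2 + W$1$2 * (a - d)" using W(2)[OF that] by (simp add: algebra_simps)
        also have "b * (b * W$2$2 + W$1$2 * (a - d)) = W$2$2 + b * W$1$2 * (a - d)"
          using bb by (simp add: distrib_left flip: mult.assoc)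
        finally show "W$1$1 = W$2$2 + b * W$1$2 * (a - d)" .
      qed
      let ?f = "\<lambda>W. (W$1$2, W$2$2) :: 3 \<times> 3"
      have "inj_on ?f (centralizer ?S A)"
        using e by (intro inj_onI) (auto simp: matrix_2_eq_iff)
      moreover have "?f ` centralizer ?S A \<subseteq> {(f, h). h * h + b * f * h * (a - d) - b * c * f * f = 1}"
        using W(4) e by (auto simp: algebra_simps)
      ultimately show ?thesis
        using card_inj_on_le[of ?f "centralizer ?S A"] card_determinant_solutions[OF False, of "a - d" c]
        by (meson finite_code le_trans)
    next
      case True
      hence c0: "c \<noteq> 0" using bc by simp
      have cc: "c * c = 1" using square_3[OF c0] .
      have e: "W$1$2 = c * W$2$1 * b" "W$1$1 = W$2$2 + c * W$2$1 * (a - d)" if "W \<in> centralizer ?S A" for W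
      proof -
        have "W$1$2 = c * (W$1$2 * c)" using cc by (simp add: mult.left_commute[of c])
        also have "\<dots> = c * (b * W$2$1)" using W(1)[OF that] by simp
        finally show "W$1$2 = c * W$2$1 * b" by (simp only: ac_simps)
        have "W$1$1 = c * (c * W$1$1)" using cc by (simp flip: mult.assoc)
        also have "c * W$1$1 = c * W$2$2 + W$2$1 * (a - d)" using W(3)[OF that] by (simp add: algebra_simps)
        also have "c * (c * W$2$2 + W$2$1 * (a - d)) = W$2$2 + c * W$2$1 * (a - d)"
          using cc by (simp add: distrib_left flip: mult.assoc)
        finally show "W$1$1 = W$2$2 + c * W$2$1 * (a - d)" .
      qed
      let ?f = "\<lambda>W. (W$2$1, W$2$2) :: 3 \<times> 3"
      have "inj_on ?f (centralizer ?S A)"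
        using e by (intro inj_onI) (auto simp: matrix_2_eq_iff)
      moreover have "?f ` centralizer ?S A \<subseteq> {(f, h). h * h + c * f * h * (a - d) - c * b * f * f = 1}"
        using W(4) e by (auto simp: algebra_simps)
      ultimately show ?thesis
        using card_inj_on_le[of ?f "centralizer ?S A"] card_determinant_solutions[OF c0, of "a - d" b]
        by (meson finite_code le_trans)
    qed
  qed
  show ?thesis
  proof
    show "\<not> comm_group ?S"
    proof
      assume "comm_group ?S"
      then interpret C: comm_group ?S .
      have "matrix_2 1 1 0 1 \<in> carrier ?S" "matrix_2 1 0 1 1 \<in> carrier ?S" by (simp_all add: carrier)
      from C.m_comm[OF this] show False by (simp add: mult_SL_2_3 matrix_2_eq_iff matrix_mult_2)
    qed
    show "small_centralizers ?S" using six two by (fastforce simp: small_centralizers_def)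
  qed
qed

section \<open>The central product of the dihedral group of order eight and the cyclic group of order four\<close>

lemma (in group) normal_of_central_involution:
  assumes z: "z \<in> carrier G" "z \<otimes> z = \<one>" and central: "\<And>g. g \<in> carrier G \<Longrightarrow> z \<otimes> g = g \<otimes> z"
  shows "{\<one>, z} \<lhd> G"
proof (rule normalI)
  show "subgroup {\<one>, z} G"
    using z by (intro subgroupI) (auto simp: inv_equality)
  show "\<forall>x\<in>carrier G. {\<one>, z} #> x = x <# {\<one>, z}"
    using central by (simp add: r_coset_def l_coset_def)
qed

lemma D8_central_product_C4_presentation:
  shows "group D8_central_product_C4" and "order D8_central_product_C4 = 16"
    and "\<exists>f. satisfies_presentation D8_central_product_C4 f (extension_relators 0 2 2 [Gen 0] [Gen 1])"
proof -
  let ?D = "dihedral_group 4" and ?C = "integer_mod_group 4"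
  let ?P = "?D \<times>\<times> ?C"
  let ?N = "{((0, 0), 0), ((2, 0), 2)} :: ((int \<times> int) \<times> int) set"
  let ?a = "((1, 0), 0) :: (int \<times> int) \<times> int" and ?b = "((0, 1), 0) :: (int \<times> int) \<times> int"
    and ?c = "((0, 0), 1) :: (int \<times> int) \<times> int"
  have D: "group ?D" unfolding dihedral_group_def by (rule group_inversion_semidirect) simp
  note r = inversion_semidirect_relations[of 4 2, folded dihedral_group_def, simplified]
  have one: "\<one>\<^bsub>?D\<^esub> = (0, 0)" by (simp add: dihedral_group_def one_inversion_semidirect)
  have r2: "(0, 1) [^]\<^bsub>?D\<^esub> (2::nat) = (1, 0) [^]\<^bsub>?D\<^esub> (0::nat)" using r(5) by simp
  note P = DirProd_cyclic_presentation[OF D r(1-4) r2 r(6), of 4, unfolded one, simplified]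
  interpret P: group ?P by (rule P(1))
  have mult: "(x, k) \<otimes>\<^bsub>?D\<^esub> (y, l) = ((x + (if even k then y else - y)) mod 4, (k + l) mod 2)"
    if "y \<in> {0..<4}" for x k y l
    using mult_inversion_semidirect[where n = 4 and m = 2] that by (simp add: dihedral_group_def)
  have carrier: "carrier ?P = ({0..<4} \<times> {0..<2}) \<times> {0..<4}"
    by (simp add: dihedral_group_def carrier_inversion_semidirect carrier_integer_mod_group)
  have z: "((2, 0), 2) \<in> carrier ?P" unfolding carrier by simp
  have N: "?N \<lhd> ?P"
  proof -
    have "((2, 0), 2) \<otimes>\<^bsub>?P\<^esub> g = g \<otimes>\<^bsub>?P\<^esub> ((2, 0), 2)" if g: "g \<in> carrier ?P" for g
    proof -
      obtain y l j where g': "g = ((y, l), j)" "y \<in> {0..<4}" using g carrier by auto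
      have "(2 + y) mod 4 = (y + (if even l then 2 else - 2)) mod 4"
        using mod_add_self2[of "y - 2" 4] by (simp add: algebra_simps)
      moreover have "(2 :: int) \<in> {0..<4}" by simp
      ultimately show ?thesis
        unfolding g'(1) mult_DirProd mult[OF g'(2)] mult[OF \<open>(2 :: int) \<in> {0..<4}\<close>] by (simp add: add.commute)
    qed
    moreover have "((2, 0), 2) \<otimes>\<^bsub>?P\<^esub> ((2, 0), 2) = \<one>\<^bsub>?P\<^esub>"
      by (simp add: mult one)
    ultimately have "{\<one>\<^bsub>?P\<^esub>, ((2, 0), 2)} \<lhd> ?P" using z by (intro P.normal_of_central_involution)
    thus ?thesis by (simp add: one)
  qed
  interpret N: normal ?N ?P by (rule N)
  let ?H = "D8_central_product_C4"
  let ?q = "\<lambda>x. ?N #>\<^bsub>?P\<^esub> x"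
  have H: "?H = ?P Mod ?N" by (simp add: D8_central_product_C4_def)
  show gH: "group ?H" unfolding H by (rule N.factorgroup_is_group)
  interpret H: group ?H by (rule gH)
  have q: "group_hom ?P ?H ?q"
    unfolding H using N.factorgroup_is_group N.r_coset_hom_Mod
    by (intro group_hom.intro) (auto simp: group_hom_axioms_def P.is_group)
  have onto: "?q ` carrier ?P = carrier ?H" by (auto simp: H FactGroup_def RCOSETS_def)
  have "card (rcosets\<^bsub>?P\<^esub> ?N) * card ?N = order ?P" using P.lagrange[OF N.is_subgroup] .
  moreover have "card ?N = 2" by simp
  moreover have "order ?P = 32" by (simp add: order_def carrier card_cartesian_product del: carrier_DirProd)
  ultimately show "order ?H = 16" by (simp add: H order_def FactGroup_def)
  have S: "?a \<in> carrier ?P" "?b \<in> carrier ?P" "?c \<in> carrier ?P" unfolding carrier by simp_all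
  have pow: "?q x [^]\<^bsub>?H\<^esub> (n::nat) = ?q (x [^]\<^bsub>?P\<^esub> n)" if "x \<in> carrier ?P" for x n
    using group_hom.hom_nat_pow[OF q that] by simp
  have conj: "?q x \<otimes>\<^bsub>?H\<^esub> ?q y \<otimes>\<^bsub>?H\<^esub> inv\<^bsub>?H\<^esub> ?q x = ?q w"
    if xyw: "x \<in> carrier ?P" "y \<in> carrier ?P" "w \<in> carrier ?P" "x \<otimes>\<^bsub>?P\<^esub> y = w \<otimes>\<^bsub>?P\<^esub> x" for x y w
  proof -
    have qc: "?q x \<in> carrier ?H" "?q w \<in> carrier ?H" using onto xyw(1,3) by blast+
    have "?q x \<otimes>\<^bsub>?H\<^esub> ?q y = ?q w \<otimes>\<^bsub>?H\<^esub> ?q x"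
      using group_hom.hom_mult[OF q] xyw by metis
    thus ?thesis using qc by (simp add: H.m_assoc)
  qed
  have "satisfies_presentation ?H (gen3 (?q ?a) (?q ?b) (?q ?c)) (extension_relators 0 2 2 [Gen 0] [Gen 1])"
  proof (rule H.satisfies_extension)
    show qa: "?q ?a \<in> carrier ?H" and qb: "?q ?b \<in> carrier ?H" and "?q ?c \<in> carrier ?H"
      using onto S by blast+
    have "?q ` generate ?P {?a, ?b, ?c} = generate ?H (?q ` {?a, ?b, ?c})"
      using S by (intro group_hom.generate_img[OF q, symmetric]) auto
    thus "generate ?H {?q ?a, ?q ?b, ?q ?c} = carrier ?H" using P(2) onto by simp
    have q1: "?q \<one>\<^bsub>?P\<^esub> = \<one>\<^bsub>?H\<^esub>" by (rule group_hom.hom_one[OF q])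
    have "?a [^]\<^bsub>?P\<^esub> (4::nat) = \<one>\<^bsub>?P\<^esub>" "?b [^]\<^bsub>?P\<^esub> (2::nat) = \<one>\<^bsub>?P\<^esub>"
      unfolding DirProd_nat_pow r(4,5) by simp_all
    thus "?q ?a [^]\<^bsub>?H\<^esub> (4::nat) = \<one>\<^bsub>?H\<^esub>" "?q ?b [^]\<^bsub>?H\<^esub> (2::nat) = ?q ?a [^]\<^bsub>?H\<^esub> (0::nat)"
      using pow S q1 by simp_all
    have "((3, 0), 0) \<in> carrier ?P" unfolding carrier by simp
    hence "?q ?b \<otimes>\<^bsub>?H\<^esub> ?q ?a \<otimes>\<^bsub>?H\<^esub> inv\<^bsub>?H\<^esub> ?q ?b = ?q ((3, 0), 0)"
      using S by (intro conj) (simp_all add: mult)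
    also have "\<dots> = inv\<^bsub>?H\<^esub> ?q ?a"
    proof (rule H.inv_equality[symmetric])
      have "((3, 0), 0) \<otimes>\<^bsub>?P\<^esub> ?a = \<one>\<^bsub>?P\<^esub>" by (simp add: mult one)
      thus "?q ((3, 0), 0) \<otimes>\<^bsub>?H\<^esub> ?q ?a = \<one>\<^bsub>?H\<^esub>"
        using group_hom.hom_mult[OF q \<open>((3, 0), 0) \<in> carrier ?P\<close> S(1)] q1 by simp
      show "?q ((3, 0), 0) \<in> carrier ?H" using onto \<open>((3, 0), 0) \<in> carrier ?P\<close> by blast
    qed (rule qa)
    finally show "?q ?b \<otimes>\<^bsub>?H\<^esub> ?q ?a \<otimes>\<^bsub>?H\<^esub> inv\<^bsub>?H\<^esub> ?q ?b = inv\<^bsub>?H\<^esub> ?q ?a" .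
    have c2: "?c [^]\<^bsub>?P\<^esub> (2::nat) = ((0, 0), 2)" "?a [^]\<^bsub>?P\<^esub> (2::nat) = ((2, 0), 0)"
      by (simp_all add: numeral_2_eq_2 mult one)
    have c2c: "((2, 0), 0) \<in> carrier ?P" unfolding carrier by simp
    have "((0, 0), 2) \<in> ?N #>\<^bsub>?P\<^esub> ((2, 0), 0)"
      by (auto simp: r_coset_def mult)
    hence "?q ((2, 0), 0) = ?q ((0, 0), 2)"
      using c2c by (intro P.repr_independence[OF _ _ N.is_subgroup])
    thus "?q ?c [^]\<^bsub>?H\<^esub> (2::nat) = ?q ?a [^]\<^bsub>?H\<^esub> (2::nat)" using pow S c2 by simp
    show "?q ?c \<otimes>\<^bsub>?H\<^esub> ?q ?a \<otimes>\<^bsub>?H\<^esub> inv\<^bsub>?H\<^esub> ?q ?c = word_value ?H (gen3 (?q ?a) (?q ?b) (?q ?c)) [Gen 0]"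
      using S qa by (subst conj[of _ _ ?a]) (simp_all add: mult)
    show "?q ?c \<otimes>\<^bsub>?H\<^esub> ?q ?b \<otimes>\<^bsub>?H\<^esub> inv\<^bsub>?H\<^esub> ?q ?c = word_value ?H (gen3 (?q ?a) (?q ?b) (?q ?c)) [Gen 1]"
      using S qb by (subst conj[of _ _ ?b]) (simp_all add: mult)
  qed
  thus "\<exists>f. satisfies_presentation ?H f (extension_relators 0 2 2 [Gen 0] [Gen 1])" by blast
qed

section \<open>Small centralizers from a large center\<close>

context finite_group
begin

text \<open>A proper centralizer contains at most half of the elements.\<close>

lemma small_centralizers_of_order:
  assumes "order G \<le> 2 * card (center G) + 8"
  shows "small_centralizers G"
  unfolding small_centralizers_def using noncentral_centralizer(2) assms by fastforce

text \<open>The centralizer of \<open>g\<close> is a subgroup that contains the generators.\<close>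

lemma mem_center_of_generators:
  assumes S: "S \<subseteq> carrier G" "generate G S = carrier G" and g: "g \<in> carrier G"
    and comm: "\<And>s. s \<in> S \<Longrightarrow> g \<otimes> s = s \<otimes> g"
  shows "g \<in> center G"
proof -
  have "S \<subseteq> centralizer G g" using S(1) comm by (auto simp: centralizer_def)
  hence "carrier G \<subseteq> centralizer G g"
    using generate_subgroup_incl[OF _ centralizer_subgroup[OF g], of S] S(2) by simp
  hence "g \<otimes> w = w \<otimes> g" if "w \<in> carrier G" for w
    using that by (auto simp: centralizer_def)
  thus ?thesis using g unfolding center_def by blast
qed

text \<open>Adjoining first \<open>a\<close> and then \<open>b\<close> to the center at most doubles the order in each step.\<close>

lemma order_le_4_center:
  assumes ab: "a \<in> carrier G" "b \<in> carrier G" "a \<otimes> a \<in> center G" "b \<otimes> b \<in> center G"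
    and conj: "b \<otimes> a \<otimes> inv b \<in> generate G (insert a (center G))"
    and gen: "carrier G \<subseteq> generate G (insert b (insert a (center G)))"
  shows "order G \<le> 4 * card (center G)"
proof -
  have Z: "generate G (center G) = center G"
    using generate_subgroup_incl[OF subset_refl center_subgroup] by (auto intro: generate.incl)
  have fixZ: "g \<otimes> z \<otimes> inv g = z" if "g \<in> carrier G" "z \<in> center G" for g z
    using that conj_eq_iff[of g z z] centerD[of z] by simp
  have 1: "finite (generate G (insert a (center G)))"
    "card (generate G (insert a (center G))) \<le> 2 * card (center G)"
    using generate_cyclic_extension[OF center_subset ab(1), of 2] fixZ ab Z finite_subset_carrier[OF center_subset]
    by (simp_all add: pow_2)
  have sub: "insert a (center G) \<subseteq> carrier G" using ab(1) center_subset[of G] by auto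
  have "b \<otimes> s \<otimes> inv b \<in> generate G (insert a (center G))" if "s \<in> insert a (center G)" for s
    using that conj fixZ[OF ab(2)] by (auto intro: generate.incl)
  moreover have "b [^] (2::nat) \<in> generate G (insert a (center G))"
    using ab by (simp add: pow_2 generate.incl)
  ultimately have "card (generate G (insert b (insert a (center G)))) \<le> 2 * card (generate G (insert a (center G)))"
    using generate_cyclic_extension(2)[OF sub ab(2), of 2] 1(1) by simp
  moreover have "generate G (insert b (insert a (center G))) = carrier G"
    using gen generate_incl[of "insert b (insert a (center G))"] sub ab(2) by (intro equalityI) auto
  ultimately show ?thesis using 1(2) by (simp add: order_def)
qed

lemma inverted_square_commutes:
  assumes "a \<in> carrier G" "b \<in> carrier G" "a [^] (4::nat) = \<one>" "b \<otimes> a \<otimes> inv b = inv a"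
  shows "(a \<otimes> a) \<otimes> b = b \<otimes> (a \<otimes> a)"
proof -
  have "(a \<otimes> a) \<otimes> (a \<otimes> a) = \<one>" using assms(1,3) by (simp add: numeral_eq_Suc m_assoc)
  hence "inv (a \<otimes> a) = a \<otimes> a" using assms(1) by (intro inv_equality) simp_all
  moreover have "b \<otimes> (a \<otimes> a) \<otimes> inv b = inv (a \<otimes> a)"
    using conj_mult[OF assms(2,1,1)] assms by (simp add: inv_mult_group)
  ultimately show ?thesis using conj_eq_iff[of b "a \<otimes> a" "a \<otimes> a"] assms by simp
qed

lemma order_le_4_center_extension:
  assumes f: "satisfies_presentation G f (extension_relators k 2 l [Gen 0] [Gen 1])" and k: "k = 0 \<or> k = 2"
  shows "order G \<le> 4 * card (center G)"
proof -
  note r = satisfies_extensionD[OF f]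
  let ?a = "f 0" and ?b = "f 1" and ?c = "f 2"
  have S: "{?a, ?b, ?c} \<subseteq> carrier G" using r by auto
  have "?c \<otimes> ?a = ?a \<otimes> ?c" "?c \<otimes> ?b = ?b \<otimes> ?c"
    using r(1-3,9,10) conj_eq_iff[of ?c ?a ?a] conj_eq_iff[of ?c ?b ?b] by simp_all
  note c = this
  have cZ: "?c \<in> center G" using c by (intro mem_center_of_generators[OF S r(4) r(3)]) auto
  have aZ: "?a \<otimes> ?a \<in> center G"
  proof (rule mem_center_of_generators[OF S r(4)])
    fix s assume "s \<in> {?a, ?b, ?c}"
    then consider "s = ?a" | "s = ?b" | "s = ?c" by blast
    thus "?a \<otimes> ?a \<otimes> s = s \<otimes> (?a \<otimes> ?a)"
    proof cases
      case 1 thus ?thesis using r by (simp add: m_assoc)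
    next
      case 2 thus ?thesis using inverted_square_commutes[OF r(1,2,5,7)] by simp
    next
      case 3 thus ?thesis using centerD(2)[OF cZ, of "?a \<otimes> ?a"] r by simp
    qed
  qed (use r in simp)
  show ?thesis
  proof (rule order_le_4_center[OF r(1,2) aZ])
    show "?b \<otimes> ?b \<in> center G" using r(1,2,6) k aZ center_closed(3) by (auto simp: pow_2)
    show "?b \<otimes> ?a \<otimes> inv ?b \<in> generate G (insert ?a (center G))"
      unfolding r(7) by (rule generate.inv) simp
    show "carrier G \<subseteq> generate G (insert ?b (insert ?a (center G)))"
      unfolding r(4)[symmetric] using cZ by (intro mono_generate) auto
  qed
qed

lemma order_le_4_center_central_commutator:
  assumes f: "satisfies_presentation G f central_commutator_relators"
  shows "order G \<le> 4 * card (center G)"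
proof -
  note r = satisfies_central_commutatorD[OF f]
  let ?a = "f 0" and ?b = "f 1" and ?c = "f 2"
  have S: "{?a, ?b, ?c} \<subseteq> carrier G" using r by auto
  have bZ: "?b \<in> center G" using r(8,9) by (intro mem_center_of_generators[OF S r(4) r(2)]) auto
  have bb: "?b \<otimes> ?b = \<one>" "?c \<otimes> ?c = \<one>" using r by (simp_all add: pow_2)
  have "?c \<otimes> (?a \<otimes> ?a) \<otimes> inv ?c = (?b \<otimes> ?a) \<otimes> (?b \<otimes> ?a)"
    using conj_mult[OF r(3,1,1)] r(8,10) by simp
  also have "\<dots> = ?a \<otimes> ?a" using center_square_mult[OF bZ r(1)] bb r by simp
  finally have ca: "?c \<otimes> (?a \<otimes> ?a) = (?a \<otimes> ?a) \<otimes> ?c" using conj_eq_iff r by simp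
  have aZ: "?a \<otimes> ?a \<in> center G"
  proof (rule mem_center_of_generators[OF S r(4)])
    fix s assume "s \<in> {?a, ?b, ?c}"
    then consider "s = ?a" | "s = ?b" | "s = ?c" by blast
    thus "?a \<otimes> ?a \<otimes> s = s \<otimes> (?a \<otimes> ?a)"
    proof cases
      case 1 thus ?thesis using r by (simp add: m_assoc)
    next
      case 2 thus ?thesis using centerD(2)[OF bZ, of "?a \<otimes> ?a"] r by simp
    next
      case 3 thus ?thesis using ca by simp
    qed
  qed (use r in simp)
  show ?thesis
  proof (rule order_le_4_center[OF r(1,3) aZ])
    show "?c \<otimes> ?c \<in> center G" using bb center_closed by simp
    show "?c \<otimes> ?a \<otimes> inv ?c \<in> generate G (insert ?a (center G))"
      unfolding r(10) using bZ by (intro generate.eng generate.incl) auto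
    show "carrier G \<subseteq> generate G (insert ?c (insert ?a (center G)))"
      unfolding r(4)[symmetric] using bZ by (intro mono_generate) auto
  qed
qed

lemma order_le_4_center_metacyclic:
  assumes f: "satisfies_presentation G f (metacyclic_relators n m 0 w)"
    and w: "(n, m, w) = (4, 4, [Inv 0]) \<or> (n, m, w) = (8, 2, replicate 5 (Gen 0))"
  shows "order G \<le> 4 * card (center G)"
proof -
  note r = satisfies_metacyclicD[OF f]
  let ?a = "f 0" and ?b = "f 1"
  have S: "{?a, ?b} \<subseteq> carrier G" using r by auto
  have "?b \<otimes> (?a \<otimes> ?a) = (?a \<otimes> ?a) \<otimes> ?b \<and> (?b \<otimes> ?b) \<otimes> ?a = ?a \<otimes> (?b \<otimes> ?b)"
    using w
  proof
    assume *: "(n, m, w) = (4, 4, [Inv 0])"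
    hence conj: "?b \<otimes> ?a \<otimes> inv ?b = inv ?a" using r by simp
    have "(?b \<otimes> ?b) \<otimes> ?a \<otimes> inv (?b \<otimes> ?b) = ?b \<otimes> (?b \<otimes> ?a \<otimes> inv ?b) \<otimes> inv ?b"
      using r(1,2) by (simp add: inv_mult_group m_assoc)
    also have "\<dots> = ?a" using conj conj_inv[OF r(2,1)] r(1) by simp
    finally have "(?b \<otimes> ?b) \<otimes> ?a = ?a \<otimes> (?b \<otimes> ?b)" using conj_eq_iff[of "?b \<otimes> ?b" ?a ?a] r(1,2) by simp
    thus ?thesis using inverted_square_commutes[OF r(1,2) _ conj] r(4) * by simp
  next
    assume *: "(n, m, w) = (8, 2, replicate 5 (Gen 0))"
    hence conj: "?b \<otimes> ?a \<otimes> inv ?b = ?a [^] (5::nat)"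
      using r(1,6) word_value_replicate[of f 0 5] by simp
    have "?b \<otimes> (?a \<otimes> ?a) \<otimes> inv ?b = ?a [^] (5::nat) \<otimes> ?a [^] (5::nat)"
      using conj_mult[OF r(2,1,1)] conj by simp
    also have "\<dots> = ?a [^] (8::nat) \<otimes> ?a [^] (2::nat)" using r(1) by (simp add: nat_pow_mult)
    also have "\<dots> = ?a \<otimes> ?a" using r(1,4) * by (simp add: pow_2)
    finally have "?b \<otimes> (?a \<otimes> ?a) = (?a \<otimes> ?a) \<otimes> ?b" using conj_eq_iff[of ?b "?a \<otimes> ?a" "?a \<otimes> ?a"] r(1,2) by simp
    moreover have "?b \<otimes> ?b = \<one>" using r(2,5) * by (simp add: pow_2)
    ultimately show ?thesis using r(1) by simp
  qed
  note c = conjunct1[OF this] conjunct2[OF this]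
  have aZ: "?a \<otimes> ?a \<in> center G"
    using c(1) r(1,2) by (intro mem_center_of_generators[OF S r(3)]) (auto simp: m_assoc)
  have bZ: "?b \<otimes> ?b \<in> center G"
    using c(2) r(1,2) by (intro mem_center_of_generators[OF S r(3)]) (auto simp: m_assoc)
  show ?thesis
  proof (rule order_le_4_center[OF r(1,2) aZ bZ])
    have a: "?a \<in> insert ?a (center G)" by simp
    have "word_value G f w \<in> generate G (insert ?a (center G))"
      using w r(1) center_subset[of G] by (intro word_value_mem_generate) auto
    thus "?b \<otimes> ?a \<otimes> inv ?b \<in> generate G (insert ?a (center G))" using r(6) by simp
    show "carrier G \<subseteq> generate G (insert ?b (insert ?a (center G)))"
      unfolding r(3)[symmetric] by (intro mono_generate) auto
  qed
qed

lemma small_centralizers_of_order_16: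
  assumes "order G \<le> 16" and "order G \<le> 4 * card (center G)"
  shows "small_centralizers G"
  using assms by (intro small_centralizers_of_order) linarith

end

section \<open>The theorem\<close>

lemma presented_group_eqs:
  "C4xC2_semidirect_C2 = presented_group central_commutator_relators"
  "C4_semidirect_C4 = presented_group (metacyclic_relators 4 4 0 [Inv 0])"
  "C8_semidirect_C2 = presented_group (metacyclic_relators 8 2 0 (replicate 5 (Gen 0)))"
  by (simp_all add: C4xC2_semidirect_C2_def C4_semidirect_C4_def C8_semidirect_C2_def
      central_commutator_relators_def metacyclic_relators_def Let_def eval_nat_numeral)

lemma (in group) iso_metacyclic:
  assumes "satisfies_presentation G f (metacyclic_relators n m k w)"
    and "satisfies_presentation H g (metacyclic_relators n m k w)" "group H"
    and "0 < n" "0 < m" "set w \<subseteq> {Gen 0, Inv 0}" "order G = n * m" "order H = n * m"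
  shows "G \<cong> H"
  using iso_by_presentation[OF assms(1-3) presented_group_metacyclic_card[OF assms(4-6)] assms(7,8)] .

lemma (in group) iso_extension:
  assumes "satisfies_presentation G f (extension_relators k m l u w)"
    and "satisfies_presentation H g (extension_relators k m l u w)" "group H"
    and "0 < m" "set u \<union> set w \<subseteq> {Gen 0, Inv 0, Gen 1, Inv 1}" "order G = m * 8" "order H = m * 8"
  shows "G \<cong> H"
  using iso_by_presentation[OF assms(1-3) presented_group_extension_card[OF assms(4,5)] assms(6,7)] .

lemma direct_product_presentations:
  shows "group (dihedral_group 4 \<times>\<times> integer_mod_group 2)" "order (dihedral_group 4 \<times>\<times> integer_mod_group 2) = 16"
    "\<exists>f. satisfies_presentation (dihedral_group 4 \<times>\<times> integer_mod_group 2) f (extension_relators 0 2 0 [Gen 0] [Gen 1])"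
    "group (quaternion_group \<times>\<times> integer_mod_group 2)" "order (quaternion_group \<times>\<times> integer_mod_group 2) = 16"
    "\<exists>f. satisfies_presentation (quaternion_group \<times>\<times> integer_mod_group 2) f (extension_relators 2 2 0 [Gen 0] [Gen 1])"
proof -
  have D: "group (dihedral_group 4)" unfolding dihedral_group_def by (rule group_inversion_semidirect) simp
  note r = inversion_semidirect_relations[of 4 2, folded dihedral_group_def, simplified]
  have r2: "(0, 1) [^]\<^bsub>dihedral_group 4\<^esub> (2::nat) = (1, 0) [^]\<^bsub>dihedral_group 4\<^esub> (0::nat)" using r(5) by simp
  note P = DirProd_cyclic_presentation[OF D r(1-4) r2 r(6) order.refl]
  show "group (dihedral_group 4 \<times>\<times> integer_mod_group 2)" by (rule P(1))
  show "\<exists>f. satisfies_presentation (dihedral_group 4 \<times>\<times> integer_mod_group 2) f (extension_relators 0 2 0 [Gen 0] [Gen 1])"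
    using P(4) by blast
  note Q = DirProd_cyclic_presentation[OF group_quaternion_group quaternion_relations order.refl]
  show "group (quaternion_group \<times>\<times> integer_mod_group 2)" by (rule Q(1))
  show "\<exists>f. satisfies_presentation (quaternion_group \<times>\<times> integer_mod_group 2) f (extension_relators 2 2 0 [Gen 0] [Gen 1])"
    using Q(4) by blast
  have "card (carrier (dihedral_group 4)) = 8" "card (carrier quaternion_group) = 8"
    using order_inversion_semidirect[of 4 2] order_quaternion_group by (simp_all add: order_def dihedral_group_def)
  thus "order (dihedral_group 4 \<times>\<times> integer_mod_group 2) = 16" "order (quaternion_group \<times>\<times> integer_mod_group 2) = 16"
    by (simp_all add: order_def card_cartesian_product carrier_integer_mod_group)
qed

lemma card_center_order_12:
  "2 \<le> card (center (dihedral_group 6))" "2 \<le> card (center (inversion_semidirect 3 4))"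
proof -
  interpret D: group "inversion_semidirect 6 2" by (rule group_inversion_semidirect) simp
  interpret E: group "inversion_semidirect 3 4" by (rule group_inversion_semidirect) simp
  have fin: "finite (center (inversion_semidirect 6 2))" "finite (center (inversion_semidirect 3 4))"
    by (rule finite_subset[OF center_subset], simp add: carrier_inversion_semidirect)+
  have "(y + (if even l then 3 else - 3)) mod 6 = (3 + y) mod 6" for y l :: int
    using mod_add_self2[of "y - 3" 6] by (simp add: algebra_simps)
  hence "{(0, 0), (3, 0)} \<subseteq> center (inversion_semidirect 6 2)"
    by (auto simp: center_def carrier_inversion_semidirect mult_inversion_semidirect add.commute)
  hence "card {(0, 0), (3, 0) :: int \<times> int} \<le> card (center (inversion_semidirect 6 2))" using fin card_mono by blast
  thus "2 \<le> card (center (dihedral_group 6))" by (simp add: dihedral_group_def)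
  have "{(0, 0), (0, 2)} \<subseteq> center (inversion_semidirect 3 4)"
    by (auto simp: center_def carrier_inversion_semidirect mult_inversion_semidirect add.commute)
  hence "card {(0, 0), (0, 2) :: int \<times> int} \<le> card (center (inversion_semidirect 3 4))" using fin card_mono by blast
  thus "2 \<le> card (center (inversion_semidirect 3 4))" by simp
qed

lemma (in finite_group) order_iso: "G \<cong> H \<Longrightarrow> order G = order H"
  by (simp add: iso_same_card order_def)

lemma (in finite_group) small_centralizers_of_iso:
  assumes "G \<cong> sym_group 3 \<or> G \<cong> dihedral_group 5 \<or> G \<cong> alt_group 4 \<or> G \<cong> GA_1_5 \<or> G \<cong> alt_group 5 \<or>
     G \<cong> dihedral_group 4 \<or> G \<cong> quaternion_group \<or>
     G \<cong> dihedral_group 6 \<or> G \<cong> inversion_semidirect 3 4 \<or> G \<cong> SL_2_3 \<or>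
     G \<cong> C4xC2_semidirect_C2 \<or> G \<cong> C4_semidirect_C4 \<or> G \<cong> C8_semidirect_C2 \<or>
     G \<cong> dihedral_group 4 \<times>\<times> integer_mod_group 2 \<or>
     G \<cong> quaternion_group \<times>\<times> integer_mod_group 2 \<or>
     G \<cong> D8_central_product_C4"
  shows "small_centralizers G"
proof -
  have z: "1 \<le> card (center G)" using card_subgroup_pos[OF center_subgroup] by simp
  have small_order: "small_centralizers G" if "G \<cong> H" "order H \<le> 10" for H :: "'c monoid"
    using order_iso[OF that(1)] that(2) z by (intro small_centralizers_of_order) linarith
  have order_12: "small_centralizers G" if "G \<cong> H" "order H = 12" "2 \<le> card (center H)" for H :: "'c monoid"
    using order_iso[OF that(1)] card_center_iso[OF that(1)] that(2,3) by (intro small_centralizers_of_order) linarith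
  have ext: "small_centralizers G" if iso: "G \<cong> H" and H: "group H" "order H = 16"
    "\<exists>g. satisfies_presentation H g (extension_relators k 2 l [Gen 0] [Gen 1])" and k: "k = 0 \<or> k = 2"
    for H :: "'c monoid" and k l
  proof -
    obtain g where g: "satisfies_presentation H g (extension_relators k 2 l [Gen 0] [Gen 1])" using H(3) by blast
    have fin: "finite (carrier (presented_group (extension_relators k 2 l [Gen 0] [Gen 1])))"
      "card (carrier (presented_group (extension_relators k 2 l [Gen 0] [Gen 1]))) \<le> order H"
      using presented_group_extension_card[of 2 "[Gen 0]" "[Gen 1]" k l] H(2) by simp_all
    have "H \<cong> presented_group (extension_relators k 2 l [Gen 0] [Gen 1])"
      using group.iso_sym[OF group_presented_group group.iso_presented_group[OF H(1) g fin]] .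
    hence "G \<cong> presented_group (extension_relators k 2 l [Gen 0] [Gen 1])" using iso iso_trans by blast
    then obtain f where "satisfies_presentation G f (extension_relators k 2 l [Gen 0] [Gen 1])"
      by (rule satisfies_presentation_of_iso)
    thus ?thesis
      using order_le_4_center_extension[OF _ k] order_iso[OF iso] H(2) by (intro small_centralizers_of_order_16) auto
  qed
  have presented: "small_centralizers G" if iso: "G \<cong> presented_group R" and card: "card (carrier (presented_group R)) \<le> 16"
    and center: "\<And>f. satisfies_presentation G f R \<Longrightarrow> order G \<le> 4 * card (center G)"
    for R :: "('x group_word \<times> 'x group_word) set"
  proof -
    obtain f where "satisfies_presentation G f R" using satisfies_presentation_of_iso[OF iso] .
    thus ?thesis using center card order_iso[OF iso] by (intro small_centralizers_of_order_16) (auto simp: order_def)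
  qed
  from assms show ?thesis
  proof (elim disjE)
    assume "G \<cong> sym_group 3" thus ?thesis
      by (rule small_order) (simp add: order_def sym_group_card_carrier fact_numeral)
  next
    assume "G \<cong> dihedral_group 5" thus ?thesis
      by (rule small_order) (simp add: dihedral_group_def order_inversion_semidirect)
  next
    assume "G \<cong> alt_group 4" thus ?thesis
      using small_centralizers_iso small_centralizers_alt_group[of 4] by auto
  next
    assume "G \<cong> GA_1_5" thus ?thesis
      using small_centralizers_iso small_centralizer_group.small[OF small_centralizer_group_GA_1_5] by blast
  next
    assume "G \<cong> alt_group 5" thus ?thesis
      using small_centralizers_iso small_centralizers_alt_group[of 5] by auto
  next
    assume "G \<cong> dihedral_group 4" thus ?thesis
      by (rule small_order) (simp add: dihedral_group_def order_inversion_semidirect)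
  next
    assume "G \<cong> quaternion_group" thus ?thesis
      by (rule small_order) (simp add: order_quaternion_group)
  next
    assume "G \<cong> dihedral_group 6" thus ?thesis
      by (rule order_12) (simp_all add: card_center_order_12, simp add: dihedral_group_def order_inversion_semidirect)
  next
    assume "G \<cong> inversion_semidirect 3 4" thus ?thesis
      by (rule order_12) (simp_all add: order_inversion_semidirect card_center_order_12)
  next
    assume "G \<cong> SL_2_3" thus ?thesis
      using small_centralizers_iso small_centralizer_group.small[OF small_centralizer_group_SL_2_3] by blast
  next
    assume "G \<cong> C4xC2_semidirect_C2" thus ?thesis
      unfolding presented_group_eqs
      by (rule presented[OF _ presented_group_central_commutator_card(2) order_le_4_center_central_commutator])
  next
    assume "G \<cong> C4_semidirect_C4" thus ?thesis
      unfolding presented_group_eqs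
      by (rule presented) (use presented_group_metacyclic_card[of 4 4 "[Inv 0]" 0] order_le_4_center_metacyclic in auto)
  next
    assume "G \<cong> C8_semidirect_C2" thus ?thesis
      unfolding presented_group_eqs
      by (rule presented)
        (use presented_group_metacyclic_card[of 8 2 "replicate 5 (Gen 0)" 0] order_le_4_center_metacyclic in auto)
  next
    assume "G \<cong> dihedral_group 4 \<times>\<times> integer_mod_group 2" thus ?thesis
      by (rule ext[OF _ direct_product_presentations(1-3)]) simp
  next
    assume "G \<cong> quaternion_group \<times>\<times> integer_mod_group 2" thus ?thesis
      by (rule ext[OF _ direct_product_presentations(4-6)]) simp
  next
    assume "G \<cong> D8_central_product_C4" thus ?thesis
      by (rule ext[OF _ D8_central_product_C4_presentation]) simp
  qed
qed

lemma (in small_centralizer_group) iso_of_small_centralizers: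
  "G \<cong> sym_group 3 \<or> G \<cong> dihedral_group 5 \<or> G \<cong> alt_group 4 \<or> G \<cong> GA_1_5 \<or> G \<cong> alt_group 5 \<or>
     G \<cong> dihedral_group 4 \<or> G \<cong> quaternion_group \<or>
     G \<cong> dihedral_group 6 \<or> G \<cong> inversion_semidirect 3 4 \<or> G \<cong> SL_2_3 \<or>
     G \<cong> C4xC2_semidirect_C2 \<or> G \<cong> C4_semidirect_C4 \<or> G \<cong> C8_semidirect_C2 \<or>
     G \<cong> dihedral_group 4 \<times>\<times> integer_mod_group 2 \<or>
     G \<cong> quaternion_group \<times>\<times> integer_mod_group 2 \<or>
     G \<cong> D8_central_product_C4"
proof -
  have inversion: "G \<cong> inversion_semidirect n m"
    if "order G = n * m" "\<exists>f. satisfies_presentation G f (metacyclic_relators n m 0 [Inv 0])" "2 \<le> n" "even m" "0 < m" for n m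
    using that satisfies_inversion_semidirect[of n m] group_inversion_semidirect[of m n] order_inversion_semidirect[of n m]
    by (auto intro: iso_metacyclic)
  have extension: "G \<cong> H"
    if "\<exists>f. satisfies_presentation G f (extension_relators k m l u w)" "\<exists>g. satisfies_presentation H g (extension_relators k m l u w)"
      "group H" "0 < m" "set u \<union> set w \<subseteq> {Gen 0, Inv 0, Gen 1, Inv 1}" "order G = m * 8" "order H = m * 8"
    for H :: "'c monoid" and k m l u w
    using that iso_extension by blast
  have presented: "G \<cong> presented_group R"
    if "\<exists>f. satisfies_presentation G f R" "finite (carrier (presented_group R))"
      "card (carrier (presented_group R)) \<le> order G" for R :: "('x group_word \<times> 'x group_word) set"
  proof -
    obtain f where f: "satisfies_presentation G f R" using \<open>\<exists>f. satisfies_presentation G f R\<close> by blast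
    show ?thesis using group.iso_sym[OF group_presented_group iso_presented_group[OF f that(2,3)]] .
  qed
  interpret GA: small_centralizer_group GA_1_5 by (rule small_centralizer_group_GA_1_5)
  interpret SL: small_centralizer_group SL_2_3 by (rule small_centralizer_group_SL_2_3)
  \<comment> \<open>The orders of these two groups leave a single case of the classification, which provides
    generators and relations for them.\<close>
  have GA: "\<exists>f. satisfies_presentation GA_1_5 f (metacyclic_relators 5 4 0 [Gen 0, Gen 0])"
    using GA.classification by (simp add: order_GA_1_5)
  have SL: "\<exists>f. satisfies_presentation SL_2_3 f (extension_relators 2 3 0 [Gen 1] [Gen 0, Gen 1])"
    using SL.classification by (simp add: order_SL_2_3)
  from classification show ?thesis
  proof (elim disjE conjE)
    assume "order G = 10" "\<exists>f. satisfies_presentation G f (metacyclic_relators 5 2 0 [Inv 0])"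
    hence "G \<cong> dihedral_group 5" unfolding dihedral_group_def by (intro inversion) simp_all
    thus ?thesis by blast
  next
    assume "order G = 20" "\<exists>f. satisfies_presentation G f (metacyclic_relators 5 4 0 [Gen 0, Gen 0])"
    hence "G \<cong> GA_1_5" using GA GA.is_group order_GA_1_5 by (auto intro: iso_metacyclic)
    thus ?thesis by blast
  next
    assume "order G = 8" "\<exists>f. satisfies_presentation G f (metacyclic_relators 4 2 0 [Inv 0])"
    hence "G \<cong> dihedral_group 4" unfolding dihedral_group_def by (intro inversion) simp_all
    thus ?thesis by blast
  next
    assume "order G = 8" "\<exists>f. satisfies_presentation G f (metacyclic_relators 4 2 2 [Inv 0])"
    hence "G \<cong> quaternion_group"
      using satisfies_quaternion_group group_quaternion_group order_quaternion_group by (auto intro: iso_metacyclic)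
    thus ?thesis by blast
  next
    assume "order G = 12" "\<exists>f. satisfies_presentation G f (metacyclic_relators 6 2 0 [Inv 0])"
    hence "G \<cong> dihedral_group 6" unfolding dihedral_group_def by (intro inversion) simp_all
    thus ?thesis by blast
  next
    assume "order G = 12" "\<exists>f. satisfies_presentation G f (metacyclic_relators 3 4 0 [Inv 0])"
    hence "G \<cong> inversion_semidirect 3 4" by (intro inversion) simp_all
    thus ?thesis by blast
  next
    assume "order G = 24" "\<exists>f. satisfies_presentation G f (extension_relators 2 3 0 [Gen 1] [Gen 0, Gen 1])"
    hence "G \<cong> SL_2_3" using SL SL.is_group order_SL_2_3 by (intro extension) auto
    thus ?thesis by blast
  next
    assume "order G = 16" "\<exists>f. satisfies_presentation G f (extension_relators 0 2 0 [Gen 0] [Gen 1])"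
    hence "G \<cong> dihedral_group 4 \<times>\<times> integer_mod_group 2"
      using direct_product_presentations by (intro extension) auto
    thus ?thesis by blast
  next
    assume "order G = 16" "\<exists>f. satisfies_presentation G f (extension_relators 2 2 0 [Gen 0] [Gen 1])"
    hence "G \<cong> quaternion_group \<times>\<times> integer_mod_group 2"
      using direct_product_presentations by (intro extension) auto
    thus ?thesis by blast
  next
    assume "order G = 16" "\<exists>f. satisfies_presentation G f (extension_relators 0 2 2 [Gen 0] [Gen 1])"
    hence "G \<cong> D8_central_product_C4"
      using D8_central_product_C4_presentation by (intro extension) auto
    thus ?thesis by blast
  next
    assume "order G = 16" "\<exists>f. satisfies_presentation G f central_commutator_relators"
    hence "G \<cong> C4xC2_semidirect_C2"
      unfolding presented_group_eqs using presented_group_central_commutator_card by (intro presented) simp_all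
    thus ?thesis by blast
  next
    assume "order G = 16" "\<exists>f. satisfies_presentation G f (metacyclic_relators 4 4 0 [Inv 0])"
    hence "G \<cong> C4_semidirect_C4"
      unfolding presented_group_eqs using presented_group_metacyclic_card[of 4 4 "[Inv 0]" 0]
      by (intro presented) simp_all
    thus ?thesis by blast
  next
    assume "order G = 16" "\<exists>f. satisfies_presentation G f (metacyclic_relators 8 2 0 (replicate 5 (Gen 0)))"
    hence "G \<cong> C8_semidirect_C2"
      unfolding presented_group_eqs using presented_group_metacyclic_card[of 8 2 "replicate 5 (Gen 0)" 0]
      by (intro presented) simp_all
    thus ?thesis by blast
  qed simp_all
qed

theorem corollary1p3:
  fixes G :: "('a, 'm) monoid_scheme"
  assumes "group G" and "finite (carrier G)" and "\<not> comm_group G"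
  shows "max_degree (commuting_graph G) < 4 \<longleftrightarrow>
     G \<cong> sym_group 3 \<or> G \<cong> dihedral_group 5 \<or> G \<cong> alt_group 4 \<or> G \<cong> GA_1_5 \<or> G \<cong> alt_group 5 \<or>
     G \<cong> dihedral_group 4 \<or> G \<cong> quaternion_group \<or>
     G \<cong> dihedral_group 6 \<or> G \<cong> inversion_semidirect 3 4 \<or> G \<cong> SL_2_3 \<or>
     G \<cong> C4xC2_semidirect_C2 \<or> G \<cong> C4_semidirect_C4 \<or> G \<cong> C8_semidirect_C2 \<or>
     G \<cong> dihedral_group 4 \<times>\<times> integer_mod_group 2 \<or>
     G \<cong> quaternion_group \<times>\<times> integer_mod_group 2 \<or>
     G \<cong> D8_central_product_C4"
proof -
  interpret finite_group G
    using assms(1,2) by (simp add: finite_group_def finite_group_axioms_def)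
  have "small_centralizer_group G" if "small_centralizers G"
    using that assms(3) finite_group_axioms by (simp add: small_centralizer_group_def small_centralizer_group_axioms_def)
  thus ?thesis
    unfolding max_degree_commuting_graph_less_4_iff[OF assms]
    using small_centralizers_of_iso small_centralizer_group.iso_of_small_centralizers by blast
qed

end
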